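(* Let $m\geq 2$ and $k\geq 3$ be fixed integers. Then there exists a constant $C$ depending only on $m$ and $k$ such that for every positive integer $n$ there exists a $k$-colored sum-free set in $\mathbb{Z}_m^n$ of size at least $(\Gamma_{m,k})^{\,n-C\sqrt{n}}$. (That is, there exists a $k$-colored sum-free set in $\mathbb{Z}_m^n$ of size at least $(\Gamma_{m,k})^{n-O(\sqrt n)}$, where the implied constant may depend on $m$ and $k$.)
   Context: $\mathbb{Z}_m=\mathbb{Z}/m\mathbb{Z}$. For an abelian group $G$ and $k\geq 3$, a $k$-colored sum-free set in $G$ is a collection of $k$-tuples $(x_{1,j},x_{2,j},\dots,x_{k,j})_{j=1}^L$ of elements of $G$ such that for all $j_1,\dots,j_k\in\{1,\dots,L\}$: $x_{1,j_1}+x_{2,j_2}+\dots+x_{k,j_k}=0$ if and only if $j_1=j_2=\dots=j_k$. Its size is $L$, the number of $k$-tuples. For integers $m\geq 2$ and $k\geq 3$, $$\Gamma_{m,k}=\min_{0<\gamma<1}\frac{1+\gamma+\dots+\gamma^{m-1}}{\gamma^{(m-1)/k}}$$ (the minimum is attained). *)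

theory Defs
  imports "HOL-Analysis.Analysis" "HOL-Algebra.FiniteProduct" "HOL-Algebra.Elementary_Groups" "HOL-Algebra.Product_Groups"
begin

definition Zmod_power :: "nat \<Rightarrow> nat \<Rightarrow> (nat \<Rightarrow> int) monoid" where
  "Zmod_power m n = product_group {1..n} (\<lambda>_. integer_mod_group m)"

lemma comm_group_Zmod_power: "comm_group (Zmod_power m n)"
proof (rule group.group_comm_groupI)
  show "group (Zmod_power m n)"
    unfolding Zmod_power_def by simp
qed (auto simp: Zmod_power_def add.commute)

(* The tuples are (x 1 j, ..., x k j) for j = 1, ..., L. The group is written multiplicatively in
   HOL-Algebra, so x_1 + ... + x_k is finprod and 0 is the unit of G. *)
definition colored_sum_free_set ::
  "('a, 'b) monoid_scheme \<Rightarrow> nat \<Rightarrow> nat \<Rightarrow> (nat \<Rightarrow> nat \<Rightarrow> 'a) \<Rightarrow> bool" where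
  "colored_sum_free_set G k L x \<longleftrightarrow>
     (\<forall>i\<in>{1..k}. \<forall>j\<in>{1..L}. x i j \<in> carrier G) \<and>
     (\<forall>js \<in> {1..k} \<rightarrow> {1..L}.
        finprod G (\<lambda>i. x i (js i)) {1..k} = \<one>\<^bsub>G\<^esub> \<longleftrightarrow>
        (\<forall>i\<in>{1..k}. \<forall>i'\<in>{1..k}. js i = js i'))"

definition Gamma_fun :: "nat \<Rightarrow> nat \<Rightarrow> real \<Rightarrow> real" where
  "Gamma_fun m k g = (\<Sum>i<m. g ^ i) / g powr ((real m - 1) / real k)"

(* LEAST denotes the minimum of the set of values; it exists for m \<ge> 2 and k \<ge> 3, see
   Gamma_min_attained below. *)
definition Gamma_min :: "nat \<Rightarrow> nat \<Rightarrow> real" where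
  "Gamma_min m k = (LEAST v. v \<in> Gamma_fun m k ` {0<..<1})"

lemma Gamma_fun_has_min:
  assumes m: "m \<ge> 2" and k: "k \<ge> 3"
  shows "\<exists>c\<in>{0<..<1}. \<forall>g\<in>{0<..<1}. Gamma_fun m k c \<le> Gamma_fun m k g"
proof -
  define a where "a = (real m - 1) / real k"
  have a: "a > 0" using m k by (simp add: a_def)
  let ?f = "Gamma_fun m k"
  have f: "?f = (\<lambda>g. (\<Sum>i<m. g ^ i) / g powr a)"
    by (rule ext) (simp add: Gamma_fun_def a_def)
  have f1: "?f 1 = real m" by (simp add: f)
  have S: "(\<Sum>i<m. real i) = real m * (real m - 1) / 2"
    by (induction m) (auto simp: field_simps)
  have D0: "((\<lambda>g::real. \<Sum>i<m. g ^ i) has_real_derivative (\<Sum>i<m. real i)) (at 1)"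
    by (auto intro!: derivative_eq_intros)
  have D1: "((\<lambda>g::real. g powr a) has_real_derivative a) (at 1)"
    by (auto intro!: derivative_eq_intros)
  have D: "(?f has_real_derivative (\<Sum>i<m. real i) - real m * a) (at 1)"
    unfolding f using DERIV_divide[OF D0 D1] by simp
  have "real m * a < real m * ((real m - 1) / 2)"
    unfolding a_def using m k by (intro mult_strict_left_mono divide_strict_left_mono) auto
  then have "(\<Sum>i<m. real i) - real m * a > 0" by (simp add: S)
  from DERIV_pos_inc_left[OF D this] obtain d where
    d: "d > 0" "\<And>h. h > 0 \<Longrightarrow> h < d \<Longrightarrow> ?f (1 - h) < ?f 1" by auto
  define g0 where "g0 = 1 - min (d/2) (1/2)"
  have g0: "0 < g0" "g0 < 1" "?f g0 < real m"
    using d(1) d(2)[of "min (d/2) (1/2)"] f1 by (auto simp: g0_def min_def)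
  define e where "e = min g0 (real m powr (- 1 / a))"
  have e: "0 < e" "e \<le> g0" using g0 m by (auto simp: e_def)
  have low: "?f g \<ge> real m" if g: "0 < g" "g < e" for g
  proof -
    have "g powr a \<le> (real m powr (- 1 / a)) powr a"
      using g a by (intro powr_mono2) (auto simp: e_def)
    also have "\<dots> = 1 / real m"
      using a m by (subst powr_powr) (simp add: powr_minus_divide)
    finally have "g powr a * real m \<le> 1" using m by (simp add: field_simps)
    moreover have "1 \<le> (\<Sum>i<m. g ^ i)"
    proof -
      have "(\<Sum>i\<in>{0}. g ^ i) \<le> (\<Sum>i<m. g ^ i)"
        using g m by (intro sum_mono2) auto
      then show ?thesis by simp
    qed
    ultimately show ?thesis using g by (simp add: f field_simps)
  qed
  have "continuous_on {e..1} ?f"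
    unfolding f using e by (intro continuous_intros) auto
  then obtain c where c: "c \<in> {e..1}" "\<And>g. g \<in> {e..1} \<Longrightarrow> ?f c \<le> ?f g"
    using continuous_attains_inf[of "{e..1}" ?f] e g0 by fastforce
  have "?f c \<le> ?f g0" using c(2)[of g0] e g0 by auto
  then have fc: "?f c < real m" using g0 by simp
  then have "c \<noteq> 1" using f1 by auto
  then have "c \<in> {0<..<1}" using c(1) e by auto
  moreover have "?f c \<le> ?f g" if "g \<in> {0<..<1}" for g
    using low[of g] c(2)[of g] fc that by (cases "g < e") auto
  ultimately show ?thesis by blast
qed

lemma Gamma_min_attained:
  assumes "m \<ge> 2" and "k \<ge> 3"
  shows "Gamma_min m k \<in> Gamma_fun m k ` {0<..<1}"
    and "\<And>g. 0 < g \<Longrightarrow> g < 1 \<Longrightarrow> Gamma_min m k \<le> Gamma_fun m k g"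
proof -
  obtain c where c: "c \<in> {0<..<1}" "\<forall>g\<in>{0<..<1}. Gamma_fun m k c \<le> Gamma_fun m k g"
    using Gamma_fun_has_min[OF assms] by blast
  have "Gamma_min m k = Gamma_fun m k c"
    unfolding Gamma_min_def using c by (intro Least_equality) auto
  then show "Gamma_min m k \<in> Gamma_fun m k ` {0<..<1}"
    and "\<And>g. 0 < g \<Longrightarrow> g < 1 \<Longrightarrow> Gamma_min m k \<le> Gamma_fun m k g"
    using c by auto
qed

end

theory Submission
  imports Defs
begin

text \<open>
  Let \<open>N = m - 1\<close> and let \<open>\<psi>\<close> be the truncated geometric distribution on \<open>{0..N}\<close> whose ratio minimises
  \<open>Gamma_fun m k\<close>; it has mean \<open>N / k\<close> and entropy \<open>ln \<Gamma>\<close>. Since \<open>\<psi>\<close> is decreasing, it is the marginal of a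
  distribution on the \<open>k\<close>-tuples of natural numbers with sum \<open>N\<close>: the residual of the closest attainable
  marginal is forced to vanish by moving units between the parts of optimal tuples. By convex duality
  there are Gibbs distributions on these tuples with marginals arbitrarily close to \<open>\<psi>\<close>.

  The words of a fixed symmetric type over the tuples give families of solutions of
  \<open>x\<^sub>1 + \<dots> + x\<^sub>k = (N, \<dots>, N)\<close> in \<open>{0..N}\<^sup>n\<close>, and such sums may be taken modulo \<open>m\<close>, because the total digit
  sum is fixed. A random affine hash into \<open>\<int> / q\<close>, combined with a Behrend set, thins these solutions out
  until most of the survivors share no component with another survivor. Two solutions sharing a component
  survive together with a probability determined by the lattice generated by their differences, and the
  number of solutions with differences in a given lattice is controlled by a supermodularity argument
  that uses the symmetry of the type. The size of the Behrend set is the source of the loss \<open>O(\<surd>n)\<close>.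
\<close>

section \<open>Compositions with prescribed marginals\<close>

text \<open>Why Gibbs distributions: the product of the weights over all positions depends only on
  the digit counts of the components, so it is constant on \<open>solutions\<close>. A type that is
  popular under these weights makes \<open>words\<close> a polynomial fraction of
  \<open>solutions\<close>; for an arbitrary coupling with the same marginals, other solutions built
  from the same components could outnumber \<open>words\<close> exponentially.

  Why the count comes out right: let \<open>deg\<close> bound the number of words through one
  component. Under \<psi> every component has the same probability \<Gamma>^(-n), so
  \<open>card words / deg\<close> is about \<Gamma>^n. A solution survives hashing with probability
  at least \<open>card S / q^(k-1)\<close>, about q^(2-k) for a Behrend set; with q about
  deg^(1/(k-2)) this leaves about \<open>card words / deg\<close> survivors.

  The obstacle: given that a solution survives, a partner whose differences generate a subgroup of
  order z modulo q is only known to survive with probability at most 1/z, and z may be far below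
  q^(k-2). Such partners must be correspondingly rare: about z^h, where q^(h(k-2)) = deg.

  The modulus is 1 plus a multiple of (2N)!, which makes all small digit differences units.\<close>

definition compositions :: "nat \<Rightarrow> nat \<Rightarrow> (nat \<Rightarrow> nat) set" where
  "compositions k N = {a. (\<forall>i\<ge>k. a i = 0) \<and> (\<Sum>i<k. a i) = N}"

lemma compositions_le:
  assumes "a \<in> compositions k N"
  shows "a i \<le> N"
proof (cases "i < k")
  case True
  then have "a i \<le> (\<Sum>i<k. a i)" by (intro member_le_sum) auto
  then show ?thesis using assms by (simp add: compositions_def)
qed (use assms in \<open>auto simp: compositions_def\<close>)

lemma finite_compositions [simp]: "finite (compositions k N)"
proof (rule finite_subset)
  show "compositions k N \<subseteq> {a. \<forall>i. (i \<in> {..<k} \<longrightarrow> a i \<in> {..N}) \<and> (i \<notin> {..<k} \<longrightarrow> a i = 0)}"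
    using compositions_le by (auto simp: compositions_def)
qed (rule finite_set_of_finite_funs, auto)

text \<open>Greedy choice, starting with the last part. It turns upper bounds on the single parts
  into a competitor for the optimality argument in \<open>coupling\<close>.\<close>

lemma compositions_below:
  assumes "N \<le> (\<Sum>i<k. u i)"
  obtains a where "a \<in> compositions k N" "\<And>i. a i \<le> u i"
proof -
  have "\<exists>a\<in>compositions k N. \<forall>i. a i \<le> u i" using assms
  proof (induction k arbitrary: N)
    case (Suc k)
    define c where "c = min N (u k)"
    have "N - c \<le> (\<Sum>i<k. u i)" using Suc.prems by (auto simp: c_def)
    from Suc.IH[OF this] obtain a where a: "a \<in> compositions k (N - c)" "\<forall>i. a i \<le> u i"
      by blast
    then have "a(k := c) \<in> compositions (Suc k) N"
      by (auto simp: compositions_def c_def)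
    moreover have "\<forall>i. (a(k := c)) i \<le> u i" using a by (auto simp: c_def)
    ultimately show ?case by blast
  qed (auto simp: compositions_def intro!: exI[of _ "\<lambda>_. 0"])
  then show ?thesis using that by blast
qed

lemma compositions_nonempty: "k \<ge> 1 \<Longrightarrow> compositions k N \<noteq> {}"
  using compositions_below[of N "\<lambda>_. N" k] by fastforce

lemma compositions_transfer:
  assumes "a \<in> compositions k N" "i < k" "h < k" "i \<noteq> h" "a h \<ge> 1"
  shows "a(i := Suc (a i), h := a h - 1) \<in> compositions k N"
proof -
  have *: "(\<Sum>j<k. b j) = b i + b h + (\<Sum>j\<in>{..<k} - {i, h}. b j)" for b :: "nat \<Rightarrow> nat"
    using assms by (subst sum.subset_diff[of "{i, h}"]) auto
  have "(\<Sum>j\<in>{..<k} - {i, h}. (a(i := Suc (a i), h := a h - 1)) j) = (\<Sum>j\<in>{..<k} - {i, h}. a j)"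
    by (rule sum.cong) auto
  then show ?thesis using assms *[of a] *[of "a(i := Suc (a i), h := a h - 1)"]
    by (auto simp: compositions_def)
qed

definition part_count :: "nat \<Rightarrow> (nat \<Rightarrow> nat) \<Rightarrow> nat \<Rightarrow> real" where
  "part_count k a v = real (card {i. i < k \<and> a i = v})"

lemma sum_part_count:
  assumes "a \<in> compositions k N"
  shows "(\<Sum>v\<le>N. g v * part_count k a v) = (\<Sum>i<k. g (a i))"
proof -
  have "part_count k a v = (\<Sum>i<k. if a i = v then 1 else 0)" for v
    by (simp add: part_count_def sum.If_cases lessThan_def Int_def conj_commute)
  then have "(\<Sum>v\<le>N. g v * part_count k a v) = (\<Sum>v\<le>N. \<Sum>i<k. g v * (if a i = v then 1 else 0))"
    by (simp add: sum_distrib_left)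
  also have "\<dots> = (\<Sum>i<k. \<Sum>v\<le>N. g v * (if a i = v then 1 else 0))" by (rule sum.swap)
  also have "\<dots> = (\<Sum>i<k. g (a i))"
  proof (rule sum.cong)
    fix i assume "i \<in> {..<k}"
    have "(\<Sum>v\<le>N. g v * (if a i = v then 1 else 0)) = (\<Sum>v\<le>N. if v = a i then g v else 0)"
      by (rule sum.cong) auto
    also have "\<dots> = g (a i)" using compositions_le[OF assms] by simp
    finally show "(\<Sum>v\<le>N. g v * (if a i = v then 1 else 0)) = g (a i)" .
  qed simp
  finally show ?thesis .
qed

text \<open>The expected number of parts equal to \<open>v\<close>, that is, the sum of the
  \<open>k\<close> marginals. Working with this sum avoids any symmetry assumption on
  \<open>p\<close>.\<close>

definition mean_count :: "nat \<Rightarrow> nat \<Rightarrow> ((nat \<Rightarrow> nat) \<Rightarrow> real) \<Rightarrow> nat \<Rightarrow> real" where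
  "mean_count k N p v = (\<Sum>a\<in>compositions k N. p a * part_count k a v)"

lemma sum_mean_count:
  "(\<Sum>v\<le>N. g v * mean_count k N p v) = (\<Sum>a\<in>compositions k N. p a * (\<Sum>i<k. g (a i)))"
proof -
  have "(\<Sum>v\<le>N. g v * mean_count k N p v)
      = (\<Sum>v\<le>N. \<Sum>a\<in>compositions k N. p a * (g v * part_count k a v))"
    by (simp add: mean_count_def sum_distrib_left algebra_simps)
  also have "\<dots> = (\<Sum>a\<in>compositions k N. \<Sum>v\<le>N. p a * (g v * part_count k a v))"
    by (rule sum.swap)
  also have "\<dots> = (\<Sum>a\<in>compositions k N. p a * (\<Sum>i<k. g (a i)))"
    by (intro sum.cong refl) (simp add: sum_distrib_left[symmetric] sum_part_count)
  finally show ?thesis .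
qed

text \<open>Boxes in the product topology are compact by Tychonoff's theorem. The index type may be
  infinite; irrelevant coordinates are pinned in the applications by taking
  \<open>l i = u i\<close>.\<close>

lemma continuous_attains_inf_box:
  fixes \<Phi> :: "('a \<Rightarrow> real) \<Rightarrow> real"
  assumes "closed C" "C \<subseteq> {x. \<forall>i. x i \<in> {l i..u i}}" "C \<noteq> {}" "continuous_on C \<Phi>"
  shows "\<exists>x\<in>C. \<forall>y\<in>C. \<Phi> x \<le> \<Phi> y"
proof (rule continuous_attains_inf)
  have "compactin (product_topology (\<lambda>i. euclidean) UNIV) (PiE UNIV (\<lambda>i. {l i..u i}))"
    by (simp add: compactin_PiE)
  then have "compact (PiE UNIV (\<lambda>i. {l i..u i}))"
    by (simp add: euclidean_product_topology)
  moreover have "PiE UNIV (\<lambda>i. {l i..u i}) = {x. \<forall>i. x i \<in> {l i..u i}}" by (auto simp: PiE_def Pi_def)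
  ultimately show "compact C"
    using assms(1,2) by (metis compact_Int_closed inf.absorb_iff2)
qed (use assms in auto)

section \<open>A decreasing law with mean N/k is a marginal of a law on compositions\<close>

locale mean_target =
  fixes k N :: nat and \<psi> :: "nat \<Rightarrow> real"
  assumes k_pos: "k \<ge> 1" and N_pos: "N \<ge> 1"
    and decseq_psi: "\<And>v. v < N \<Longrightarrow> \<psi> (Suc v) \<le> \<psi> v"
    and psi_nonneg: "\<And>v. v \<le> N \<Longrightarrow> \<psi> v \<ge> 0"
    and sum_psi: "(\<Sum>v\<le>N. \<psi> v) = 1"
    and mean_psi: "real k * (\<Sum>v\<le>N. real v * \<psi> v) = real N"
begin

abbreviation T where "T \<equiv> compositions k N"

definition residual :: "((nat \<Rightarrow> nat) \<Rightarrow> real) \<Rightarrow> nat \<Rightarrow> real" where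
  "residual p v = real k * \<psi> v - mean_count k N p v"

text \<open>First-order optimality for the least squared norm of \<open>residual\<close> over all
  probability vectors on \<open>T\<close>: the residual is an outer normal of the polytope of
  attainable counts, so no single composition beats the average.\<close>

lemma closest_point:
  obtains p where "\<And>a. p a \<ge> 0" "sum p T = 1"
    "\<And>a. a \<in> T \<Longrightarrow> (\<Sum>i<k. residual p (a i)) \<le> (\<Sum>v\<le>N. residual p v * mean_count k N p v)"
proof -
  define C where "C = {p :: (nat \<Rightarrow> nat) \<Rightarrow> real. (\<forall>a. p a \<in> {0..(if a \<in> T then 1 else 0)}) \<and> sum p T = 1}"
  define \<Phi> where "\<Phi> p = (\<Sum>v\<le>N. (residual p v)\<^sup>2)" for p
  have cont [continuous_intros]: "continuous_on X (\<lambda>p :: (nat \<Rightarrow> nat) \<Rightarrow> real. p a)" for a X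
    by (rule continuous_on_subset[OF continuous_on_product_coordinates]) auto
  have "\<exists>p\<in>C. \<forall>p'\<in>C. \<Phi> p \<le> \<Phi> p'"
  proof (rule continuous_attains_inf_box[of _ "\<lambda>_. 0" "\<lambda>a. if a \<in> T then 1 else 0"])
    have "closed {p :: (nat \<Rightarrow> nat) \<Rightarrow> real. sum p T = 1}"
      by (intro closed_Collect_eq continuous_intros)
    moreover have "closed {p :: (nat \<Rightarrow> nat) \<Rightarrow> real. \<forall>a. p a \<in> {0..(if a \<in> T then 1 else 0)}}"
      unfolding atLeastAtMost_iff
      by (intro closed_Collect_all closed_Collect_conj closed_Collect_le continuous_intros)
    ultimately show "closed C" unfolding C_def Collect_conj_eq by (rule closed_Int[rotated])
  next
    obtain a0 where "a0 \<in> T" using compositions_nonempty k_pos by blast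
    then have "(\<lambda>a. if a = a0 then 1 else 0) \<in> C" by (auto simp: C_def)
    then show "C \<noteq> {}" by blast
  next
    show "continuous_on C \<Phi>"
      unfolding \<Phi>_def residual_def mean_count_def by (intro continuous_intros)
  qed (auto simp: C_def)
  then obtain p where p: "p \<in> C" and min: "\<And>p'. p' \<in> C \<Longrightarrow> \<Phi> p \<le> \<Phi> p'" by blast
  have opt: "(\<Sum>i<k. residual p (a i)) \<le> (\<Sum>v\<le>N. residual p v * mean_count k N p v)" if a: "a \<in> T" for a
  proof -
    define d where "d v = part_count k a v - mean_count k N p v" for v
    define A where "A = (\<Sum>v\<le>N. residual p v * d v)"
    define B where "B = (\<Sum>v\<le>N. (d v)\<^sup>2)"
    \<comment> \<open>Moving \<open>p\<close> by a fraction \<open>e\<close> towards the point mass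
      at \<open>a\<close> changes the objective by -2eA + e^2 B, which cannot be negative.\<close>
    have step: "2 * A \<le> e * B" if e: "0 < e" "e \<le> 1" for e
    proof -
      define p' where "p' b = (1 - e) * p b + e * (if b = a then 1 else 0)" for b
      have "p' b \<in> {0..(if b \<in> T then 1 else 0)}" for b
      proof -
        have "0 \<le> p b" "p b \<le> (if b \<in> T then 1 else 0)" using p by (auto simp: C_def)
        moreover from this have "(1 - e) * p b \<le> (1 - e) * 1" if "b \<in> T"
          using e that by (intro mult_left_mono) auto
        ultimately show ?thesis using e a by (auto simp: p'_def)
      qed
      moreover have "sum p' T = 1"
        using p a by (simp add: p'_def sum.distrib sum_distrib_left[symmetric] C_def)
      ultimately have p': "p' \<in> C" by (simp add: C_def)
      have "mean_count k N p' v = (1 - e) * mean_count k N p v + e * part_count k a v" for v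
      proof -
        have "mean_count k N p' v = (\<Sum>b\<in>T. (1 - e) * (p b * part_count k b v)
            + (if b = a then e * part_count k b v else 0))"
          unfolding mean_count_def p'_def by (intro sum.cong) (auto simp: algebra_simps)
        then show ?thesis using a by (simp add: sum.distrib sum_distrib_left mean_count_def)
      qed
      then have res: "residual p' v = residual p v - e * d v" for v
        by (simp add: residual_def d_def algebra_simps)
      have "\<Phi> p' = (\<Sum>v\<le>N. (residual p v)\<^sup>2 - 2 * e * (residual p v * d v) + e\<^sup>2 * (d v)\<^sup>2)"
        unfolding \<Phi>_def res by (intro sum.cong) (auto simp: power2_eq_square algebra_simps)
      also have "\<dots> = \<Phi> p - 2 * e * A + e\<^sup>2 * B"
        by (simp add: sum.distrib sum_subtractf \<Phi>_def A_def B_def sum_distrib_left)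
      finally have "e * (2 * A) \<le> e * (e * B)"
        using min[OF p'] by (simp add: power2_eq_square algebra_simps)
      then show ?thesis using e by simp
    qed
    have "A \<le> 0"
    proof (rule ccontr)
      assume "\<not> A \<le> 0"
      moreover have "B \<ge> 0" unfolding B_def by (intro sum_nonneg) auto
      \<comment> \<open>This \<open>e\<close> gives \<open>e * B \<le> A\<close>, against
        \<open>2 * A \<le> e * B\<close> for positive \<open>A\<close>.\<close>
      ultimately have "0 < A / (A + B)" "A / (A + B) \<le> 1" "A / (A + B) * B \<le> A"
        by (auto simp: divide_simps)
      with step[of "A / (A + B)"] \<open>\<not> A \<le> 0\<close> show False by auto
    qed
    then show ?thesis
      using sum_part_count[OF a, of "residual p"]
      by (simp add: A_def d_def algebra_simps sum_subtractf)
  qed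
  show ?thesis
    by (rule that[of p]) (use p opt in \<open>auto simp: C_def\<close>)
qed


text \<open>Target and attained counts both have mass \<open>k\<close> and first moment
  \<open>N\<close>. Hence the residual is orthogonal to all affine functions, which makes a linear
  tilt of it harmless later on.\<close>

lemma sum_residual:
  assumes "sum p T = 1"
  shows "(\<Sum>v\<le>N. residual p v) = 0" "(\<Sum>v\<le>N. real v * residual p v) = 0"
proof -
  have "(\<Sum>v\<le>N. mean_count k N p v) = real k"
    using sum_mean_count[of "\<lambda>_. 1" k N p] assms by (simp add: sum_distrib_right[symmetric])
  then show "(\<Sum>v\<le>N. residual p v) = 0"
    using sum_psi by (simp add: residual_def sum_subtractf sum_distrib_left[symmetric])
  have "(\<Sum>v\<le>N. real v * mean_count k N p v) = (\<Sum>a\<in>T. p a * real N)"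
    unfolding sum_mean_count
    by (intro sum.cong) (auto simp: compositions_def of_nat_sum[symmetric] simp del: of_nat_sum)
  also have "\<dots> = real N" using assms by (simp add: sum_distrib_right[symmetric])
  finally show "(\<Sum>v\<le>N. real v * residual p v) = 0"
    using mean_psi by (simp add: residual_def algebra_simps sum_subtractf sum_distrib_left)
qed

text \<open>Abel summation. It converts a weighted total of the drops of \<open>mean_count\<close>
  into an average over compositions, so that drops forced by \<psi> can be confronted with
  optimality of the compositions in the support of \<open>p\<close>.\<close>

lemma summation_by_parts:
  fixes \<omega> :: "nat \<Rightarrow> real"
  assumes "\<omega> N = 0"
  shows "(\<Sum>v<N. \<omega> v * (mean_count k N p v - mean_count k N p (Suc v)))
       = (\<Sum>a\<in>T. p a * (\<Sum>i<k. \<omega> (a i) - (if a i = 0 then 0 else \<omega> (a i - 1))))"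
proof -
  let ?\<rho> = "mean_count k N p"
  have "(\<Sum>v<n. \<omega> v * (?\<rho> v - ?\<rho> (Suc v)))
      = (\<Sum>v\<le>n. (\<omega> v - (if v = 0 then 0 else \<omega> (v - 1))) * ?\<rho> v) - \<omega> n * ?\<rho> n" for n
    by (induction n) (auto simp: algebra_simps)
  from this[of N] show ?thesis using assms by (simp add: sum_mean_count)
qed

text \<open>Where the residual rises, the attained counts must fall at least as much, since \<psi>
  decreases; optimality restricts which compositions can carry mass. Two test weights in
  \<open>summation_by_parts\<close> make these clash: the positive increments of the tilted residual
  \<open>F\<close> show that \<open>F\<close> decreases, and a parabola on each level set of
  \<open>F\<close> shows that the tilt \<open>s\<close> is 0. A decreasing function orthogonal to
  affine functions is 0.\<close>

lemma coupling:
  obtains p where "\<And>a. p a \<ge> 0" "sum p T = 1" "\<And>v. v \<le> N \<Longrightarrow> mean_count k N p v = real k * \<psi> v"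
proof -
  obtain p where p_nonneg: "\<And>a. p a \<ge> 0" and p_sum: "sum p T = 1" and
    opt: "\<And>a. a \<in> T \<Longrightarrow> (\<Sum>i<k. residual p (a i)) \<le> (\<Sum>v\<le>N. residual p v * mean_count k N p v)"
    using closest_point by blast
  define r where "r = residual p"
  define \<rho> where "\<rho> = mean_count k N p"
  note r_sums = sum_residual[OF p_sum, folded r_def]
  have \<rho>_decr: "r (Suc v) - r v \<le> \<rho> v - \<rho> (Suc v)" if "v < N" for v
    using mult_left_mono[OF decseq_psi[OF that], of "real k"] by (simp add: r_def residual_def \<rho>_def)
  \<comment> \<open>The smallest nonnegative tilt with \<open>F 1 \<le> F 0\<close>. As the parts of
    a composition sum to \<open>N\<close>, the tilt shifts all sums of \<open>F\<close> by the same
    \<open>s * N\<close> and keeps the maximisers.\<close>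
  define s where "s = max (r 1 - r 0) 0"
  define F where "F v = r v - s * real v" for v
  define M where "M = (\<Sum>v\<le>N. F v * \<rho> v)"
  have F_sum: "(\<Sum>i<k. F (a i)) = (\<Sum>i<k. r (a i)) - s * real N" if "a \<in> T" for a
    using that by (auto simp: F_def sum_subtractf sum_distrib_left[symmetric] compositions_def)
  have M_avg: "M = (\<Sum>a\<in>T. p a * (\<Sum>i<k. F (a i)))"
    by (simp add: M_def \<rho>_def sum_mean_count)
  have F_opt: "(\<Sum>i<k. F (a i)) \<le> M" if "a \<in> T" for a
  proof -
    have "M = (\<Sum>b\<in>T. p b * (\<Sum>i<k. r (b i))) - (\<Sum>b\<in>T. p b * (s * real N))"
      by (simp add: M_avg F_sum algebra_simps sum_subtractf)
    also have "\<dots> = (\<Sum>v\<le>N. r v * \<rho> v) - s * real N"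
      using p_sum by (simp add: \<rho>_def sum_mean_count sum_distrib_right[symmetric])
    finally show ?thesis using opt[OF that] F_sum[OF that] by (simp add: r_def \<rho>_def)
  qed
  \<comment> \<open>\<open>M\<close> is both an upper bound and the \<open>p\<close>-average of
    these sums, so every composition in the support attains it.\<close>
  have tight: "(\<Sum>i<k. F (a i)) = M" if "a \<in> T" "p a > 0" for a
  proof (rule ccontr)
    assume "(\<Sum>i<k. F (a i)) \<noteq> M"
    then have "p a * (\<Sum>i<k. F (a i)) < p a * M" using F_opt[OF that(1)] that by auto
    moreover have "p b * (\<Sum>i<k. F (b i)) \<le> p b * M" if "b \<in> T" for b
      using F_opt[OF that] p_nonneg by (intro mult_left_mono)
    ultimately have "(\<Sum>b\<in>T. p b * (\<Sum>i<k. F (b i))) < (\<Sum>b\<in>T. p b * M)"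
      using that(1) by (intro sum_strict_mono_ex1) auto
    then show False using M_avg p_sum by (simp add: sum_distrib_right[symmetric])
  qed
  have \<rho>_decr_F: "F (Suc v) - F v + s \<le> \<rho> v - \<rho> (Suc v)" if "v < N" for v
    using \<rho>_decr[OF that] by (simp add: F_def algebra_simps)

  \<comment> \<open>Moving one unit from part \<open>h\<close> to part \<open>i\<close> cannot increase a tight composition.\<close>
  have exchange: "F (Suc (a i)) - F (a i) \<le> F (a h) - F (a h - 1)"
    if "a \<in> T" "p a > 0" "i < k" "h < k" "i \<noteq> h" "a h \<ge> 1" for a i h
  proof -
    let ?b = "a(i := Suc (a i), h := a h - 1)"
    have *: "(\<Sum>j<k. F (b j)) = F (b i) + F (b h) + (\<Sum>j\<in>{..<k} - {i, h}. F (b j))" for b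
      using that by (subst sum.subset_diff[of "{i, h}"]) auto
    have "(\<Sum>j\<in>{..<k} - {i, h}. F (?b j)) = (\<Sum>j\<in>{..<k} - {i, h}. F (a j))"
      by (rule sum.cong) auto
    then show ?thesis
      using F_opt[OF compositions_transfer[OF that(1,3-6)]] tight[OF that(1,2)] *[of a] *[of ?b] that(5)
      by simp
  qed
  have F_antimono1: "F (Suc v) \<le> F v" if "v < N" for v
  proof -
    \<comment> \<open>The positive increments of \<open>F\<close>, cut off at \<open>N\<close> to
      remove the boundary term. The choice of \<open>s\<close> makes \<omega> vanish at 0.\<close>
    define \<omega> where "\<omega> v = (if v < N then max 0 (F (Suc v) - F v) else 0)" for v
    have \<omega>_nonneg: "\<omega> v \<ge> 0" for v by (simp add: \<omega>_def)
    have \<omega>0: "\<omega> 0 = 0" by (auto simp: \<omega>_def F_def s_def)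
    have "(\<Sum>i<k. \<omega> (a i) - (if a i = 0 then 0 else \<omega> (a i - 1))) \<le> 0" if a: "a \<in> T" "p a > 0" for a
    proof -
      define Z where "Z = {i. i < k \<and> a i \<noteq> 0}"
      have Z: "finite Z" by (simp add: Z_def)
      have ex: "\<omega> (a i) \<le> \<omega> (a h - 1)" if "i \<in> Z" "h \<in> Z" "i \<noteq> h" for i h
        using exchange[of a i h] that a compositions_le[OF a(1), of h] by (auto simp: \<omega>_def Z_def)
      have "(\<Sum>i<k. \<omega> (a i) - (if a i = 0 then 0 else \<omega> (a i - 1))) = (\<Sum>i\<in>Z. \<omega> (a i) - \<omega> (a i - 1))"
        using \<omega>0 by (intro sum.mono_neutral_cong_right) (auto simp: Z_def)
      also have "\<dots> \<le> 0"
      proof (cases "card Z \<le> 1")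
        case True
        \<comment> \<open>A single nonzero part equals \<open>N\<close>, where \<omega> is
          0.\<close>
        have "\<omega> (a i) - \<omega> (a i - 1) \<le> 0" if i: "i \<in> Z" for i
        proof -
          have "Z = {i}" using True i Z by (auto simp: card_le_Suc0_iff_eq)
          then have "(\<Sum>j<k. a j) = (\<Sum>j\<in>{i}. a j)"
            by (intro sum.mono_neutral_right) (auto simp: Z_def)
          then show ?thesis using a(1) \<omega>_nonneg[of "a i - 1"] by (simp add: compositions_def \<omega>_def)
        qed
        then show ?thesis by (rule sum_nonpos)
      next
        case False
        \<comment> \<open>The exchange inequality is summed over all ordered pairs of distinct
          nonzero parts.\<close>
        have "(real (card Z) - 1) * (\<Sum>i\<in>Z. \<omega> (a i)) = (\<Sum>i\<in>Z. \<Sum>h\<in>Z - {i}. \<omega> (a i))"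
          using Z by (simp add: sum_distrib_left card_Diff_singleton)
            (use False in \<open>simp add: of_nat_diff\<close>)
        also have "\<dots> \<le> (\<Sum>i\<in>Z. \<Sum>h\<in>Z - {i}. \<omega> (a h - 1))"
        proof (rule sum_mono, rule sum_mono)
          fix i h assume "i \<in> Z" "h \<in> Z - {i}"
          then show "\<omega> (a i) \<le> \<omega> (a h - 1)" using ex[of i h] by blast
        qed
        also have "\<dots> = (\<Sum>i\<in>Z. (\<Sum>h\<in>Z. \<omega> (a h - 1)) - \<omega> (a i - 1))"
          using Z by (intro sum.cong) (auto simp: sum_diff1)
        also have "\<dots> = (real (card Z) - 1) * (\<Sum>h\<in>Z. \<omega> (a h - 1))"
          by (simp add: sum_subtractf algebra_simps)
        finally show ?thesis using False by (simp add: sum_subtractf)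
      qed
      finally show ?thesis .
    qed
    then have nonpos: "p a * (\<Sum>i<k. \<omega> (a i) - (if a i = 0 then 0 else \<omega> (a i - 1))) \<le> 0" if "a \<in> T" for a
      using that p_nonneg[of a] by (cases "p a = 0") (auto intro: mult_nonneg_nonpos)
    have "(\<Sum>a\<in>T. p a * (\<Sum>i<k. \<omega> (a i) - (if a i = 0 then 0 else \<omega> (a i - 1)))) \<le> 0"
      by (rule sum_nonpos) (rule nonpos)
    then have "(\<Sum>v<N. \<omega> v * (\<rho> v - \<rho> (Suc v))) \<le> 0"
      unfolding \<rho>_def by (subst summation_by_parts) (auto simp: \<omega>_def)
    \<comment> \<open>A rise of \<open>F\<close> forces a drop of \<rho> by at least the same
      amount, so the nonpositive weighted drop dominates the sum of the squares of \<omega>.\<close>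
    moreover have "(\<omega> v)\<^sup>2 \<le> \<omega> v * (\<rho> v - \<rho> (Suc v))" if "v < N" for v
    proof (cases "\<omega> v = 0")
      case False
      then have "\<omega> v \<le> \<rho> v - \<rho> (Suc v)"
        using \<rho>_decr_F[OF that] that by (auto simp: \<omega>_def s_def split: if_splits)
      then show ?thesis using \<omega>_nonneg by (simp add: power2_eq_square mult_left_mono)
    qed auto
    then have "(\<Sum>v<N. (\<omega> v)\<^sup>2) \<le> (\<Sum>v<N. \<omega> v * (\<rho> v - \<rho> (Suc v)))" by (intro sum_mono) auto
    ultimately have "(\<Sum>v<N. (\<omega> v)\<^sup>2) \<le> 0" by linarith
    then have "(\<Sum>v<N. (\<omega> v)\<^sup>2) = 0" by (intro antisym sum_nonneg) auto
    then have "\<omega> v = 0" using that by (subst (asm) sum_nonneg_eq_0_iff) auto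
    then show ?thesis using that by (auto simp: \<omega>_def max_def split: if_splits)
  qed
  have F_antimono: "F v \<le> F u" if "u \<le> v" "v \<le> N" for u v
    using that
  proof (induction v rule: dec_induct)
    case (step n)
    then show ?case using F_antimono1[of n] by simp
  qed simp

  \<comment> \<open>Since \<open>r\<close> is orthogonal to linear functions, one factor
    \<open>r\<close> of the square may be replaced by \<open>F\<close>.\<close>
  have r_norm: "(\<Sum>v\<le>N. (r v)\<^sup>2) = real k * (\<Sum>v\<le>N. F v * \<psi> v) - M"
  proof -
    have "(\<Sum>v\<le>N. (r v)\<^sup>2) = (\<Sum>v\<le>N. F v * r v + s * (real v * r v))"
      by (intro sum.cong) (auto simp: F_def power2_eq_square algebra_simps)
    also have "\<dots> = (\<Sum>v\<le>N. F v * r v)"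
      using r_sums by (simp add: sum.distrib sum_distrib_left[symmetric])
    also have "\<dots> = (\<Sum>v\<le>N. real k * (F v * \<psi> v) - F v * \<rho> v)"
      by (intro sum.cong) (auto simp: r_def residual_def \<rho>_def algebra_simps)
    finally show ?thesis by (simp add: sum_subtractf sum_distrib_left M_def)
  qed

  have "s \<le> 0"
  proof (rule ccontr)
    assume "\<not> s \<le> 0"
    then have s: "s > 0" by simp
    then have F01: "F 1 = F 0" by (simp add: F_def s_def max_def split: if_splits)
    \<comment> \<open>\<open>F\<close> decreases on {0..N}, so its level sets there are intervals;
      \<open>bot\<close> and \<open>top\<close> give their ends.\<close>
    define bot where "bot v = (LEAST u. F u = F v)" for v
    define top where "top v = Max {u. u \<le> N \<and> F u = F v}" for v
    have bot: "F (bot v) = F v" "bot v \<le> v" for v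
      unfolding bot_def by (rule LeastI[of _ v], simp) (rule Least_le, simp)
    have top: "F (top v) = F v" "v \<le> top v" "top v \<le> N" if "v \<le> N" for v
    proof -
      have "finite {u. u \<le> N \<and> F u = F v}" "v \<in> {u. u \<le> N \<and> F u = F v}" using that by auto
      from Max_in[OF this(1)] Max_ge[OF this] this(2)
      show "F (top v) = F v" "v \<le> top v" "top v \<le> N" unfolding top_def by blast+
    qed
    have top_ge: "u \<le> top v" if "u \<le> N" "F u = F v" for u v
      unfolding top_def using that by (intro Max_ge) auto
    have cong: "bot u = bot v" "top u = top v" if "F u = F v" for u v
      using that by (simp_all add: bot_def top_def)
    \<comment> \<open>The weight \<open>\<omega>\<close> is chosen such that its difference at \<open>v\<close> is the distance
      from \<open>v\<close> to the centre of the level set of \<open>F\<close> containing \<open>v\<close>.\<close>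
    define \<omega> where "\<omega> v = (real (top v) - real v) * (real v - real (bot v) + 1) / 2" for v
    have \<omega>N: "\<omega> N = 0" using top[of N] by (simp add: \<omega>_def)
    have \<omega>_diff: "\<omega> v - (if v = 0 then 0 else \<omega> (v - 1)) = (real (bot v) + real (top v)) / 2 - real v"
      if v: "v \<le> N" for v
    proof -
      have "(if v = 0 then 0 else \<omega> (v - 1))
          = (real (top v) - real v + 1) * (real v - real (bot v)) / 2"
      proof (cases "v = 0 \<or> F (v - 1) = F v")
        case True
        then show ?thesis using cong[of "v - 1" v] bot(2)[of v]
          by (auto simp: \<omega>_def of_nat_diff)
      next
        case False
        then have lt: "F v < F (v - 1)" using F_antimono[of "v - 1" v] v by auto
        have "\<not> bot v < v"
        proof
          assume "bot v < v"
          then have "F (v - 1) \<le> F (bot v)" using v by (intro F_antimono) auto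
          then show False using lt bot(1)[of v] by simp
        qed
        moreover have "\<not> top (v - 1) \<ge> v"
        proof
          assume "v \<le> top (v - 1)"
          moreover have le: "v - 1 \<le> N" using v by simp
          ultimately have "F (top (v - 1)) \<le> F v" using top(3)[OF le] by (intro F_antimono)
          then show False using lt top(1)[OF le] by simp
        qed
        ultimately have "bot v = v" "top (v - 1) = v - 1"
          using bot(2)[of v] top(2)[of "v - 1"] v by linarith+
        then show ?thesis using False by (simp add: \<omega>_def)
      qed
      then show ?thesis by (simp add: \<omega>_def field_simps)
    qed
    have \<omega>_nonneg: "\<omega> v \<ge> 0" if "v \<le> N" for v
      using top(2)[OF that] bot(2)[of v] by (simp add: \<omega>_def)
    \<comment> \<open>Between neighbours in one level set \<rho> drops by at least \<open>s\<close>,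
      and elsewhere \<omega> vanishes. The level set of 0 also contains 1, which makes the total
      strictly positive.\<close>
    have "0 < (\<Sum>v<N. \<omega> v * (\<rho> v - \<rho> (Suc v)))"
    proof (rule sum_pos2)
      have "1 \<le> top 0" using F01 N_pos by (intro top_ge) auto
      moreover have "bot 0 = 0" using bot(2)[of 0] by simp
      ultimately have "\<omega> 0 > 0" by (simp add: \<omega>_def)
      then show "0 < \<omega> 0 * (\<rho> 0 - \<rho> (Suc 0))"
        using \<rho>_decr_F[of 0] N_pos F01 s by (intro mult_pos_pos) auto
      fix v assume v: "v \<in> {..<N}"
      show "0 \<le> \<omega> v * (\<rho> v - \<rho> (Suc v))"
      proof (cases "top v = v")
        case False
        then have "Suc v \<le> top v" using top(2)[of v] v by auto
        then have "F (Suc v) = F v"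
          using F_antimono[of "Suc v" "top v"] F_antimono[of v "Suc v"] top(1,3)[of v] v by auto
        then show ?thesis using \<rho>_decr_F[of v] \<omega>_nonneg[of v] v s by (intro mult_nonneg_nonneg) auto
      qed (simp add: \<omega>_def)
    qed (use N_pos in auto)
    also have "\<dots> = (\<Sum>a\<in>T. p a * (\<Sum>i<k. \<omega> (a i) - (if a i = 0 then 0 else \<omega> (a i - 1))))"
      unfolding \<rho>_def by (rule summation_by_parts[where \<omega> = \<omega>]) (rule \<omega>N)
    finally obtain a where a: "a \<in> T" and
      pos: "p a * (\<Sum>i<k. \<omega> (a i) - (if a i = 0 then 0 else \<omega> (a i - 1))) > 0"
      by (meson not_le sum_nonpos)
    have pa: "p a > 0" and \<omega>_pos: "(\<Sum>i<k. \<omega> (a i) - (if a i = 0 then 0 else \<omega> (a i - 1))) > 0"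
      using pos p_nonneg[of a] by (auto simp: zero_less_mult_iff)
    note \<omega>_pos
    also have "(\<Sum>i<k. \<omega> (a i) - (if a i = 0 then 0 else \<omega> (a i - 1)))
        = (\<Sum>i<k. (real (bot (a i)) + real (top (a i))) / 2 - real (a i))"
      using compositions_le[OF a] by (intro sum.cong refl \<omega>_diff)
    also have "\<dots> = real (\<Sum>i<k. bot (a i) + top (a i)) / 2 - real (\<Sum>i<k. a i)"
      by (simp add: sum_subtractf sum_divide_distrib[symmetric] sum.distrib)
    finally have "real (2 * (\<Sum>i<k. a i)) < real (\<Sum>i<k. bot (a i) + top (a i))" by simp
    then have "2 * (\<Sum>i<k. a i) < (\<Sum>i<k. bot (a i) + top (a i))" by (rule of_nat_less_iff[THEN iffD1])
    \<comment> \<open>Some composition in the support has parts whose level-set centres sum to more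
      than \<open>N\<close>, the sum of the parts themselves.\<close>
    then have centres: "2 * N < (\<Sum>i<k. bot (a i) + top (a i))"
      using a by (simp add: compositions_def)
    have bot_le_top: "bot (a i) \<le> top (a i)" for i
      using bot(2)[of "a i"] top(2)[of "a i"] compositions_le[OF a, of i] by linarith
    \<comment> \<open>Otherwise some composition keeps part \<open>i\<close> below its level set and
      the other parts at or below their \<open>top\<close>. As \<open>F\<close> decreases, its sum
      of \<open>F\<close> would exceed the maximum \<open>M\<close>.\<close>
    have lift: "(\<Sum>h\<in>{..<k} - {i}. top (a h)) + bot (a i) \<le> N" if i: "i < k" "bot (a i) \<ge> 1" for i
    proof (rule ccontr)
      assume "\<not> ?thesis"
      define u where "u h = (if h = i then bot (a i) - 1 else top (a h))" for h
      have "(\<Sum>h<k. u h) = (\<Sum>h\<in>{..<k} - {i}. top (a h)) + (bot (a i) - 1)"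
        using i by (subst sum.remove[of _ i]) (auto simp: u_def)
      with \<open>\<not> ?thesis\<close> i have "N \<le> (\<Sum>h<k. u h)" by simp
      from compositions_below[OF this] obtain b where b: "b \<in> T" "\<And>h. b h \<le> u h" by blast
      have "bot (a i) \<le> N" using bot(2)[of "a i"] compositions_le[OF a, of i] by simp
      have "u h \<le> N" for h
        using top(3)[OF compositions_le[OF a, of h]] \<open>bot (a i) \<le> N\<close> by (auto simp: u_def)
      then have "F (u h) \<le> F (b h)" for h using b(2) by (intro F_antimono) auto
      moreover have "F (a h) \<le> F (u h)" for h
        using top(1)[OF compositions_le[OF a, of h]] bot(1)[of "a i"]
          F_antimono[of "bot (a i) - 1" "bot (a i)"] \<open>bot (a i) \<le> N\<close> by (auto simp: u_def)
      moreover have "F (a i) < F (u i)"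
      proof -
        have "F (u i) \<noteq> F (a i)"
        proof
          assume "F (u i) = F (a i)"
          then have "bot (a i) \<le> u i" unfolding bot_def by (rule Least_le)
          then show False using i by (simp add: u_def)
        qed
        with \<open>\<And>h. F (a h) \<le> F (u h)\<close>[of i] show ?thesis by simp
      qed
      ultimately have "(\<Sum>h<k. F (a h)) < (\<Sum>h<k. F (b h))"
        using i by (intro sum_strict_mono_ex1) (auto intro: order_trans less_le_trans)
      then show False using F_opt[OF b(1)] tight[OF a pa] by simp
    qed
    show False
    proof (cases "\<exists>i<k. bot (a i) \<ge> 1")
      case True
      then obtain i where i: "i < k" "bot (a i) \<ge> 1" by blast
      have split: "(\<Sum>h<k. f h) = f i + (\<Sum>h\<in>{..<k} - {i}. f h)" for f :: "nat \<Rightarrow> nat"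
        using i by (subst sum.remove[of _ i]) auto
      \<comment> \<open>\<open>centres\<close> against \<open>lift\<close> at \<open>i\<close>. A
        second part with positive \<open>bot\<close> would contradict \<open>lift\<close> there, so
        all other \<open>bot\<close> values are 0 and \<open>top (a i)\<close> would exceed
        \<open>N\<close>.\<close>
      have "N < top (a i) + (\<Sum>h\<in>{..<k} - {i}. bot (a h))"
        using centres[unfolded sum.distrib] lift[OF i]
          split[of "\<lambda>h. bot (a h)"] split[of "\<lambda>h. top (a h)"] by linarith
      moreover have "bot (a j) = 0" if j: "j \<in> {..<k} - {i}" for j
      proof (rule ccontr)
        assume "bot (a j) \<noteq> 0"
        let ?R = "{..<k} - {i} - {j}"
        have split2: "(\<Sum>h\<in>{..<k} - {i}. f h) = f j + (\<Sum>h\<in>?R. f h)"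
          "(\<Sum>h\<in>{..<k} - {j}. f h) = f i + (\<Sum>h\<in>?R. f h)" for f :: "nat \<Rightarrow> nat"
        proof -
          show "(\<Sum>h\<in>{..<k} - {i}. f h) = f j + (\<Sum>h\<in>?R. f h)"
            using j by (subst sum.remove[of _ j]) auto
          have "{..<k} - {j} - {i} = ?R" by auto
          then show "(\<Sum>h\<in>{..<k} - {j}. f h) = f i + (\<Sum>h\<in>?R. f h)"
            using i j by (subst sum.remove[of _ i]) auto
        qed
        have "(\<Sum>h\<in>?R. bot (a h)) \<le> (\<Sum>h\<in>?R. top (a h))"
          by (intro sum_mono bot_le_top)
        moreover have "(\<Sum>h\<in>{..<k} - {j}. top (a h)) + bot (a j) \<le> N"
          using lift[of j] j \<open>bot (a j) \<noteq> 0\<close> by simp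
        ultimately show False
          using centres[unfolded sum.distrib] lift[OF i]
            split[of "\<lambda>h. bot (a h)"] split[of "\<lambda>h. top (a h)"]
            split2[of "\<lambda>h. bot (a h)"] split2[of "\<lambda>h. top (a h)"] by linarith
      qed
      ultimately show False using top(3)[OF compositions_le[OF a, of i]] by simp
    next
      case False
      then have "F (a i) = F 0" if "i < k" for i using bot(1)[of "a i"] that by (cases "bot (a i)") auto
      \<comment> \<open>All parts lie in the level set of 0, where \<open>F\<close> is largest. Then
        \<open>r_norm\<close> forces \<open>r = 0\<close>, contrary to \<open>s > 0\<close>.\<close>
      then have "M = real k * F 0" using tight[OF a pa] by simp
      moreover have "(\<Sum>v\<le>N. F v * \<psi> v) \<le> F 0"
      proof -
        have "(\<Sum>v\<le>N. F v * \<psi> v) \<le> (\<Sum>v\<le>N. F 0 * \<psi> v)"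
          by (intro sum_mono mult_right_mono F_antimono psi_nonneg) auto
        then show ?thesis using sum_psi by (simp add: sum_distrib_left[symmetric])
      qed
      ultimately have "(\<Sum>v\<le>N. (r v)\<^sup>2) \<le> 0" using r_norm k_pos by (simp add: mult_left_mono)
      then have "(\<Sum>v\<le>N. (r v)\<^sup>2) = 0" by (intro antisym sum_nonneg) auto
      then have "r v = 0" if "v \<le> N" for v using that by (subst (asm) sum_nonneg_eq_0_iff) auto
      then show False using s N_pos by (simp add: s_def)
    qed
  qed
  then have "s = 0" by (simp add: s_def)
  have r_antimono: "r v \<le> r u" if "u \<le> v" "v \<le> N" for u v
    using F_antimono[OF that] \<open>s = 0\<close> by (simp add: F_def)
  have "r v = 0" if "v \<le> N" for v
  proof -
    \<comment> \<open>The first sign change of \<open>r\<close>: multiplying by \<open>v - u\<close>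
      makes all terms nonpositive, while their sum is 0 by orthogonality to affine
      functions.\<close>
    define u where "u = (LEAST v. v > N \<or> r v < 0)"
    have u: "u > N \<or> r u < 0" unfolding u_def by (rule LeastI[of _ "Suc N"]) simp
    have below: "r v \<ge> 0" if "v < u" for v
      using not_less_Least[OF that[unfolded u_def]] by simp
    have neg: "(real v - real u) * r v \<le> 0" if "v \<le> N" for v
    proof (cases "v < u")
      case False
      then have "r v \<le> r u" using that by (intro r_antimono) auto
      then show ?thesis using u False that by (intro mult_nonneg_nonpos) auto
    qed (use below in \<open>auto intro!: mult_nonpos_nonneg\<close>)
    have "(\<Sum>v\<le>N. (real v - real u) * r v) = 0"
      using r_sums by (simp add: algebra_simps sum_subtractf sum_distrib_left[symmetric])
    then have "(\<Sum>v\<le>N. - ((real v - real u) * r v)) = 0" by (simp add: sum_negf)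
    moreover have "0 \<le> - ((real v - real u) * r v)" if "v \<in> {..N}" for v
      using neg[of v] that by simp
    ultimately have prod0: "- ((real v - real u) * r v) = 0" if "v \<in> {..N}" for v
      using sum_nonneg_0[of "{..N}" "\<lambda>v. - ((real v - real u) * r v)" v] that by blast
    have other: "r v = 0" if "v \<le> N" "v \<noteq> u" for v
      using prod0[of v] that by simp
    show ?thesis
    proof (cases "u \<le> N")
      case True
      then have "(\<Sum>v\<le>N. r v) = r u" by (subst sum.remove[of _ u]) (auto simp: other)
      then show ?thesis using r_sums(1) other that by metis
    qed (use other that in auto)
  qed
  then show ?thesis using that[of p] p_nonneg p_sum by (simp add: r_def residual_def)
qed

end

section \<open>Gibbs distributions\<close>

lemma sum_comp_permutes:
  assumes "\<sigma> permutes {..<k}"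
  shows "(\<Sum>i<k. g ((a \<circ> \<sigma>) i)) = (\<Sum>i<k. g (a i))"
  using sum.permute[OF assms, of "\<lambda>i. g (a i)"] by (simp add: o_def)

lemma compositions_permute:
  assumes "\<sigma> permutes {..<k}" "a \<in> compositions k N"
  shows "a \<circ> \<sigma> \<in> compositions k N"
  using assms(2) sum_comp_permutes[OF assms(1), of "\<lambda>x. x" a] permutes_not_in[OF assms(1)]
  by (auto simp: compositions_def)

lemma sum_part_swap:
  assumes f: "\<And>\<sigma> a. \<sigma> permutes {..<k} \<Longrightarrow> f (a \<circ> \<sigma>) = f a" and ij: "i < k" "j < k"
  shows "(\<Sum>a | a \<in> compositions k N \<and> a j = v. f a) = (\<Sum>a | a \<in> compositions k N \<and> a i = v. f a)"
proof -
  let ?\<tau> = "Transposition.transpose i j" and ?T = "compositions k N"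
  have p: "?\<tau> permutes {..<k}" using ij by (intro permutes_swap_id) auto
  show ?thesis
  proof (rule sum.reindex_bij_witness[where i = "\<lambda>a. a \<circ> ?\<tau>" and j = "\<lambda>a. a \<circ> ?\<tau>"])
    fix a
    show "f (a \<circ> ?\<tau>) = f a" by (rule f[OF p])
    show "a \<circ> ?\<tau> \<in> {a \<in> ?T. a i = v}" if "a \<in> {a \<in> ?T. a j = v}"
      using that compositions_permute[OF p] by simp
    show "a \<circ> ?\<tau> \<in> {a \<in> ?T. a j = v}" if "a \<in> {a \<in> ?T. a i = v}"
      using that compositions_permute[OF p] by simp
  qed (auto simp: o_assoc[symmetric])
qed

text \<open>The unnormalised exponential family whose sufficient statistics are the part counts,
  restricted to \<open>compositions k N\<close> wherever it is summed.\<close>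

definition gibbs :: "nat \<Rightarrow> (nat \<Rightarrow> real) \<Rightarrow> (nat \<Rightarrow> nat) \<Rightarrow> real" where
  "gibbs k \<theta> a = exp (\<Sum>i<k. \<theta> (a i))"

lemma gibbs_pos [simp]: "gibbs k \<theta> a > 0"
  by (simp add: gibbs_def)

lemma gibbs_permute: "\<sigma> permutes {..<k} \<Longrightarrow> gibbs k \<theta> (a \<circ> \<sigma>) = gibbs k \<theta> a"
  using sum_comp_permutes[of \<sigma> k \<theta> a] by (simp add: gibbs_def)

lemma gibbs_marginal:
  assumes "i < k"
  shows "real k * (\<Sum>a | a \<in> compositions k N \<and> a i = v. gibbs k \<theta> a) = mean_count k N (gibbs k \<theta>) v"
proof -
  let ?T = "compositions k N"
  have "(\<Sum>a | a \<in> ?T \<and> a j = v. gibbs k \<theta> a) = (\<Sum>a | a \<in> ?T \<and> a i = v. gibbs k \<theta> a)" if "j < k" for j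
    using gibbs_permute assms that by (rule sum_part_swap)
  then have "(\<Sum>j<k. \<Sum>a | a \<in> ?T \<and> a j = v. gibbs k \<theta> a)
      = real k * (\<Sum>a | a \<in> ?T \<and> a i = v. gibbs k \<theta> a)" by simp
  moreover have "(\<Sum>j<k. \<Sum>a | a \<in> ?T \<and> a j = v. gibbs k \<theta> a)
      = (\<Sum>j<k. \<Sum>a\<in>?T. if a j = v then gibbs k \<theta> a else 0)"
    by (simp add: sum.inter_filter)
  moreover have "\<dots> = (\<Sum>a\<in>?T. \<Sum>j<k. if a j = v then gibbs k \<theta> a else 0)" by (rule sum.swap)
  moreover have "\<dots> = mean_count k N (gibbs k \<theta>) v"
    unfolding mean_count_def part_count_def
    by (intro sum.cong) (auto simp: sum.If_cases lessThan_def Int_def)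
  ultimately show ?thesis by simp
qed

section \<open>Regularised duality and approximate marginals\<close>

context mean_target
begin

text \<open>Under the coupling the left side is an average of exponents, each at most the logarithm
  of the partition function. This bounds the dual objective of \<open>gibbs_approximation\<close>
  below by 0.\<close>

lemma exp_average_le_partition_function:
  "real k * (\<Sum>v\<le>N. \<psi> v * \<theta> v) \<le> ln (\<Sum>a\<in>T. gibbs k \<theta> a)"
proof -
  obtain p where p: "\<And>a. p a \<ge> 0" "sum p T = 1" "\<And>v. v \<le> N \<Longrightarrow> mean_count k N p v = real k * \<psi> v"
    using coupling by blast
  have "(\<Sum>a\<in>T. p a * (\<Sum>i<k. \<theta> (a i))) \<le> (\<Sum>a\<in>T. p a * ln (\<Sum>a\<in>T. gibbs k \<theta> a))"
  proof (intro sum_mono mult_left_mono p)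
    fix a assume a: "a \<in> T"
    have "gibbs k \<theta> a \<le> (\<Sum>a\<in>T. gibbs k \<theta> a)"
      using a by (intro member_le_sum) (auto intro: less_imp_le)
    then have "ln (gibbs k \<theta> a) \<le> ln (\<Sum>a\<in>T. gibbs k \<theta> a)"
      by (metis gibbs_pos ln_le_cancel_iff order_less_le_trans)
    then show "(\<Sum>i<k. \<theta> (a i)) \<le> ln (\<Sum>a\<in>T. gibbs k \<theta> a)" by (simp add: gibbs_def)
  qed
  also have "\<dots> = ln (\<Sum>a\<in>T. gibbs k \<theta> a)" using p by (simp add: sum_distrib_right[symmetric])
  finally have le: "(\<Sum>a\<in>T. p a * (\<Sum>i<k. \<theta> (a i))) \<le> ln (\<Sum>a\<in>T. gibbs k \<theta> a)" .
  have "(\<Sum>a\<in>T. p a * (\<Sum>i<k. \<theta> (a i))) = (\<Sum>v\<le>N. \<theta> v * mean_count k N p v)"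
    by (rule sum_mean_count[symmetric])
  also have "\<dots> = real k * (\<Sum>v\<le>N. \<psi> v * \<theta> v)"
    unfolding sum_distrib_left by (intro sum.cong) (auto simp: p(3))
  finally show ?thesis using le by simp
qed

text \<open>\<open>coupling\<close> gives no control over the support of \<open>p\<close>, so the
  minimum of the dual objective might lie at infinity. The penalty |\<theta>|^2 / n makes it
  attained: the critical point equation shows a marginal error of -2 \<theta> / n, and comparison
  with \<theta> = 0 gives |\<theta>|^2 at most n ln (card T). An error of order 1 / sqrt n per
  position costs only exp(O(sqrt n)) over O(n) positions.\<close>

lemma gibbs_approximation:
  assumes "n \<ge> 1"
  obtains \<theta> where "\<And>v. v \<le> N \<Longrightarrow>
    \<bar>mean_count k N (gibbs k \<theta>) v / (\<Sum>a\<in>T. gibbs k \<theta> a) - real k * \<psi> v\<bar> \<le> 2 * sqrt (ln (card T)) / sqrt (real n)"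
proof -
  define Z where "Z \<theta> = (\<Sum>a\<in>T. gibbs k \<theta> a)" for \<theta>
  define \<Phi> where "\<Phi> \<theta> = ln (Z \<theta>) - real k * (\<Sum>v\<le>N. \<psi> v * \<theta> v) + (\<Sum>v\<le>N. (\<theta> v)\<^sup>2) / real n" for \<theta>
  \<comment> \<open>The a priori bound for the minimiser. The box has radius \<open>B + 1\<close>,
    so the minimiser is interior in each relevant coordinate and the derivative there
    vanishes.\<close>
  define B where "B = sqrt (real n * ln (card T))"
  define R where "R = B + 1"
  have T: "T \<noteq> {}" using compositions_nonempty k_pos by blast
  then have card_T: "card T \<ge> 1" by (simp add: Suc_le_eq card_gt_0_iff)
  have Z_pos: "Z \<theta> > 0" for \<theta> unfolding Z_def using T by (intro sum_pos) auto
  have B: "B \<ge> 0" "B\<^sup>2 = real n * ln (card T)" using card_T by (simp_all add: B_def)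
  define C where "C = {\<theta> :: nat \<Rightarrow> real. \<forall>v. \<theta> v \<in> {(if v \<le> N then -R else 0)..(if v \<le> N then R else 0)}}"
  have cont [continuous_intros]: "continuous_on X (\<lambda>\<theta> :: nat \<Rightarrow> real. \<theta> v)" for v X
    by (rule continuous_on_subset[OF continuous_on_product_coordinates]) auto
  have zero: "(\<lambda>_. 0) \<in> C" using B by (auto simp: C_def R_def)
  have "\<exists>\<theta>\<in>C. \<forall>\<theta>'\<in>C. \<Phi> \<theta> \<le> \<Phi> \<theta>'"
  proof (rule continuous_attains_inf_box)
    show "closed C" unfolding C_def atLeastAtMost_iff
      by (intro closed_Collect_all closed_Collect_conj closed_Collect_le continuous_intros)
    show "C \<subseteq> {\<theta>. \<forall>v. \<theta> v \<in> {(if v \<le> N then -R else 0)..(if v \<le> N then R else 0)}}"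
      by (simp add: C_def)
    show "continuous_on C \<Phi>"
    proof -
      have "(\<Sum>a\<in>T. exp (\<Sum>i<k. \<theta> (a i))) \<noteq> 0" for \<theta> :: "nat \<Rightarrow> real"
        using Z_pos[of \<theta>] by (simp add: Z_def gibbs_def)
      then show ?thesis using assms unfolding \<Phi>_def Z_def gibbs_def
        by (intro continuous_intros) auto
    qed
  qed (use zero in auto)
  then obtain \<theta> where \<theta>: "\<theta> \<in> C" and min: "\<And>\<theta>'. \<theta>' \<in> C \<Longrightarrow> \<Phi> \<theta> \<le> \<Phi> \<theta>'" by blast
  have "(\<Sum>v\<le>N. (\<theta> v)\<^sup>2) / real n \<le> \<Phi> \<theta>"
    using exp_average_le_partition_function[of \<theta>] by (simp add: \<Phi>_def Z_def)
  also have "\<dots> \<le> ln (card T)" using min[OF zero] by (simp add: \<Phi>_def Z_def gibbs_def)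
  finally have norm: "(\<Sum>v\<le>N. (\<theta> v)\<^sup>2) \<le> B\<^sup>2" using assms by (simp add: B field_simps)
  have \<theta>_le: "\<bar>\<theta> v\<bar> \<le> B" if "v \<le> N" for v
  proof -
    have "(\<theta> v)\<^sup>2 \<le> (\<Sum>v\<le>N. (\<theta> v)\<^sup>2)" using that by (intro member_le_sum) auto
    with norm B show ?thesis by (metis abs_le_square_iff abs_of_nonneg order_trans)
  qed
  have "mean_count k N (gibbs k \<theta>) v / Z \<theta> - real k * \<psi> v = - 2 * \<theta> v / real n" if v: "v \<le> N" for v
  proof -
    define S where "S = (\<Sum>v\<le>N. \<psi> v * \<theta> v)"
    define Q where "Q = (\<Sum>v\<le>N. (\<theta> v)\<^sup>2)"
    define h where "h t = ln (\<Sum>a\<in>T. gibbs k \<theta> a * exp ((t - \<theta> v) * part_count k a v))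
      - real k * (S + (t - \<theta> v) * \<psi> v) + (Q + t\<^sup>2 - (\<theta> v)\<^sup>2) / real n" for t
    have upd: "(\<Sum>u\<le>N. g u ((\<theta>(v := t)) u)) = (\<Sum>u\<le>N. g u (\<theta> u)) + g v t - g v (\<theta> v)"
      for g :: "nat \<Rightarrow> real \<Rightarrow> real" and t
    proof -
      have "(\<Sum>u\<in>{..N} - {v}. g u ((\<theta>(v := t)) u)) = (\<Sum>u\<in>{..N} - {v}. g u (\<theta> u))"
        by (intro sum.cong) auto
      then show ?thesis using v by (simp add: sum.remove[of "{..N}" v])
    qed
    have h: "\<Phi> (\<theta>(v := t)) = h t" for t
    proof -
      have "gibbs k (\<theta>(v := t)) a = gibbs k \<theta> a * exp ((t - \<theta> v) * part_count k a v)" if "a \<in> T" for a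
      proof -
        have "(\<Sum>i<k. (\<theta>(v := t)) (a i)) = (\<Sum>i<k. \<theta> (a i)) + (t - \<theta> v) * part_count k a v"
          unfolding sum_part_count[OF that, symmetric]
          using upd[of "\<lambda>u x. x * part_count k a u" t] by (simp add: algebra_simps del: fun_upd_apply)
        then show ?thesis by (simp add: gibbs_def exp_add del: fun_upd_apply)
      qed
      then have Z: "Z (\<theta>(v := t)) = (\<Sum>a\<in>T. gibbs k \<theta> a * exp ((t - \<theta> v) * part_count k a v))"
        unfolding Z_def by (intro sum.cong) auto
      have "(\<Sum>u\<le>N. \<psi> u * (\<theta>(v := t)) u) = S + (t - \<theta> v) * \<psi> v"
        using upd[of "\<lambda>u x. \<psi> u * x" t] by (simp add: S_def algebra_simps del: fun_upd_apply)
      moreover have "(\<Sum>u\<le>N. ((\<theta>(v := t)) u)\<^sup>2) = Q + t\<^sup>2 - (\<theta> v)\<^sup>2"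
        using upd[of "\<lambda>u x. x\<^sup>2" t] by (simp only: Q_def)
      ultimately show ?thesis by (simp only: \<Phi>_def h_def Z)
    qed
    have h0: "\<Phi> \<theta> = h (\<theta> v)" using h[of "\<theta> v"] by simp
    have "(h has_real_derivative mean_count k N (gibbs k \<theta>) v / Z \<theta> - real k * \<psi> v + 2 * \<theta> v / real n) (at (\<theta> v))"
      unfolding h_def
      using Z_pos[of \<theta>] assms
      by (auto intro!: derivative_eq_intros simp: Z_def mean_count_def mult.commute)
    moreover have "h (\<theta> v) \<le> h t" if "\<bar>\<theta> v - t\<bar> < 1" for t
    proof -
      have t: "\<bar>t\<bar> \<le> R" using that \<theta>_le[OF v] by (simp add: R_def)
      have "(\<theta>(v := t)) u \<in> {(if u \<le> N then -R else 0)..(if u \<le> N then R else 0)}" for u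
      proof (cases "u = v")
        case True
        then show ?thesis using t v by (simp add: abs_le_iff)
      next
        case False
        then have "(\<theta>(v := t)) u = \<theta> u" by simp
        moreover have "\<theta> u \<in> {(if u \<le> N then -R else 0)..(if u \<le> N then R else 0)}"
          using \<theta> unfolding C_def by blast
        ultimately show ?thesis by (simp only:)
      qed
      then have "\<theta>(v := t) \<in> C" unfolding C_def by blast
      from min[OF this] show ?thesis by (simp only: h h0)
    qed
    ultimately have "mean_count k N (gibbs k \<theta>) v / Z \<theta> - real k * \<psi> v + 2 * \<theta> v / real n = 0"
      by (intro DERIV_local_min[of h _ "\<theta> v" 1]) auto
    then show ?thesis by simp
  qed
  moreover have "\<bar>- 2 * \<theta> v / real n\<bar> \<le> 2 * sqrt (ln (card T)) / sqrt (real n)" if "v \<le> N" for v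
  proof -
    have "\<bar>- 2 * \<theta> v / real n\<bar> \<le> 2 * B / real n" using \<theta>_le[OF that] assms by (simp add: divide_right_mono)
    also have "\<dots> = 2 * sqrt (ln (card T)) / sqrt (real n)"
      using assms by (simp add: B_def real_sqrt_mult field_simps)
    finally show ?thesis .
  qed
  ultimately show ?thesis using that[of \<theta>] by (simp add: Z_def)
qed

end

section \<open>Symmetric types\<close>

text \<open>Pigeonhole by weight instead of by number: the total \<open>Z^n\<close> is distributed
  over at most (n+1)^(card T) types.\<close>

lemma popular_type:
  assumes n: "n \<ge> 1"
  obtains c' where "\<And>a. a \<notin> compositions k N \<Longrightarrow> c' a = 0"
    "(\<Sum>a\<in>compositions k N. gibbs k \<theta> a) ^ n / real (n + 1) ^ card (compositions k N)
      \<le> (\<Sum>e | e \<in> PiE {..<n} (\<lambda>_. compositions k N) \<and> (\<forall>a. card {p \<in> {..<n}. e p = a} = c' a).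
          \<Prod>p<n. gibbs k \<theta> (e p))"
proof -
  let ?T = "compositions k N"
  let ?W = "PiE {..<n} (\<lambda>_. ?T)"
  define ty where "ty e = (\<lambda>a\<in>?T. card {p \<in> {..<n}. e p = a})" for e :: "nat \<Rightarrow> nat \<Rightarrow> nat"
  define w where "w e = (\<Prod>p<n. gibbs k \<theta> (e p))" for e
  define A where "A = PiE ?T (\<lambda>_. {..n})"
  have A: "finite A" "card A = (n + 1) ^ card ?T" by (auto simp: A_def card_PiE intro: finite_PiE)
  have W: "finite ?W" by (intro finite_PiE) auto
  have ty: "ty ` ?W \<subseteq> A"
  proof (rule image_subsetI)
    fix e :: "nat \<Rightarrow> nat \<Rightarrow> nat"
    have "card {p \<in> {..<n}. e p = a} \<le> card {..<n}" for a by (intro card_mono) auto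
    then show "ty e \<in> A" by (auto simp: ty_def A_def)
  qed
  have "(\<Sum>a\<in>?T. gibbs k \<theta> a) ^ n = (\<Sum>e\<in>?W. w e)"
    unfolding w_def by (subst prod_sum_PiE[symmetric]) auto
  also have "\<dots> = (\<Sum>t\<in>A. \<Sum>e | e \<in> ?W \<and> ty e = t. w e)"
    by (rule sum.group[OF W A(1) ty, symmetric])
  finally have total: "(\<Sum>a\<in>?T. gibbs k \<theta> a) ^ n = (\<Sum>t\<in>A. \<Sum>e | e \<in> ?W \<and> ty e = t. w e)" .
  have "\<exists>t\<in>A. (\<Sum>a\<in>?T. gibbs k \<theta> a) ^ n / real (card A) \<le> (\<Sum>e | e \<in> ?W \<and> ty e = t. w e)"
  proof (rule ccontr)
    assume contra: "\<not> ?thesis"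
    have "A \<noteq> {}" using A by (metis card.empty power_not_zero add_eq_0_iff_both_eq_0 one_neq_zero)
    then have "(\<Sum>t\<in>A. \<Sum>e | e \<in> ?W \<and> ty e = t. w e) < (\<Sum>t\<in>A. (\<Sum>a\<in>?T. gibbs k \<theta> a) ^ n / real (card A))"
      using contra A by (intro sum_strict_mono) (auto simp: not_le)
    also have "\<dots> = (\<Sum>a\<in>?T. gibbs k \<theta> a) ^ n" using \<open>A \<noteq> {}\<close> A by simp
    finally show False using total by simp
  qed
  then obtain t where t: "t \<in> A" "(\<Sum>a\<in>?T. gibbs k \<theta> a) ^ n / real (card A) \<le> (\<Sum>e | e \<in> ?W \<and> ty e = t. w e)"
    by blast
  define c' where "c' a = (if a \<in> ?T then t a else 0)" for a
  have "{e. e \<in> ?W \<and> ty e = t} = {e. e \<in> ?W \<and> (\<forall>a. card {p \<in> {..<n}. e p = a} = c' a)}"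
  proof (intro Collect_cong conj_cong refl)
    fix e assume e: "e \<in> ?W"
    have out: "{p \<in> {..<n}. e p = a} = {}" if "a \<notin> ?T" for a using e that by (auto simp: PiE_def Pi_def)
    have "ty e = t \<longleftrightarrow> (\<forall>a\<in>?T. ty e a = t a)"
      using t(1) by (auto simp: A_def ty_def intro!: extensionalityI[of _ ?T] simp: PiE_def)
    also have "\<dots> \<longleftrightarrow> (\<forall>a. card {p \<in> {..<n}. e p = a} = c' a)"
      using out by (auto simp: ty_def c'_def)
    finally show "ty e = t \<longleftrightarrow> (\<forall>a. card {p \<in> {..<n}. e p = a} = c' a)" .
  qed
  then show ?thesis
    using t(2) A(2) that[of c'] by (simp add: c'_def w_def)
qed

text \<open>Concatenating one block for every permutation of the components makes the type symmetric.\<close>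

lemma symmetric_type:
  fixes k N n :: nat
  assumes n: "n \<ge> 1"
  defines "T \<equiv> compositions k N" and "I \<equiv> {\<sigma>. \<sigma> permutes {..<k}} \<times> {..<n}"
  obtains c where "\<And>\<sigma> a. \<sigma> permutes {..<k} \<Longrightarrow> c (a \<circ> \<sigma>) = c a"
    "((\<Sum>a\<in>T. gibbs k \<theta> a) ^ n / real (n + 1) ^ card T) ^ fact k
      \<le> (\<Sum>e | e \<in> PiE I (\<lambda>_. T) \<and> (\<forall>a. card {p \<in> I. e p = a} = c a). \<Prod>p\<in>I. gibbs k \<theta> (e p))"
proof -
  obtain c' where c': "(\<Sum>a\<in>T. gibbs k \<theta> a) ^ n / real (n + 1) ^ card T
      \<le> (\<Sum>e | e \<in> PiE {..<n} (\<lambda>_. T) \<and> (\<forall>a. card {p \<in> {..<n}. e p = a} = c' a). \<Prod>p<n. gibbs k \<theta> (e p))"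
    using popular_type[OF n, of k N \<theta>] unfolding T_def by blast
  define Per where "Per = {\<sigma>. \<sigma> permutes {..<k}}"
  have Per: "finite Per" "card Per = fact k" by (simp_all add: Per_def finite_permutations card_permutations)
  have I: "I = Per \<times> {..<n}" by (simp add: I_def Per_def)
  define c where "c a = (\<Sum>\<sigma>\<in>Per. c' (a \<circ> \<sigma>))" for a
  have c_sym: "c (a \<circ> \<tau>) = c a" if "\<tau> permutes {..<k}" for a \<tau>
    using setum_permutations_compose_left[OF that, of "\<lambda>\<sigma>. c' (a \<circ> \<sigma>)"]
    by (simp add: c_def Per_def o_assoc)
  define E' where "E' = {e. e \<in> PiE {..<n} (\<lambda>_. T) \<and> (\<forall>a. card {p \<in> {..<n}. e p = a} = c' a)}"
  define E where "E = {e. e \<in> PiE I (\<lambda>_. T) \<and> (\<forall>a. card {p \<in> I. e p = a} = c a)}"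
  have fin_T: "finite T" by (simp add: T_def)
  have fin_I: "finite I" using Per by (simp add: I)
  have fin: "finite E'" "finite E"
    unfolding E'_def E_def
    by (rule finite_subset[OF _ finite_PiE[of "{..<n}" "\<lambda>_. T"]]; use fin_T in auto)
      (rule finite_subset[OF _ finite_PiE[of I "\<lambda>_. T"]]; use fin_T fin_I in auto)
  \<comment> \<open>In the block of \<sigma> all letters are composed with the inverse of \<sigma>,
    so this block contributes \<open>c' (a \<circ> \<sigma>)\<close> to the count of
    \<open>a\<close>.\<close>
  define F where "F f = restrict (\<lambda>(\<sigma>, p). f \<sigma> p \<circ> inv_into UNIV \<sigma>) I" for f :: "(nat \<Rightarrow> nat) \<Rightarrow> nat \<Rightarrow> nat \<Rightarrow> nat"
  have inv1: "x \<circ> inv_into UNIV \<sigma> = a \<longleftrightarrow> x = a \<circ> \<sigma>" if "\<sigma> \<in> Per" for \<sigma> and x a :: "nat \<Rightarrow> nat"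
  proof -
    have "\<sigma> permutes {..<k}" using that by (simp add: Per_def)
    note inv = permutes_inv_o[OF this]
    show ?thesis
    proof
      assume "x \<circ> inv_into UNIV \<sigma> = a"
      then have "a \<circ> \<sigma> = x \<circ> (inv_into UNIV \<sigma> \<circ> \<sigma>)" by (auto simp: o_assoc)
      then show "x = a \<circ> \<sigma>" by (simp add: inv)
    next
      assume "x = a \<circ> \<sigma>"
      then have "x \<circ> inv_into UNIV \<sigma> = a \<circ> (\<sigma> \<circ> inv_into UNIV \<sigma>)" by (auto simp: o_assoc)
      then show "x \<circ> inv_into UNIV \<sigma> = a" by (simp add: inv)
    qed
  qed
  have F_E: "F f \<in> E" if f: "f \<in> PiE Per (\<lambda>_. E')" for f
  proof -
    have f\<sigma>: "f \<sigma> \<in> E'" if "\<sigma> \<in> Per" for \<sigma> using f that by auto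
    have "F f z \<in> T" if zI: "z \<in> I" for z
    proof -
      obtain \<sigma> p where z: "z = (\<sigma>, p)" "\<sigma> \<in> Per" "p < n" using zI unfolding I by (cases z) auto
      have "f \<sigma> p \<in> T" using f\<sigma>[OF z(2)] z(3) by (auto simp: E'_def)
      moreover have "inv_into UNIV \<sigma> permutes {..<k}" using z(2) by (simp add: Per_def permutes_inv)
      ultimately show ?thesis
        using zI compositions_permute[of "inv_into UNIV \<sigma>" k "f \<sigma> p" N] by (simp add: F_def z(1) T_def)
    qed
    then have "F f \<in> PiE I (\<lambda>_. T)" by (auto simp: F_def)
    moreover have "card {z \<in> I. F f z = a} = c a" for a
    proof -
      have "{z \<in> I. F f z = a} = (SIGMA \<sigma>:Per. {p \<in> {..<n}. f \<sigma> p = a \<circ> \<sigma>})"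
      proof (rule Set.set_eqI)
        fix z :: "(nat \<Rightarrow> nat) \<times> nat"
        obtain \<sigma> p where z: "z = (\<sigma>, p)" by (cases z)
        show "z \<in> {z \<in> I. F f z = a} \<longleftrightarrow> z \<in> (SIGMA \<sigma>:Per. {p \<in> {..<n}. f \<sigma> p = a \<circ> \<sigma>})"
          by (cases "\<sigma> \<in> Per"; cases "p < n") (simp_all add: z F_def inv1 I)
      qed
      then have "card {z \<in> I. F f z = a} = (\<Sum>\<sigma>\<in>Per. card {p \<in> {..<n}. f \<sigma> p = a \<circ> \<sigma>})"
        using Per by (simp add: card_SigmaI)
      also have "\<dots> = c a" unfolding c_def using f\<sigma> by (intro sum.cong) (auto simp: E'_def)
      finally show ?thesis .
    qed
    ultimately show ?thesis by (simp add: E_def)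
  qed
  have F_inj: "inj_on F (PiE Per (\<lambda>_. E'))"
  proof (rule inj_onI)
    fix f g assume f: "f \<in> PiE Per (\<lambda>_. E')" and g: "g \<in> PiE Per (\<lambda>_. E')" and eq: "F f = F g"
    show "f = g"
    proof (rule PiE_ext[OF f g])
      fix \<sigma> assume \<sigma>: "\<sigma> \<in> Per"
      have "f \<sigma> \<in> PiE {..<n} (\<lambda>_. T)" "g \<sigma> \<in> PiE {..<n} (\<lambda>_. T)"
        using PiE_mem[OF f \<sigma>] PiE_mem[OF g \<sigma>] by (auto simp: E'_def)
      then show "f \<sigma> = g \<sigma>"
      proof (rule PiE_ext)
        fix p assume "p \<in> {..<n}"
        then have "f \<sigma> p \<circ> inv_into UNIV \<sigma> = g \<sigma> p \<circ> inv_into UNIV \<sigma>" using fun_cong[OF eq, of "(\<sigma>, p)"] \<sigma> by (simp add: F_def I)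
        then have "f \<sigma> p = (g \<sigma> p \<circ> inv_into UNIV \<sigma>) \<circ> \<sigma>" using inv1[OF \<sigma>] by blast
        also have "\<dots> = g \<sigma> p" using inv1[OF \<sigma>, of "g \<sigma> p" "g \<sigma> p \<circ> inv_into UNIV \<sigma>"] by simp
        finally show "f \<sigma> p = g \<sigma> p" .
      qed
    qed
  qed
  have "((\<Sum>a\<in>T. gibbs k \<theta> a) ^ n / real (n + 1) ^ card T) ^ fact k \<le> (\<Sum>e\<in>E'. \<Prod>p<n. gibbs k \<theta> (e p)) ^ fact k"
    using c' unfolding E'_def by (intro power_mono) (auto simp: less_imp_le intro!: divide_nonneg_nonneg zero_le_power sum_nonneg)
  also have "\<dots> = (\<Prod>\<sigma>\<in>Per. \<Sum>e\<in>E'. \<Prod>p<n. gibbs k \<theta> (e p))" by (simp add: Per)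
  also have "\<dots> = (\<Sum>f\<in>PiE Per (\<lambda>_. E'). \<Prod>\<sigma>\<in>Per. \<Prod>p<n. gibbs k \<theta> (f \<sigma> p))"
    using Per fin by (intro prod_sum_PiE) auto
  also have "\<dots> = (\<Sum>f\<in>PiE Per (\<lambda>_. E'). \<Prod>z\<in>I. gibbs k \<theta> (F f z))"
  proof (intro sum.cong refl)
    fix f
    have "(\<Prod>z\<in>I. gibbs k \<theta> (F f z)) = (\<Prod>(\<sigma>, p)\<in>Per \<times> {..<n}. gibbs k \<theta> (f \<sigma> p))"
      unfolding I
    proof (intro prod.cong refl)
      fix z assume z: "z \<in> Per \<times> {..<n}"
      then obtain \<sigma> p where zs: "z = (\<sigma>, p)" "\<sigma> \<in> Per" by (cases z) auto
      have "inv_into UNIV \<sigma> permutes {..<k}" using zs(2) by (simp add: Per_def permutes_inv)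
      then show "gibbs k \<theta> (F f z) = (case z of (\<sigma>, p) \<Rightarrow> gibbs k \<theta> (f \<sigma> p))"
        using z by (simp add: F_def I zs(1) gibbs_permute)
    qed
    then show "(\<Prod>\<sigma>\<in>Per. \<Prod>p<n. gibbs k \<theta> (f \<sigma> p)) = (\<Prod>z\<in>I. gibbs k \<theta> (F f z))"
      by (simp add: prod.cartesian_product)
  qed
  also have "\<dots> = (\<Sum>e\<in>F ` PiE Per (\<lambda>_. E'). \<Prod>z\<in>I. gibbs k \<theta> (e z))"
    by (subst sum.reindex[OF F_inj]) simp
  also have "\<dots> \<le> (\<Sum>e\<in>E. \<Prod>z\<in>I. gibbs k \<theta> (e z))"
    using F_E fin by (intro sum_mono2) (auto simp: less_imp_le intro!: prod_nonneg)
  finally show ?thesis using c_sym by (intro that[of c]) (auto simp: E_def)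
qed

section \<open>Lattices modulo an integer\<close>

locale mod_lattice =
  fixes k q :: nat
  assumes q_ge_2: "q \<ge> 2"
begin

text \<open>Subgroups of (Z/q)^k, encoded by their preimages in Z^k so that integer digit
  differences can be tested without reduction. \<open>box\<close> holds the standard
  representatives, and \<open>density\<close> is the order of the subgroup.\<close>

definition lattice :: "(nat \<Rightarrow> int) set \<Rightarrow> bool" where
  "lattice V \<longleftrightarrow> (\<forall>x\<in>V. \<forall>i\<ge>k. x i = 0) \<and> (\<forall>x\<in>V. \<forall>y\<in>V. (\<lambda>i. x i - y i) \<in> V)
     \<and> (\<forall>x. (\<forall>i. int q dvd x i) \<and> (\<forall>i\<ge>k. x i = 0) \<longrightarrow> x \<in> V)"

definition box :: "(nat \<Rightarrow> int) set" where
  "box = {x. \<forall>i. (i \<in> {..<k} \<longrightarrow> x i \<in> {0..<int q}) \<and> (i \<notin> {..<k} \<longrightarrow> x i = 0)}"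

definition reduce :: "(nat \<Rightarrow> int) \<Rightarrow> nat \<Rightarrow> int" where
  "reduce x i = x i mod int q"

definition density :: "(nat \<Rightarrow> int) set \<Rightarrow> nat" where
  "density V = card (V \<inter> box)"

definition lattice_sum :: "(nat \<Rightarrow> int) set \<Rightarrow> (nat \<Rightarrow> int) set \<Rightarrow> (nat \<Rightarrow> int) set" where
  "lattice_sum V W = {\<lambda>i. x i + y i | x y. x \<in> V \<and> y \<in> W}"

lemma lattice_sumI:
  "x \<in> V \<Longrightarrow> y \<in> W \<Longrightarrow> (\<And>i. z i = x i + y i) \<Longrightarrow> z \<in> lattice_sum V W"
  unfolding lattice_sum_def by (intro CollectI exI[of _ x] exI[of _ y]) auto

lemma finite_box [simp]: "finite box"
  unfolding box_def by (rule finite_set_of_finite_funs) auto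

lemma lattice_supp: "lattice V \<Longrightarrow> x \<in> V \<Longrightarrow> i \<ge> k \<Longrightarrow> x i = 0"
  by (auto simp: lattice_def)

lemma lattice_multiples:
  "lattice V \<Longrightarrow> (\<And>i. int q dvd x i) \<Longrightarrow> (\<And>i. i \<ge> k \<Longrightarrow> x i = 0) \<Longrightarrow> x \<in> V"
  by (auto simp: lattice_def)

lemma lattice_diff: "lattice V \<Longrightarrow> x \<in> V \<Longrightarrow> y \<in> V \<Longrightarrow> (\<lambda>i. x i - y i) \<in> V"
  by (auto simp: lattice_def)

lemma lattice_zero: "lattice V \<Longrightarrow> (\<lambda>_. 0) \<in> V"
  by (rule lattice_multiples) auto

lemma lattice_neg: "lattice V \<Longrightarrow> x \<in> V \<Longrightarrow> (\<lambda>i. - x i) \<in> V"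
  using lattice_diff[of V "\<lambda>_. 0" x] lattice_zero by simp

lemma lattice_add: "lattice V \<Longrightarrow> x \<in> V \<Longrightarrow> y \<in> V \<Longrightarrow> (\<lambda>i. x i + y i) \<in> V"
  using lattice_diff[of V x "\<lambda>i. - y i"] lattice_neg by simp

lemma lattice_scale:
  assumes "lattice V" "x \<in> V"
  shows "(\<lambda>i. n * x i) \<in> V"
proof -
  have nat: "(\<lambda>i. int m * x i) \<in> V" for m
  proof (induction m)
    case (Suc m)
    then show ?case using lattice_add[OF assms(1) Suc assms(2)] by (simp add: algebra_simps)
  qed (use lattice_zero assms in auto)
  show ?thesis
  proof (cases "n \<ge> 0")
    case True
    then show ?thesis using nat[of "nat n"] by simp
  next
    case False
    then show ?thesis using lattice_neg[OF assms(1) nat[of "nat (- n)"]] by simp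
  qed
qed

lemma lattice_sum_mem:
  assumes "lattice V" "finite J" "\<And>j. j \<in> J \<Longrightarrow> f j \<in> V"
  shows "(\<lambda>i. \<Sum>j\<in>J. f j i) \<in> V"
  using assms(2,3)
  by (induction J rule: finite_induct) (auto simp: lattice_zero lattice_add assms(1))

lemma lattice_cong:
  assumes "lattice V" "x \<in> V" "\<And>i. int q dvd (y i - x i)" "\<And>i. i \<ge> k \<Longrightarrow> y i = 0"
  shows "y \<in> V"
proof -
  have "(\<lambda>i. y i - x i) \<in> V"
    using assms(3,4) lattice_supp[OF assms(1,2)] by (intro lattice_multiples[OF assms(1)]) auto
  from lattice_add[OF assms(1) this assms(2)] show ?thesis by simp
qed

lemma reduce_box: "(\<And>i. i \<ge> k \<Longrightarrow> x i = 0) \<Longrightarrow> reduce x \<in> box"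
  using q_ge_2 by (auto simp: box_def reduce_def)

lemma reduce_lattice:
  assumes "lattice V" "x \<in> V"
  shows "reduce x \<in> V \<inter> box"
proof -
  have "reduce x \<in> V"
    by (rule lattice_cong[OF assms])
      (use lattice_supp[OF assms] in \<open>auto simp: reduce_def mod_eq_dvd_iff[symmetric]\<close>)
  then show ?thesis using reduce_box lattice_supp[OF assms] by blast
qed

lemma box_eqI:
  assumes "x \<in> box" "y \<in> box" "\<And>i. int q dvd (x i - y i)"
  shows "x = y"
proof
  fix i
  have "x i mod int q = y i mod int q" using assms(3) by (simp add: mod_eq_dvd_iff)
  moreover have "x i \<in> {0..<int q}" "y i \<in> {0..<int q}" if "i < k"
    using assms(1,2) that by (simp_all add: box_def)
  moreover have "x i = 0" "y i = 0" if "\<not> i < k" using assms(1,2) that by (simp_all add: box_def)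
  ultimately show "x i = y i" by (cases "i < k") auto
qed

lemma lattice_eqI:
  assumes "lattice V" "lattice W" "V \<inter> box = W \<inter> box"
  shows "V = W"
proof -
  have "V \<subseteq> W" if "lattice V" "lattice W" "V \<inter> box \<subseteq> W" for V W
  proof
    fix x assume x: "x \<in> V"
    then have "reduce x \<in> W" using reduce_lattice[OF that(1)] that(3) by blast
    then show "x \<in> W"
      by (rule lattice_cong[OF that(2)])
        (use lattice_supp[OF that(1) x] in \<open>auto simp: reduce_def mod_eq_dvd_iff[symmetric]\<close>)
  qed
  then show ?thesis using assms by blast
qed

lemma finite_lattices: "finite {V. lattice V}"
proof (rule inj_on_finite)
  show "inj_on (\<lambda>V. V \<inter> box) {V. lattice V}" by (rule inj_onI, rule lattice_eqI) auto
  show "(\<lambda>V. V \<inter> box) ` {V. lattice V} \<subseteq> Pow box" by blast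
qed (rule finite_Pow_iff[THEN iffD2], rule finite_box)

lemma lattice_Int: "lattice V \<Longrightarrow> lattice W \<Longrightarrow> lattice (V \<inter> W)"
  unfolding lattice_def Int_iff by (intro conjI ballI allI impI; blast)

lemma lattice_lattice_sum:
  assumes "lattice V" "lattice W"
  shows "lattice (lattice_sum V W)"
  unfolding lattice_def
proof (intro conjI ballI allI impI)
  fix x y assume "x \<in> lattice_sum V W" "y \<in> lattice_sum V W"
  then obtain x1 x2 y1 y2 where xy: "x = (\<lambda>i. x1 i + x2 i)" "y = (\<lambda>i. y1 i + y2 i)"
    "x1 \<in> V" "y1 \<in> V" "x2 \<in> W" "y2 \<in> W" by (auto simp: lattice_sum_def)
  show "(\<lambda>i. x i - y i) \<in> lattice_sum V W"
    using lattice_diff[OF assms(1) xy(3,4)] lattice_diff[OF assms(2) xy(5,6)]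
    by (rule lattice_sumI) (simp add: xy)
next
  fix x assume "(\<forall>i. int q dvd x i) \<and> (\<forall>i\<ge>k. x i = 0)"
  then have "x \<in> V" by (intro lattice_multiples[OF assms(1)]) auto
  then show "x \<in> lattice_sum V W" using lattice_zero[OF assms(2)] by (rule lattice_sumI) simp
next
  fix x i assume "x \<in> lattice_sum V W" and i: "i \<ge> k"
  then obtain x1 x2 where x: "x = (\<lambda>i. x1 i + x2 i)" "x1 \<in> V" "x2 \<in> W"
    by (auto simp: lattice_sum_def)
  then show "x i = 0" using lattice_supp[OF assms(1) x(2) i] lattice_supp[OF assms(2) x(3) i] by simp
qed

lemma lattice_sum_upper:
  assumes "lattice W"
  shows "V \<subseteq> lattice_sum V W"
proof
  fix x assume "x \<in> V"
  then show "x \<in> lattice_sum V W" using lattice_zero[OF assms] by (rule lattice_sumI) simp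
qed

lemma lattice_sum_upper2:
  assumes "lattice V"
  shows "W \<subseteq> lattice_sum V W"
proof
  fix x assume "x \<in> W"
  with lattice_zero[OF assms] show "x \<in> lattice_sum V W" by (rule lattice_sumI) simp
qed

lemma lattice_sum_least:
  "lattice Y \<Longrightarrow> V \<subseteq> Y \<Longrightarrow> W \<subseteq> Y \<Longrightarrow> lattice_sum V W \<subseteq> Y"
  by (auto simp: lattice_sum_def intro!: lattice_add[of Y])

lemma density_pos: "lattice V \<Longrightarrow> density V \<ge> 1"
proof -
  assume V: "lattice V"
  then have "(\<lambda>_. 0) \<in> V \<inter> box" using lattice_zero q_ge_2 by (auto simp: box_def)
  then show ?thesis by (auto simp: density_def Suc_le_eq card_gt_0_iff)
qed

text \<open>The order formula for sum and intersection of two subgroups, in the direction needed: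
  the logarithm of the order is submodular.\<close>

lemma density_exchange:
  assumes V: "lattice V" and W: "lattice W"
  shows "density (lattice_sum V W) * density (V \<inter> W) \<le> density V * density W"
proof -
  let ?S = "lattice_sum V W \<inter> box" and ?D = "V \<inter> W \<inter> box"
  have "\<exists>x y. x \<in> V \<and> y \<in> W \<and> z = (\<lambda>i. x i + y i)" if "z \<in> ?S" for z
    using that by (auto simp: lattice_sum_def)
  then obtain f g where fg: "\<And>z. z \<in> ?S \<Longrightarrow> f z \<in> V \<and> g z \<in> W \<and> z = (\<lambda>i. f z i + g z i)"
    by metis
  \<comment> \<open>A fixed splitting of \<open>z\<close> into summands from \<open>V\<close> and
    \<open>W\<close> is shifted by \<open>d\<close>. The sum of the two images recovers
    \<open>z\<close>, and after that the first image recovers \<open>d\<close>.\<close>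
  define F where "F = (\<lambda>(z, d). (reduce (\<lambda>i. f z i + d i), reduce (\<lambda>i. g z i - d i)))"
  have "card (?S \<times> ?D) \<le> card ((V \<inter> box) \<times> (W \<inter> box))"
  proof (rule card_inj_on_le)
    show "inj_on F (?S \<times> ?D)"
    proof (rule inj_onI, clarify)
      fix z d z' d'
      assume z: "z \<in> lattice_sum V W" "z \<in> box" "z' \<in> lattice_sum V W" "z' \<in> box"
        and d: "d \<in> V" "d \<in> W" "d \<in> box" "d' \<in> V" "d' \<in> W" "d' \<in> box"
        and eq: "F (z, d) = F (z', d')"
      have dv: "int q dvd (f z i + d i) - (f z' i + d' i)" "int q dvd (g z i - d i) - (g z' i - d' i)" for i
        using eq by (auto simp: F_def reduce_def fun_eq_iff mod_eq_dvd_iff)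
      have "int q dvd z i - z' i" for i
      proof -
        have "z i = f z i + g z i" "z' i = f z' i + g z' i"
          using fg[of z] fg[of z'] z by (auto dest: fun_cong)
        then show ?thesis using dvd_add[OF dv(1)[of i] dv(2)[of i]] by (simp add: algebra_simps)
      qed
      then have zz: "z = z'" using z by (intro box_eqI)
      then have "d = d'" using dv(1) d by (intro box_eqI) (auto simp: algebra_simps)
      with zz show "z = z' \<and> d = d'" by simp
    qed
    show "F ` (?S \<times> ?D) \<subseteq> (V \<inter> box) \<times> (W \<inter> box)"
    proof (rule image_subsetI)
      fix zd assume zd: "zd \<in> ?S \<times> ?D"
      obtain z d where [simp]: "zd = (z, d)" by (cases zd)
      show "F zd \<in> (V \<inter> box) \<times> (W \<inter> box)"
        unfolding F_def \<open>zd = (z, d)\<close> prod.case using fg[of z] zd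
        by (intro SigmaI reduce_lattice[OF V] reduce_lattice[OF W] lattice_add[OF V] lattice_diff[OF W]) auto
    qed
  qed auto
  then show ?thesis by (simp add: density_def card_cartesian_product)
qed

definition lattice_permute :: "(nat \<Rightarrow> nat) \<Rightarrow> (nat \<Rightarrow> int) set \<Rightarrow> (nat \<Rightarrow> int) set" where
  "lattice_permute \<sigma> V = (\<lambda>x. x \<circ> \<sigma>) ` V"

lemma
  assumes \<sigma>: "\<sigma> permutes {..<k}" and V: "lattice V"
  shows lattice_lattice_permute: "lattice (lattice_permute \<sigma> V)"
    and density_lattice_permute: "density (lattice_permute \<sigma> V) = density V"
proof -
  have inv: "x \<circ> \<sigma> \<circ> inv_into UNIV \<sigma> = x" "x \<circ> inv_into UNIV \<sigma> \<circ> \<sigma> = x" for x :: "nat \<Rightarrow> int"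
    using permutes_inv_o[OF \<sigma>] by (simp_all add: o_assoc[symmetric])
  have out: "\<sigma> i = i" "inv_into UNIV \<sigma> i = i" if "i \<ge> k" for i
    using permutes_not_in[OF \<sigma>] permutes_not_in[OF permutes_inv[OF \<sigma>]] that by auto
  have mem: "x \<in> lattice_permute \<sigma> V \<longleftrightarrow> x \<circ> inv_into UNIV \<sigma> \<in> V" for x
    unfolding lattice_permute_def using inv by (metis (no_types, lifting) image_iff)
  show "lattice (lattice_permute \<sigma> V)"
    unfolding lattice_def
  proof (intro conjI ballI allI impI)
    fix x i assume "x \<in> lattice_permute \<sigma> V" "i \<ge> k"
    then show "x i = 0" using lattice_supp[OF V, of "x \<circ> inv_into UNIV \<sigma>" i] out by (simp add: mem)
  next
    fix x y assume "x \<in> lattice_permute \<sigma> V" "y \<in> lattice_permute \<sigma> V"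
    then show "(\<lambda>i. x i - y i) \<in> lattice_permute \<sigma> V"
      using lattice_diff[OF V, of "x \<circ> inv_into UNIV \<sigma>" "y \<circ> inv_into UNIV \<sigma>"] by (simp add: mem o_def)
  next
    fix x assume "(\<forall>i. int q dvd x i) \<and> (\<forall>i\<ge>k. x i = 0)"
    then show "x \<in> lattice_permute \<sigma> V"
      using out unfolding mem by (intro lattice_multiples[OF V]) auto
  qed
  have box_iff: "x \<circ> \<sigma> \<in> box \<longleftrightarrow> x \<in> box" for x
    using permutes_in_image[OF \<sigma>] permutes_surj[OF \<sigma>] unfolding box_def mem_Collect_eq o_def
    by (metis (mono_tags, lifting) surj_def)
  have "lattice_permute \<sigma> V \<inter> box = (\<lambda>x. x \<circ> \<sigma>) ` (V \<inter> box)"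
    unfolding lattice_permute_def using box_iff by auto
  moreover have "inj_on (\<lambda>x. x \<circ> \<sigma>) (V \<inter> box)" by (rule inj_on_inverseI[where g = "\<lambda>x. x \<circ> inv_into UNIV \<sigma>"]) (rule inv)
  ultimately show "density (lattice_permute \<sigma> V) = density V"
    by (simp add: density_def card_image)
qed

text \<open>The multiples of \<open>x\<close> by 0, ..., q-1 are distinct modulo \<open>q\<close>,
  because coordinate \<open>j\<close> of \<open>x\<close> is a unit.\<close>

lemma density_ge_modulus:
  assumes V: "lattice V" and x: "x \<in> V" "coprime (x j) (int q)"
  shows "density V \<ge> q"
proof -
  have "card {0..<int q} \<le> card (V \<inter> box)"
  proof (rule card_inj_on_le)
    show "(\<lambda>t. reduce (\<lambda>i. t * x i)) ` {0..<int q} \<subseteq> V \<inter> box"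
      using reduce_lattice[OF V lattice_scale[OF V x(1)]] by blast
    show "inj_on (\<lambda>t. reduce (\<lambda>i. t * x i)) {0..<int q}"
    proof (rule inj_onI)
      fix s t assume st: "s \<in> {0..<int q}" "t \<in> {0..<int q}"
        and "reduce (\<lambda>i. s * x i) = reduce (\<lambda>i. t * x i)"
      then have "int q dvd (s - t) * x j"
        by (auto simp: reduce_def fun_eq_iff mod_eq_dvd_iff algebra_simps)
      then have "int q dvd s - t" using x(2) by (simp add: coprime_dvd_mult_left_iff coprime_commute)
      then show "s = t" using st by (auto simp: mod_eq_dvd_iff[symmetric])
    qed
  qed simp
  then show ?thesis by (simp add: density_def)
qed

text \<open>The lattice in which differences of two solutions with equal \<open>i\<close>-th component live.\<close>

definition balanced :: "nat \<Rightarrow> (nat \<Rightarrow> int) set" where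
  "balanced i = {x. (\<forall>j\<ge>k. x j = 0) \<and> int q dvd x i \<and> int q dvd (\<Sum>j<k. x j)}"

lemma lattice_balanced: "lattice (balanced i)"
  unfolding lattice_def balanced_def by (auto simp: sum_subtractf intro!: dvd_sum)

text \<open>All coordinates except \<open>i\<close> and one more are free; the latter is fixed by
  the sum condition.\<close>

lemma density_balanced:
  assumes i: "i < k" and k: "k \<ge> 3"
  shows "density (balanced i) \<ge> q ^ (k - 2)"
proof -
  obtain b where b: "b < k" "b \<noteq> i"
  proof -
    have "(if i = 0 then 1 else 0) < k" "(if i = 0 then 1 else 0) \<noteq> i" using k by auto
    then show ?thesis using that by blast
  qed
  let ?J = "{..<k} - {i, b}"
  define F where "F f j = (if j \<in> ?J then f j else if j = b then (- (\<Sum>j\<in>?J. f j)) mod int q else 0)"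
    for f :: "nat \<Rightarrow> int" and j
  have "card (PiE ?J (\<lambda>_. {0..<int q})) \<le> card (balanced i \<inter> box)"
  proof (rule card_inj_on_le)
    show "inj_on F (PiE ?J (\<lambda>_. {0..<int q}))"
    proof (rule inj_onI)
      fix f g assume f: "f \<in> PiE ?J (\<lambda>_. {0..<int q})" and g: "g \<in> PiE ?J (\<lambda>_. {0..<int q})"
        and eq: "F f = F g"
      show "f = g"
      proof (rule PiE_ext[OF f g])
        fix j assume "j \<in> ?J"
        then show "f j = g j" using fun_cong[OF eq, of j] by (simp add: F_def)
      qed
    qed
    show "F ` PiE ?J (\<lambda>_. {0..<int q}) \<subseteq> balanced i \<inter> box"
    proof
      fix x assume "x \<in> F ` PiE ?J (\<lambda>_. {0..<int q})"
      then obtain f where f: "f \<in> PiE ?J (\<lambda>_. {0..<int q})" and x: "x = F f" by blast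
      have fj: "0 \<le> f j" "f j < int q" if "j \<in> ?J" for j using PiE_mem[OF f that] by auto
      have "(\<Sum>j<k. x j) = x i + x b + (\<Sum>j\<in>?J. x j)"
        using i b by (subst sum.subset_diff[of "{i, b}"]) auto
      also have "(\<Sum>j\<in>?J. x j) = (\<Sum>j\<in>?J. f j)" by (intro sum.cong) (auto simp: x F_def)
      also have "x i + x b = (- (\<Sum>j\<in>?J. f j)) mod int q" using b by (simp add: x F_def)
      finally have "int q dvd (\<Sum>j<k. x j)"
        by (simp add: dvd_eq_mod_eq_0 mod_add_left_eq)
      moreover have "x \<in> box" using fj b q_ge_2 by (auto simp: x F_def box_def)
      moreover have "x i = 0" using b by (simp add: x F_def)
      moreover have "\<forall>j\<ge>k. x j = 0" using b i by (auto simp: x F_def)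
      ultimately show "x \<in> balanced i \<inter> box" by (auto simp: balanced_def)
    qed
  qed auto
  moreover have "card (PiE ?J (\<lambda>_. {0..<int q})) = q ^ (k - 2)"
    using i b by (simp add: card_PiE card_Diff_subset numeral_2_eq_2)
  ultimately show ?thesis by (simp add: density_def)
qed

definition lattice_span :: "(nat \<Rightarrow> int) set \<Rightarrow> (nat \<Rightarrow> int) set" where
  "lattice_span D = {x. (\<forall>j\<ge>k. x j = 0) \<and> (\<exists>w. \<forall>j. int q dvd x j - (\<Sum>d\<in>D. w d * d j))}"

lemma lattice_lattice_span:
  shows "lattice (lattice_span D)"
  unfolding lattice_def
proof (intro conjI ballI allI impI)
  fix x y assume "x \<in> lattice_span D" "y \<in> lattice_span D"
  then obtain w w' where supp: "\<forall>j\<ge>k. x j = 0" "\<forall>j\<ge>k. y j = 0"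
    and w: "\<And>j. int q dvd x j - (\<Sum>d\<in>D. w d * d j)" "\<And>j. int q dvd y j - (\<Sum>d\<in>D. w' d * d j)"
    by (auto simp: lattice_span_def)
  have "int q dvd (x j - y j) - (\<Sum>d\<in>D. (w d - w' d) * d j)" for j
    using dvd_diff[OF w(1)[of j] w(2)[of j]] by (simp add: algebra_simps sum_subtractf)
  then show "(\<lambda>i. x i - y i) \<in> lattice_span D"
    using supp by (auto simp: lattice_span_def intro!: exI[of _ "\<lambda>d. w d - w' d"])
next
  fix x assume "(\<forall>i. int q dvd x i) \<and> (\<forall>i\<ge>k. x i = 0)"
  then show "x \<in> lattice_span D" by (auto simp: lattice_span_def intro!: exI[of _ "\<lambda>_. 0"])
qed (auto simp: lattice_span_def)

lemma lattice_span_base: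
  assumes "finite D" "d \<in> D" "\<And>j. j \<ge> k \<Longrightarrow> d j = 0"
  shows "d \<in> lattice_span D"
proof -
  have "(\<Sum>d'\<in>D. (if d' = d then 1 else 0) * d' j) = d j" for j
    using assms by (subst sum.remove[of _ d]) auto
  then show ?thesis
    using assms(3) by (auto simp: lattice_span_def intro!: exI[of _ "\<lambda>d'. if d' = d then 1 else 0"])
qed

lemma lattice_span_least:
  assumes "lattice V" "finite D" "D \<subseteq> V"
  shows "lattice_span D \<subseteq> V"
proof
  fix x assume "x \<in> lattice_span D"
  then obtain w where x: "\<forall>j\<ge>k. x j = 0" "\<And>j. int q dvd x j - (\<Sum>d\<in>D. w d * d j)"
    by (auto simp: lattice_span_def)
  have "(\<lambda>j. \<Sum>d\<in>D. w d * d j) \<in> V"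
    using assms by (intro lattice_sum_mem[OF assms(1,2)] lattice_scale[OF assms(1)]) auto
  then show "x \<in> V" by (rule lattice_cong[OF assms(1)]) (use x in auto)
qed

end

section \<open>Classes of words\<close>

text \<open>Digit differences have absolute value at most \<open>N\<close>, and differences of these
  at most \<open>2 * N\<close>. The coprimality condition makes all nonzero ones units modulo
  \<open>q\<close> and takes the place of primality of \<open>q\<close>.\<close>

locale word_class = mod_lattice k q for k q :: nat +
  fixes N :: nat and I :: "'i set" and c :: "(nat \<Rightarrow> nat) \<Rightarrow> nat"
  assumes k_ge_3: "k \<ge> 3" and N_pos: "N \<ge> 1" and finite_I [simp]: "finite I"
    and coprime_q: "\<And>t. 1 \<le> t \<Longrightarrow> t \<le> 2 * N \<Longrightarrow> coprime t q"
    and c_symmetric: "\<And>\<sigma> a. \<sigma> permutes {..<k} \<Longrightarrow> c (a \<circ> \<sigma>) = c a"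
begin

abbreviation T where "T \<equiv> compositions k N"

definition words :: "('i \<Rightarrow> nat \<Rightarrow> nat) set" where
  "words = {e \<in> PiE I (\<lambda>_. T). \<forall>a. card {p \<in> I. e p = a} = c a}"

text \<open>All solutions whose components have the same composition as those of the elements of \<open>words\<close>.\<close>

definition solutions :: "('i \<Rightarrow> nat \<Rightarrow> nat) set" where
  "solutions = {e \<in> PiE I (\<lambda>_. T). \<forall>i<k. \<forall>v. card {p \<in> I. e p i = v} = (\<Sum>a | a \<in> T \<and> a i = v. c a)}"

definition word_diff :: "('i \<Rightarrow> nat \<Rightarrow> nat) \<Rightarrow> ('i \<Rightarrow> nat \<Rightarrow> nat) \<Rightarrow> 'i \<Rightarrow> nat \<Rightarrow> int" where
  "word_diff e e' p i = int (e' p i) - int (e p i)"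

definition cls :: "('i \<Rightarrow> nat \<Rightarrow> nat) set \<Rightarrow> (nat \<Rightarrow> int) set \<Rightarrow> ('i \<Rightarrow> nat \<Rightarrow> nat) \<Rightarrow> ('i \<Rightarrow> nat \<Rightarrow> nat) set" where
  "cls A V e = {e' \<in> A. \<forall>p\<in>I. word_diff e e' p \<in> V}"

lemma q_gt: "q > 2 * N"
proof (rule ccontr)
  assume "\<not> q > 2 * N"
  then have "coprime q q" using q_ge_2 by (intro coprime_q) auto
  then show False using q_ge_2 by simp
qed

lemma finite_PiE_T [simp]: "finite (PiE I (\<lambda>_. T))"
  by (intro finite_PiE) auto

lemma finite_words [simp]: "finite words"
  by (rule finite_subset[of _ "PiE I (\<lambda>_. T)"]) (auto simp: words_def)

lemma finite_solutions [simp]: "finite solutions"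
  by (rule finite_subset[of _ "PiE I (\<lambda>_. T)"]) (auto simp: solutions_def)

lemma finite_cls [simp]: "finite A \<Longrightarrow> finite (cls A V e)"
  by (simp add: cls_def)

lemma words_subset_solutions: "words \<subseteq> solutions"
proof
  fix e assume e: "e \<in> words"
  have "card {p \<in> I. e p i = v} = (\<Sum>a | a \<in> T \<and> a i = v. c a)" for i v
  proof -
    have "{p \<in> I. e p i = v} = (\<Union>a\<in>{a \<in> T. a i = v}. {p \<in> I. e p = a})"
      using e by (auto simp: words_def PiE_def Pi_def)
    also have "card \<dots> = (\<Sum>a | a \<in> T \<and> a i = v. card {p \<in> I. e p = a})"
      by (subst card_UN_disjoint) auto
    finally show ?thesis using e by (simp add: words_def)
  qed
  then show "e \<in> solutions" using e by (simp add: words_def solutions_def)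
qed

lemma solutions_mem:
  assumes "e \<in> solutions" "p \<in> I"
  shows "e p \<in> T"
  using assms by (auto simp: solutions_def PiE_def Pi_def)

lemma word_diff_supp: "e \<in> solutions \<Longrightarrow> e' \<in> solutions \<Longrightarrow> p \<in> I \<Longrightarrow> i \<ge> k \<Longrightarrow> word_diff e e' p i = 0"
  using solutions_mem[of e p] solutions_mem[of e' p] by (auto simp: word_diff_def compositions_def)

lemma word_diff_bound: "e \<in> solutions \<Longrightarrow> e' \<in> solutions \<Longrightarrow> p \<in> I \<Longrightarrow> \<bar>word_diff e e' p i\<bar> \<le> int N"
  using compositions_le[OF solutions_mem[of e p], of i] compositions_le[OF solutions_mem[of e' p], of i]
  by (auto simp: word_diff_def)

lemma sum_word_diff:
  assumes "e \<in> solutions" "e' \<in> solutions" "p \<in> I"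
  shows "(\<Sum>i<k. word_diff e e' p i) = 0"
proof -
  have "(\<Sum>i<k. e p i) = N" "(\<Sum>i<k. e' p i) = N"
    using solutions_mem[OF assms(1,3)] solutions_mem[OF assms(2,3)] by (auto simp: compositions_def)
  then show ?thesis by (simp add: word_diff_def sum_subtractf of_nat_sum[symmetric] del: of_nat_sum)
qed

lemma small_dvd_imp_zero: "int q dvd t \<Longrightarrow> \<bar>t\<bar> \<le> 2 * int N \<Longrightarrow> t = 0"
  using q_gt zdvd_imp_le[of "int q" "\<bar>t\<bar>"] by (cases "t = 0") auto

lemma small_coprime: "t \<noteq> 0 \<Longrightarrow> \<bar>t\<bar> \<le> 2 * int N \<Longrightarrow> coprime t (int q)"
proof -
  assume "t \<noteq> 0" "\<bar>t\<bar> \<le> 2 * int N"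
  then have "coprime (nat \<bar>t\<bar>) q" by (intro coprime_q) auto
  then have "coprime \<bar>t\<bar> (int q)" by (metis abs_ge_zero coprime_int_iff nat_0_le)
  then show ?thesis by simp
qed

lemma cls_refl:
  assumes "lattice V" "e \<in> A"
  shows "e \<in> cls A V e"
proof -
  have "word_diff e e p \<in> V" for p
    using lattice_zero[OF assms(1)] by (simp add: word_diff_def[abs_def])
  then show ?thesis using assms by (simp add: cls_def)
qed

lemma cls_trans:
  assumes "lattice V" "e1 \<in> cls A V e" "e2 \<in> cls B V e1"
  shows "e2 \<in> cls B V e"
  unfolding cls_def
proof (intro CollectI conjI ballI)
  fix p assume "p \<in> I"
  then have "word_diff e e1 p \<in> V" "word_diff e1 e2 p \<in> V" using assms by (auto simp: cls_def)
  from lattice_add[OF assms(1) this] show "word_diff e e2 p \<in> V"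
    by (simp add: word_diff_def[abs_def])
qed (use assms in \<open>auto simp: cls_def\<close>)

lemma cls_sym:
  assumes "lattice V" "e' \<in> cls A V e" "e \<in> B"
  shows "e \<in> cls B V e'"
  unfolding cls_def
proof (intro CollectI conjI ballI)
  fix p assume "p \<in> I"
  then have "word_diff e e' p \<in> V" using assms by (auto simp: cls_def)
  from lattice_neg[OF assms(1) this] show "word_diff e' e p \<in> V"
    by (simp add: word_diff_def[abs_def])
qed (use assms in auto)

text \<open>Equal letter counts mean that the words are rearrangements of each other. Position
  permutations thus act transitively on \<open>words\<close>, and class sizes do not depend on the
  base word.\<close>

lemma words_conjugate:
  assumes "e \<in> words" "e' \<in> words"
  obtains f where "f permutes I" "\<And>p. p \<in> I \<Longrightarrow> e' p = e (f p)"
proof -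
  have "image_mset e' (mset_set I) = image_mset e (mset_set I)"
  proof (rule multiset_eqI)
    fix a
    have "count (image_mset g (mset_set I)) a = card {p \<in> I. g p = a}" for g :: "'i \<Rightarrow> nat \<Rightarrow> nat"
      by (simp add: count_image_mset Int_def vimage_def conj_commute)
    then show "count (image_mset e' (mset_set I)) a = count (image_mset e (mset_set I)) a"
      using assms by (simp add: words_def)
  qed
  from image_mset_eq_implies_permutes[OF finite_I this]
  obtain f where "f permutes I" "\<forall>p\<in>I. e' p = e (f p)" by metis
  then show ?thesis by (intro that[of f]) auto
qed

definition position_invariant :: "('i \<Rightarrow> nat \<Rightarrow> nat) set \<Rightarrow> bool" where
  "position_invariant A \<longleftrightarrow> (\<forall>e\<in>A. \<forall>f. f permutes I \<longrightarrow> restrict (\<lambda>p. e (f p)) I \<in> A) \<and> A \<subseteq> extensional I"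

lemma card_reindex_positions:
  assumes "f permutes I"
  shows "card {p \<in> I. P (e (f p))} = card {p \<in> I. P (e p)}"
proof (rule bij_betw_same_card)
  show "bij_betw f {p \<in> I. P (e (f p))} {p \<in> I. P (e p)}"
  proof (rule bij_betw_byWitness[where f' = "inv_into UNIV f"])
    show "f ` {p \<in> I. P (e (f p))} \<subseteq> {p \<in> I. P (e p)}"
      using permutes_in_image[OF assms] by auto
    show "inv_into UNIV f ` {p \<in> I. P (e p)} \<subseteq> {p \<in> I. P (e (f p))}"
      using permutes_in_image[OF permutes_inv[OF assms]] permutes_inverses[OF assms] by auto
  qed (use permutes_inverses[OF assms] in auto)
qed

lemma position_invariant_words: "position_invariant words"
  unfolding position_invariant_def
proof (intro conjI ballI allI impI)
  fix e f assume e: "e \<in> words" and f: "f permutes I"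
  have "card {p \<in> I. restrict (\<lambda>p. e (f p)) I p = a} = c a" for a
    using card_reindex_positions[OF f, of "\<lambda>x. x = a" e] e
    by (simp add: words_def cong: conj_cong)
  then show "restrict (\<lambda>p. e (f p)) I \<in> words"
    using e permutes_in_image[OF f] by (auto simp: words_def PiE_def Pi_def)
qed (auto simp: words_def PiE_def)

lemma position_invariant_solutions: "position_invariant solutions"
  unfolding position_invariant_def
proof (intro conjI ballI allI impI)
  fix e f assume e: "e \<in> solutions" and f: "f permutes I"
  have "card {p \<in> I. restrict (\<lambda>p. e (f p)) I p i = v} = card {p \<in> I. e p i = v}" for i v
    using card_reindex_positions[OF f, of "\<lambda>x. x i = v" e]
    by (simp cong: conj_cong)
  then show "restrict (\<lambda>p. e (f p)) I \<in> solutions"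
    using e permutes_in_image[OF f] by (auto simp: solutions_def PiE_def Pi_def)
qed (auto simp: solutions_def PiE_def)

lemma card_cls_le:
  assumes A: "position_invariant A" "finite A" and e: "e \<in> words" "e' \<in> words"
  shows "card (cls A V e) \<le> card (cls A V e')"
proof -
  obtain f where f: "f permutes I" "\<And>p. p \<in> I \<Longrightarrow> e' p = e (f p)"
    using words_conjugate[OF e] by blast
  show ?thesis
  proof (rule card_inj_on_le)
    show "inj_on (\<lambda>x. restrict (\<lambda>p. x (f p)) I) (cls A V e)"
    proof (rule inj_onI)
      fix x y assume xy: "x \<in> cls A V e" "y \<in> cls A V e"
        and eq: "restrict (\<lambda>p. x (f p)) I = restrict (\<lambda>p. y (f p)) I"
      have "x \<in> extensional I" "y \<in> extensional I"
        using xy A by (auto simp: cls_def position_invariant_def)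
      then show "x = y"
      proof (rule extensionalityI)
        fix p assume "p \<in> I"
        then have "inv_into UNIV f p \<in> I" using permutes_in_image[OF permutes_inv[OF f(1)]] by blast
        then show "x p = y p"
          using fun_cong[OF eq, of "inv_into UNIV f p"] permutes_inverses[OF f(1)] by simp
      qed
    qed
    show "(\<lambda>x. restrict (\<lambda>p. x (f p)) I) ` cls A V e \<subseteq> cls A V e'"
    proof (rule image_subsetI)
      fix x assume x: "x \<in> cls A V e"
      have "word_diff e' (restrict (\<lambda>p. x (f p)) I) p \<in> V" if p: "p \<in> I" for p
      proof -
        have "word_diff e' (restrict (\<lambda>p. x (f p)) I) p = word_diff e x (f p)"
          using p f(2) by (simp add: word_diff_def[abs_def])
        then show ?thesis using x permutes_in_image[OF f(1)] p by (simp add: cls_def)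
      qed
      then show "restrict (\<lambda>p. x (f p)) I \<in> cls A V e'"
        using x A(1) f(1) by (auto simp: cls_def position_invariant_def)
    qed
  qed (use A in auto)
qed

lemma card_cls_eq:
  assumes "position_invariant A" "finite A" "e \<in> words" "e' \<in> words"
  shows "card (cls A V e) = card (cls A V e')"
  using card_cls_le[OF assms] card_cls_le[OF assms(1,2,4,3)] by (rule antisym)

lemma card_cls_pos: "lattice V \<Longrightarrow> e \<in> words \<Longrightarrow> card (cls words V e) \<ge> 1"
  using cls_refl[of V e words] by (auto simp: Suc_le_eq card_gt_0_iff)

lemma card_common_cls_le:
  assumes V: "lattice V" and e: "e \<in> words"
  shows "card {e1 \<in> words. e' \<in> cls A V e1} \<le> card (cls words V e)"
proof (cases "{e1 \<in> words. e' \<in> cls A V e1} = {}")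
  case True
  then show ?thesis by (simp only: card.empty)
next
  case False
  then obtain e1 where e1: "e1 \<in> words" "e' \<in> cls A V e1" by blast
  have "{e2 \<in> words. e' \<in> cls A V e2} \<subseteq> cls words V e1"
  proof clarify
    fix e2 assume e2: "e2 \<in> words" "e' \<in> cls A V e2"
    show "e2 \<in> cls words V e1" by (rule cls_trans[OF V e1(2) cls_sym[OF V e2(2,1)]])
  qed
  then have "card {e2 \<in> words. e' \<in> cls A V e2} \<le> card (cls words V e1)"
    by (intro card_mono) auto
  then show ?thesis
    using card_cls_eq[OF position_invariant_words finite_words e1(1) e] by simp
qed

text \<open>Double counting of congruent pairs of a word and a solution: the words congruent to one
  given solution all lie in a single class of \<open>words\<close>.\<close>

lemma card_cls_solutions:
  assumes V: "lattice V" and e: "e \<in> words"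
  shows "card words * card (cls solutions V e) \<le> card solutions * card (cls words V e)"
proof -
  have "card words * card (cls solutions V e) = (\<Sum>e1\<in>words. card (cls solutions V e))" by simp
  also have "\<dots> = (\<Sum>e1\<in>words. card (cls solutions V e1))"
    by (intro sum.cong refl card_cls_eq[OF position_invariant_solutions finite_solutions e])
  also have "\<dots> = card (SIGMA e1:words. cls solutions V e1)" by simp
  also have "\<dots> = card ((\<lambda>(x, y). (y, x)) ` (SIGMA e1:words. cls solutions V e1))"
    by (rule card_image[symmetric]) (auto simp: inj_on_def)
  also have "\<dots> \<le> card (SIGMA e':solutions. {e1 \<in> words. e' \<in> cls solutions V e1})"
    by (intro card_mono) (auto simp: cls_def)
  also have "\<dots> = (\<Sum>e'\<in>solutions. card {e1 \<in> words. e' \<in> cls solutions V e1})" by simp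
  also have "\<dots> \<le> (\<Sum>e'\<in>solutions. card (cls words V e))"
    by (intro sum_mono card_common_cls_le[OF V e])
  finally show ?thesis by simp
qed

text \<open>Two-step paths from \<open>e\<close> with steps in \<open>V\<close> and \<open>W\<close>
  end in the class of the sum. Midpoints of paths with the same ends are congruent modulo both
  lattices. So the logarithm of the class size is supermodular, opposite to that of
  \<open>density\<close>.\<close>

lemma card_cls_exchange:
  assumes V: "lattice V" and W: "lattice W" and e: "e \<in> words"
  shows "card (cls words V e) * card (cls words W e)
    \<le> card (cls words (lattice_sum V W) e) * card (cls words (V \<inter> W) e)"
proof -
  let ?S = "lattice_sum V W"
  have S: "lattice ?S" by (rule lattice_lattice_sum[OF V W])
  let ?X = "SIGMA e1:cls words V e. cls words W e1"
  have "card ?X = (\<Sum>e1\<in>cls words V e. card (cls words W e1))" by simp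
  also have "\<dots> = (\<Sum>e1\<in>cls words V e. card (cls words W e))"
    by (intro sum.cong refl card_cls_eq[OF position_invariant_words finite_words _ e]) (auto simp: cls_def)
  finally have X: "card (cls words V e) * card (cls words W e) = card ?X" by simp
  have fibre: "card {e1. (e1, e2) \<in> ?X} \<le> card (cls words (V \<inter> W) e)" for e2
  proof (cases "{e1. (e1, e2) \<in> ?X} = {}")
    case True
    then show ?thesis by (simp only: card.empty)
  next
    case False
    then obtain e1 where e1: "e1 \<in> cls words V e" "e2 \<in> cls words W e1" by blast
    have e1': "e1 \<in> words" using e1 by (simp add: cls_def)
    have "{e3. (e3, e2) \<in> ?X} \<subseteq> cls words (V \<inter> W) e1"
    proof clarify
      fix e3 assume e3: "e3 \<in> cls words V e" "e2 \<in> cls words W e3"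
      have e3': "e3 \<in> words" using e3 by (simp add: cls_def)
      have "e3 \<in> cls words V e1" by (rule cls_trans[OF V cls_sym[OF V e1(1) e] e3(1)])
      moreover have "e3 \<in> cls words W e1" by (rule cls_trans[OF W e1(2) cls_sym[OF W e3(2) e3']])
      ultimately show "e3 \<in> cls words (V \<inter> W) e1" by (auto simp: cls_def)
    qed
    then have "card {e3. (e3, e2) \<in> ?X} \<le> card (cls words (V \<inter> W) e1)" by (intro card_mono) auto
    then show ?thesis using card_cls_eq[OF position_invariant_words finite_words e1' e] by simp
  qed
  have "card ?X = card ((\<lambda>(x, y). (y, x)) ` ?X)"
    by (rule card_image[symmetric]) (auto simp: inj_on_def)
  also have "\<dots> \<le> card (SIGMA e2:cls words ?S e. {e1. (e1, e2) \<in> ?X})"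
  proof (intro card_mono)
    have "finite {e1. (e1, e2) \<in> ?X}" for e2
      by (rule finite_subset[of _ words]) (auto simp: cls_def)
    then show "finite (SIGMA e2:cls words ?S e. {e1. (e1, e2) \<in> ?X})" by (intro finite_SigmaI) auto
    show "(\<lambda>(x, y). (y, x)) ` ?X \<subseteq> (SIGMA e2:cls words ?S e. {e1. (e1, e2) \<in> ?X})"
    proof clarify
      fix e1 e2 assume e1: "e1 \<in> cls words V e" and e2: "e2 \<in> cls words W e1"
      have "e1 \<in> cls words ?S e" using e1 lattice_sum_upper[OF W, of V] by (auto simp: cls_def)
      moreover have "W \<subseteq> ?S" by (rule lattice_sum_upper2[OF V])
      then have "e2 \<in> cls words ?S e1" using e2 by (auto simp: cls_def)
      ultimately have "e2 \<in> cls words ?S e" by (rule cls_trans[OF S])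
      then show "e2 \<in> cls words ?S e \<and> e1 \<in> {e1. (e1, e2) \<in> ?X}" using e1 e2 by simp
    qed
  qed
  also have "\<dots> = (\<Sum>e2\<in>cls words ?S e. card {e1. (e1, e2) \<in> ?X})"
    by (rule card_SigmaI) (auto intro: finite_subset[of _ words] simp: cls_def)
  also have "\<dots> \<le> (\<Sum>e2\<in>cls words ?S e. card (cls words (V \<inter> W) e))"
    by (intro sum_mono fibre)
  finally show ?thesis using X by simp
qed

text \<open>The symmetry of the type enters here: permuting the components of each letter maps
  \<open>words\<close> into itself and carries \<open>V\<close> to its permuted copy.\<close>

lemma card_cls_permute_le:
  assumes \<sigma>: "\<sigma> permutes {..<k}" and e: "e \<in> words"
  shows "card (cls words V e) \<le> card (cls words (lattice_permute \<sigma> V) e)"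
proof -
  define F where "F x = restrict (\<lambda>p. x p \<circ> \<sigma>) I" for x :: "'i \<Rightarrow> nat \<Rightarrow> nat"
  have inv: "x \<circ> \<sigma> \<circ> inv_into UNIV \<sigma> = x" "x \<circ> inv_into UNIV \<sigma> \<circ> \<sigma> = x" for x :: "nat \<Rightarrow> nat"
    using permutes_inv_o[OF \<sigma>] by (simp_all add: o_assoc[symmetric])
  have F_words: "F x \<in> words" if x: "x \<in> words" for x
  proof -
    have "card {p \<in> I. F x p = a} = c a" for a
    proof -
      have "{p \<in> I. F x p = a} = {p \<in> I. x p = a \<circ> inv_into UNIV \<sigma>}"
        using inv by (auto simp: F_def)
      then show ?thesis
        using x c_symmetric[OF permutes_inv[OF \<sigma>], of a] by (simp add: words_def)
    qed
    moreover have "F x \<in> PiE I (\<lambda>_. T)"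
      using x compositions_permute[OF \<sigma>] by (auto simp: words_def F_def)
    ultimately show ?thesis by (simp add: words_def)
  qed
  have "card (cls words V e) \<le> card (cls words (lattice_permute \<sigma> V) (F e))"
  proof (rule card_inj_on_le)
    show "inj_on F (cls words V e)"
    proof (rule inj_onI)
      fix x y assume xy: "x \<in> cls words V e" "y \<in> cls words V e" and eq: "F x = F y"
      have "x \<in> extensional I" "y \<in> extensional I" using xy by (auto simp: cls_def words_def PiE_def)
      then show "x = y"
      proof (rule extensionalityI)
        fix p assume "p \<in> I"
        then have "x p \<circ> \<sigma> = y p \<circ> \<sigma>" using fun_cong[OF eq, of p] by (simp add: F_def)
        then show "x p = y p" using inv by metis
      qed
    qed
    show "F ` cls words V e \<subseteq> cls words (lattice_permute \<sigma> V) (F e)"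
    proof (rule image_subsetI)
      fix x assume x: "x \<in> cls words V e"
      have "word_diff (F e) (F x) p \<in> lattice_permute \<sigma> V" if p: "p \<in> I" for p
      proof -
        have "word_diff (F e) (F x) p = word_diff e x p \<circ> \<sigma>"
          using p by (auto simp: word_diff_def F_def)
        then show ?thesis using x p by (auto simp: cls_def lattice_permute_def)
      qed
      then show "F x \<in> cls words (lattice_permute \<sigma> V) (F e)" using x F_words by (simp add: cls_def)
    qed
  qed simp
  then show ?thesis
    using card_cls_eq[OF position_invariant_words finite_words F_words[OF e] e] by simp
qed

text \<open>A nonzero difference in \<open>V\<close> has two different coordinates a, b other than
  \<open>i\<close>. Subtracting its transposed copy leaves a unit times the vector with entries 1 at
  a and -1 at b. Its images under the allowed swaps generate \<open>balanced i\<close>.\<close>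

lemma cls_nontrivial_imp_balanced:
  assumes V: "lattice V" "V \<subseteq> balanced i" and i: "i < k" and e: "e \<in> words"
    and swap: "\<And>a b. a < k \<Longrightarrow> b < k \<Longrightarrow> a \<noteq> i \<Longrightarrow> b \<noteq> i \<Longrightarrow> lattice_permute (Transposition.transpose a b) V \<subseteq> V"
    and nontriv: "card (cls words V e) > 1"
  shows "V = balanced i"
proof -
  have "cls words V e \<noteq> {e}" using nontriv by (intro notI) simp
  then obtain e' where e': "e' \<in> cls words V e" "e' \<noteq> e"
    using cls_refl[OF V(1) e] by blast
  have sol: "e \<in> solutions" "e' \<in> solutions"
    using e e' words_subset_solutions by (auto simp: cls_def)
  have "e \<in> extensional I" "e' \<in> extensional I"
    using e e' by (auto simp: cls_def words_def PiE_def)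
  then obtain p where p: "p \<in> I" "e p \<noteq> e' p" using e'(2) extensionalityI by metis
  define d where "d = word_diff e e' p"
  have d: "d \<in> V" using e' p by (simp add: d_def cls_def)
  have d_small: "\<bar>d j\<bar> \<le> int N" for j using word_diff_bound[OF sol p(1)] by (simp add: d_def)
  have d_supp: "d j = 0" if "j \<ge> k" for j using word_diff_supp[OF sol p(1) that] by (simp add: d_def)
  have di: "d i = 0" using d V(2) d_small[of i] by (intro small_dvd_imp_zero) (auto simp: balanced_def)
  \<comment> \<open>If all coordinates other than \<open>i\<close> agreed, the zero sum and
    \<open>d i = 0\<close> would make all of them 0.\<close>
  have "\<exists>a b. a < k \<and> b < k \<and> a \<noteq> i \<and> b \<noteq> i \<and> d a \<noteq> d b"
  proof (rule ccontr)
    assume contra: "\<not> ?thesis"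
    obtain j where "e p j \<noteq> e' p j" using p(2) by blast
    then have j: "d j \<noteq> 0" by (simp add: d_def word_diff_def)
    have jk: "j < k" "j \<noteq> i" using j di d_supp by (auto intro: leI)
    have "(\<Sum>a<k. d a) = (\<Sum>a\<in>{..<k} - {i}. d a)"
      using i di by (subst sum.remove[of _ i]) auto
    also have "\<dots> = (\<Sum>a\<in>{..<k} - {i}. d j)"
      using contra jk by (intro sum.cong) auto
    finally have "int (k - 1) * d j = 0"
      using sum_word_diff[OF sol p(1)] i by (simp add: d_def)
    then show False using j k_ge_3 by simp
  qed
  then obtain a b where ab: "a < k" "b < k" "a \<noteq> i" "b \<noteq> i" "d a \<noteq> d b" by blast
  define E where "E a b j = (if j = a then 1 else 0) - (if j = b then 1 else 0 :: int)" for a b j :: nat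
  have E_supp: "E a b j = 0" if "a < k" "b < k" "j \<ge> k" for a b j using that by (auto simp: E_def)
  have "d \<circ> Transposition.transpose a b \<in> V"
    using swap[OF ab(1-4)] d by (auto simp only: lattice_permute_def)
  then have "(\<lambda>j. d j - (d \<circ> Transposition.transpose a b) j) \<in> V"
    by (rule lattice_diff[OF V(1) d])
  moreover have "(\<lambda>j. d j - (d \<circ> Transposition.transpose a b) j) = (\<lambda>j. (d a - d b) * E a b j)"
    using ab by (auto simp: E_def fun_eq_iff Transposition.transpose_def)
  ultimately have mem: "(\<lambda>j. (d a - d b) * E a b j) \<in> V" by simp
  have "\<bar>d a - d b\<bar> \<le> 2 * int N" using d_small[of a] d_small[of b] by linarith
  then have "coprime (d a - d b) (int q)" using ab(5) by (intro small_coprime) auto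
  then obtain u v where u: "u * (d a - d b) + v * int q = 1"
    using bezout_int[of "d a - d b" "int q"] by auto
  have Eab: "E a b \<in> V"
  proof (rule lattice_cong[OF V(1) lattice_scale[OF V(1) mem, of u]])
    fix j
    have "E a b j - u * ((d a - d b) * E a b j) = (1 - u * (d a - d b)) * E a b j"
      by (simp add: algebra_simps)
    also have "1 - u * (d a - d b) = v * int q" using u by simp
    finally show "int q dvd E a b j - u * ((d a - d b) * E a b j)" by simp
  qed (use E_supp ab in auto)
  have E_swap: "E x' y' \<in> V" if "E x y \<in> V" "c' < k" "c' \<noteq> i" "d' < k" "d' \<noteq> i"
    "\<And>j. E x' y' j = E x y (Transposition.transpose c' d' j)" for x y x' y' c' d'
  proof -
    have "E x' y' = E x y \<circ> Transposition.transpose c' d'" using that(6) by auto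
    then show ?thesis using swap[of c' d'] that(1-5) by (auto simp only: lattice_permute_def)
  qed
  have Ejb: "E j b \<in> V" if j: "j < k" "j \<noteq> i" "j \<noteq> b" for j
    by (rule E_swap[OF Eab, of a j]) (use ab j in \<open>auto simp: E_def Transposition.transpose_def\<close>)
  have "balanced i \<subseteq> V"
  proof
    fix w assume w: "w \<in> balanced i"
    let ?J = "{..<k} - {i, b}"
    \<comment> \<open>This combination matches \<open>w\<close> on \<open>?J\<close>; at
      \<open>b\<close> and \<open>i\<close> it agrees modulo \<open>q\<close> by the two conditions
      defining \<open>balanced i\<close>.\<close>
    have "(\<lambda>l. \<Sum>j\<in>?J. w j * E j b l) \<in> V"
      using Ejb by (intro lattice_sum_mem[OF V(1)] lattice_scale[OF V(1)]) auto
    then show "w \<in> V"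
    proof (rule lattice_cong[OF V(1)])
      fix l
      have Jsum: "(\<Sum>j\<in>?J. w j * E j b l) = (if l \<in> ?J then w l else 0) - (if l = b then \<Sum>j\<in>?J. w j else 0)"
      proof -
        have "(\<Sum>j\<in>?J. w j * E j b l) = (\<Sum>j\<in>?J. (if j = l then w j else 0) - (if l = b then w j else 0))"
          by (intro sum.cong) (auto simp: E_def)
        then show ?thesis by (auto simp: sum_subtractf)
      qed
      have split: "(\<Sum>j<k. w j) = w i + w b + (\<Sum>j\<in>?J. w j)"
        using ab i by (subst sum.subset_diff[of "{i, b}"]) auto
      have wi: "int q dvd w i" and ws: "int q dvd (\<Sum>j<k. w j)" using w by (auto simp: balanced_def)
      have wb: "int q dvd w b + (\<Sum>j\<in>?J. w j)"
        using dvd_diff[OF ws wi] by (simp add: split)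
      consider "l = b" | "l \<noteq> b" "l = i" | "l \<noteq> b" "l \<in> ?J" | "l \<noteq> b" "l \<ge> k" by fastforce
      then have "int q dvd w l - ((if l \<in> ?J then w l else 0) - (if l = b then \<Sum>j\<in>?J. w j else 0))"
      proof cases
        case 1
        then show ?thesis using wb by simp
      next
        case 4
        then have "w l = 0" "l \<notin> ?J" using w by (auto simp: balanced_def)
        then show ?thesis using 4 by simp
      qed (use wi in simp_all)
      then show "int q dvd w l - (\<Sum>j\<in>?J. w j * E j b l)" by (simp only: Jsum)
    qed (use w in \<open>auto simp: balanced_def\<close>)
  qed
  then show ?thesis using V(2) by blast
qed

text \<open>The function \<open>ln s - h ln z\<close>, with \<open>s\<close> the class size and \<open>z\<close> the density, is supermodular
  on the lattices inside \<open>balanced i\<close>. Hence its largest maximiser is unique, therefore invariant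
  under the permutations of the components other than \<open>i\<close>, and such lattices are trivial.\<close>

lemma ln_card_cls_le:
  assumes e: "e \<in> words" and i: "i < k" and h: "h \<ge> 0"
    and full: "ln (card (cls words (balanced i) e)) \<le> h * ln (density (balanced i))"
    and V: "lattice V" "V \<subseteq> balanced i"
  shows "ln (card (cls words V e)) \<le> h * ln (density V)"
proof -
  define \<delta> where "\<delta> V = ln (card (cls words V e)) - h * ln (density V)" for V
  define L where "L = {V. lattice V \<and> V \<subseteq> balanced i}"
  have L: "finite L" "V \<in> L" using V finite_lattices by (auto simp: L_def intro: finite_subset)
  define M where "M = {V \<in> L. \<forall>W\<in>L. \<delta> W \<le> \<delta> V}"
  have "M \<noteq> {}"
  proof -
    have "Max (\<delta> ` L) \<in> \<delta> ` L" using L by (intro Max_in) auto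
    then obtain V0 where "V0 \<in> L" "\<delta> V0 = Max (\<delta> ` L)" by auto
    then have "V0 \<in> M" using L by (auto simp: M_def)
    then show ?thesis by blast
  qed
  moreover have "finite M" using L by (simp add: M_def)
  ultimately have "Max (density ` M) \<in> density ` M" by (intro Max_in) auto
  then obtain V0 where "V0 \<in> M" "Max (density ` M) = density V0" by auto
  then have V0: "V0 \<in> M" "\<And>W. W \<in> M \<Longrightarrow> density W \<le> density V0"
    using Max_ge[of "density ` M"] \<open>finite M\<close> by force+
  have V0_lat: "lattice V0" "V0 \<subseteq> balanced i" using V0(1) by (auto simp: M_def L_def)
  have swap: "lattice_permute (Transposition.transpose a b) V0 \<subseteq> V0"
    if ab: "a < k" "b < k" "a \<noteq> i" "b \<noteq> i" for a b
  proof -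
    let ?\<sigma> = "Transposition.transpose a b"
    have \<sigma>: "?\<sigma> permutes {..<k}" using ab by (intro permutes_swap_id) auto
    define W where "W = lattice_permute ?\<sigma> V0"
    have W: "lattice W" unfolding W_def by (rule lattice_lattice_permute[OF \<sigma> V0_lat(1)])
    have W_sub: "W \<subseteq> balanced i"
    proof -
      have "x \<circ> ?\<sigma> \<in> balanced i" if "x \<in> balanced i" for x
        using that sum.permute[OF \<sigma>, of x] permutes_not_in[OF \<sigma>] ab
        by (auto simp: balanced_def o_def)
      then show ?thesis using V0_lat(2) by (auto simp: W_def lattice_permute_def)
    qed
    have "\<delta> V0 \<le> \<delta> W"
      using card_cls_permute_le[OF \<sigma> e, of V0] card_cls_pos[OF V0_lat(1) e]
        density_lattice_permute[OF \<sigma> V0_lat(1)]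
      by (simp add: \<delta>_def W_def)
    let ?S = "lattice_sum V0 W" and ?D = "V0 \<inter> W"
    have S: "lattice ?S" "?S \<subseteq> balanced i" and D: "lattice ?D"
      using lattice_lattice_sum[OF V0_lat(1) W] lattice_sum_least[OF lattice_balanced V0_lat(2) W_sub]
        lattice_Int[OF V0_lat(1) W] by auto
    \<comment> \<open>Class sizes are log-supermodular and densities log-submodular; with
      \<open>h \<ge> 0\<close> both effects have the same sign.\<close>
    have "\<delta> V0 + \<delta> W \<le> \<delta> ?S + \<delta> ?D"
    proof -
      have pos: "real (card (cls words X e)) > 0" "real (density X) > 0" if "lattice X" for X
        using card_cls_pos[OF that e] density_pos[OF that] by auto
      have "ln (real (card (cls words V0 e)) * card (cls words W e))
          \<le> ln (real (card (cls words ?S e)) * card (cls words ?D e))"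
        using card_cls_exchange[OF V0_lat(1) W e] pos V0_lat W S D
        by (subst ln_le_cancel_iff) (auto simp flip: of_nat_mult)
      moreover have "ln (real (density ?S) * density ?D) \<le> ln (real (density V0) * density W)"
        using density_exchange[OF V0_lat(1) W] pos V0_lat W S D
        by (subst ln_le_cancel_iff) (auto simp flip: of_nat_mult)
      ultimately show ?thesis
        using pos V0_lat W S D h mult_left_mono[of "ln (density ?S) + ln (density ?D)" "ln (density V0) + ln (density W)" h]
        by (simp add: \<delta>_def ln_mult_pos algebra_simps)
    qed
    moreover have "\<delta> ?D \<le> \<delta> V0" using V0(1) D V0_lat by (auto simp: M_def L_def)
    ultimately have "\<delta> V0 \<le> \<delta> ?S" using \<open>\<delta> V0 \<le> \<delta> W\<close> by linarith
    then have "?S \<in> M" using V0(1) S by (fastforce simp: M_def L_def)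
    then have "density ?S \<le> density V0" by (rule V0(2))
    moreover have "V0 \<inter> box \<subseteq> ?S \<inter> box" using lattice_sum_upper[OF W, of V0] by blast
    ultimately have "V0 \<inter> box = ?S \<inter> box"
      unfolding density_def by (intro card_seteq) auto
    then have "V0 = ?S" by (rule lattice_eqI[OF V0_lat(1) S(1)])
    moreover have "W \<subseteq> ?S" by (rule lattice_sum_upper2[OF V0_lat(1)])
    ultimately show ?thesis by (simp add: W_def)
  qed
  have "\<delta> V0 \<le> 0"
  proof (cases "card (cls words V0 e) > 1")
    case True
    then have "V0 = balanced i" using cls_nontrivial_imp_balanced[OF V0_lat i e swap] by blast
    then show ?thesis using full by (simp add: \<delta>_def)
  next
    case False
    then have "card (cls words V0 e) = 1" using card_cls_pos[OF V0_lat(1) e] by simp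
    then show ?thesis using h density_pos[OF V0_lat(1)] by (simp add: \<delta>_def)
  qed
  moreover have "\<delta> V \<le> \<delta> V0" using V0(1) L by (simp add: M_def)
  ultimately show ?thesis by (simp add: \<delta>_def)
qed

end

section \<open>Conflicts: solutions sharing a component with a word\<close>

context word_class
begin

definition diff_set :: "('i \<Rightarrow> nat \<Rightarrow> nat) \<Rightarrow> ('i \<Rightarrow> nat \<Rightarrow> nat) \<Rightarrow> (nat \<Rightarrow> int) set" where
  "diff_set e e' = word_diff e e' ` I"

definition share :: "('i \<Rightarrow> nat \<Rightarrow> nat) \<Rightarrow> ('i \<Rightarrow> nat \<Rightarrow> nat) \<Rightarrow> nat \<Rightarrow> bool" where
  "share e e' i \<longleftrightarrow> (\<forall>p\<in>I. e' p i = e p i)"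

definition conflicts :: "('i \<Rightarrow> nat \<Rightarrow> nat) \<Rightarrow> ('i \<Rightarrow> nat \<Rightarrow> nat) set" where
  "conflicts e = {e' \<in> solutions. e' \<noteq> e \<and> (\<exists>i<k. share e e' i)}"

lemma finite_conflicts [simp]: "finite (conflicts e)"
  by (simp add: conflicts_def)

lemma diff_set_span:
  assumes "e \<in> solutions" "e' \<in> solutions" "p \<in> I"
  shows "word_diff e e' p \<in> lattice_span (diff_set e e')"
  using assms word_diff_supp by (intro lattice_span_base) (auto simp: diff_set_def)

lemma cls_balanced:
  assumes e: "e \<in> solutions" and A: "A \<subseteq> solutions"
  shows "cls A (balanced i) e = {e' \<in> A. share e e' i}"
proof -
  have "(\<forall>p\<in>I. word_diff e e' p \<in> balanced i) \<longleftrightarrow> share e e' i" if e': "e' \<in> solutions" for e'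
  proof -
    have "word_diff e e' p \<in> balanced i \<longleftrightarrow> e' p i = e p i" if p: "p \<in> I" for p
    proof -
      have "word_diff e e' p \<in> balanced i \<longleftrightarrow> int q dvd word_diff e e' p i"
        using sum_word_diff[OF e e' p] word_diff_supp[OF e e' p] by (simp add: balanced_def)
      also have "\<dots> \<longleftrightarrow> word_diff e e' p i = 0"
        using word_diff_bound[OF e e' p, of i] small_dvd_imp_zero[of "word_diff e e' p i"] by auto
      finally show ?thesis by (simp add: word_diff_def)
    qed
    then show ?thesis by (simp add: share_def)
  qed
  then show ?thesis using A by (auto simp: cls_def)
qed

text \<open>Partners are grouped by a shared component and by their set of differences, which leaves
  at most k * 2^((card T)^2) groups. If the differences of a group span a lattice of density z, then
  z is at least q, and the group has at most R * z^h members of weight 1/z. As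
  \<open>h \<le> 1\<close>, its total is at most R * q^(h-1). The exponent satisfies q^(h(k-2)) =
  deg, so \<open>share\<close> is the hypothesis of \<open>ln_card_cls_le\<close> at
  \<open>balanced i\<close>.\<close>

lemma conflict_sum:
  assumes e: "e \<in> words" and deg: "deg \<ge> 1"
    and share: "\<And>i. i < k \<Longrightarrow> real (card {e' \<in> words. share e e' i}) \<le> deg"
    and h: "h = ln deg / (real (k - 2) * ln (real q))" "h \<le> 1"
  shows "(\<Sum>e'\<in>conflicts e. 1 / real (density (lattice_span (diff_set e e'))))
    \<le> real k * 2 ^ (card T ^ 2) * (real (card solutions) / real (card words)) * real q powr (h - 1)"
proof -
  define \<Delta> where "\<Delta> = (\<lambda>(a, a') i. int (a' i) - int (a i)) ` (T \<times> T)"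
  have \<Delta>: "finite \<Delta>" "card \<Delta> \<le> card T ^ 2"
    using card_image_le[of "T \<times> T" "\<lambda>(a, a') i. int (a' i) - int (a i)"]
    by (auto simp: \<Delta>_def card_cartesian_product power2_eq_square)
  define C where "C = (\<lambda>(i, D). {e' \<in> solutions. e' \<noteq> e \<and> share e e' i \<and> diff_set e e' = D})"
  define f where "f e' = 1 / real (density (lattice_span (diff_set e e')))" for e'
  define R where "R = real (card solutions) / real (card words)"
  have e_sol: "e \<in> solutions" using e words_subset_solutions by blast
  have h_nonneg: "h \<ge> 0" using deg q_ge_2 by (simp add: h)
  have inner: "(\<Sum>e'\<in>C (i, D). f e') \<le> R * real q powr (h - 1)" if i: "i < k" for i D
  proof (cases "C (i, D) = {}")
    case True
    then show ?thesis by (simp only: sum.empty) (simp add: R_def)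
  next
    case False
    then obtain e' where e': "e' \<in> solutions" "e' \<noteq> e" "share e e' i" "diff_set e e' = D"
      by (auto simp: C_def)
    let ?V = "lattice_span D"
    have V: "lattice ?V" by (rule lattice_lattice_span)
    have "D \<subseteq> balanced i"
      using cls_balanced[OF e_sol subset_refl, of i] e' by (auto simp: cls_def diff_set_def)
    then have V_sub: "?V \<subseteq> balanced i"
      using e'(4) by (intro lattice_span_least lattice_balanced) (auto simp: diff_set_def)
    have "e \<in> extensional I" "e' \<in> extensional I"
      using e_sol e' by (auto simp: solutions_def PiE_def)
    then obtain p where p: "p \<in> I" "e p \<noteq> e' p" using e'(2) extensionalityI by metis
    then obtain j where j: "e p j \<noteq> e' p j" by blast
    have "\<bar>word_diff e e' p j\<bar> \<le> 2 * int N" using word_diff_bound[OF e_sol e'(1) p(1), of j] by linarith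
    then have "coprime (word_diff e e' p j) (int q)"
      using j by (intro small_coprime) (auto simp: word_diff_def)
    then have z: "density ?V \<ge> q"
      using density_ge_modulus[OF V] diff_set_span[OF e_sol e'(1) p(1)] e'(4) by blast
    have "ln (real (card (cls words (balanced i) e))) \<le> ln deg"
      using share[OF i] card_cls_pos[OF lattice_balanced e, of i] deg
        cls_balanced[OF e_sol words_subset_solutions]
      by (subst ln_le_cancel_iff) auto
    also have "ln deg = h * ln (real (q ^ (k - 2)))"
      using k_ge_3 q_ge_2 by (simp add: h ln_realpow)
    also have "\<dots> \<le> h * ln (real (density (balanced i)))"
    proof (intro mult_left_mono h_nonneg)
      have le: "real (q ^ (k - 2)) \<le> real (density (balanced i))"
        by (simp only: of_nat_le_iff density_balanced[OF i k_ge_3])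
      moreover have pos: "0 < real (q ^ (k - 2))" using q_ge_2 by simp
      ultimately have "0 < real (density (balanced i))" by linarith
      with le pos show "ln (real (q ^ (k - 2))) \<le> ln (real (density (balanced i)))"
        by (subst ln_le_cancel_iff)
    qed
    finally have "ln (card (cls words ?V e)) \<le> h * ln (density ?V)"
      by (intro ln_card_cls_le[OF e i h_nonneg _ V V_sub])
    then have "ln (real (card (cls words ?V e))) \<le> ln (real (density ?V) powr h)"
      using z q_ge_2 by (simp add: ln_powr)
    then have s: "real (card (cls words ?V e)) \<le> real (density ?V) powr h"
      using card_cls_pos[OF V e] z q_ge_2 by (subst (asm) ln_le_cancel_iff) auto
    have "card words > 0" using e by (auto simp: card_gt_0_iff)
    have "C (i, D) \<subseteq> cls solutions ?V e"
      using diff_set_span[OF e_sol] by (auto simp: C_def cls_def)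
    then have "real (card (C (i, D))) \<le> real (card (cls solutions ?V e))"
      by (intro of_nat_mono card_mono) auto
    also have "\<dots> \<le> R * real (card (cls words ?V e))"
      using card_cls_solutions[OF V e] \<open>card words > 0\<close>
      by (simp add: R_def field_simps flip: of_nat_mult)
    also have "\<dots> \<le> R * real (density ?V) powr h"
      using s by (intro mult_left_mono) (simp_all add: R_def)
    finally have C_le: "real (card (C (i, D))) \<le> R * real (density ?V) powr h" .
    have "(\<Sum>e'\<in>C (i, D). f e') = (\<Sum>e'\<in>C (i, D). 1 / real (density ?V))"
      by (intro sum.cong) (auto simp: C_def f_def)
    also have "\<dots> = real (card (C (i, D))) / real (density ?V)" by simp
    also have "\<dots> \<le> R * real (density ?V) powr h / real (density ?V)"
      by (intro divide_right_mono C_le) simp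
    also have "\<dots> = R * real (density ?V) powr (h - 1)"
      using z q_ge_2 by (simp add: powr_diff)
    also have "\<dots> \<le> R * real q powr (h - 1)"
      using z q_ge_2 h(2) by (intro mult_left_mono powr_mono2') (auto simp: R_def)
    finally show ?thesis .
  qed
  define \<iota> where "\<iota> e' = (SOME i. i < k \<and> share e e' i)" for e'
  have \<iota>: "\<iota> e' < k \<and> share e e' (\<iota> e')" if "e' \<in> conflicts e" for e'
  proof -
    have "\<exists>i. i < k \<and> share e e' i" using that by (auto simp: conflicts_def)
    then show ?thesis unfolding \<iota>_def by (rule someI_ex)
  qed
  let ?X = "{..<k} \<times> Pow \<Delta>"
  define g where "g e' = ((\<iota> e', diff_set e e'), e')" for e'
  have g: "g ` conflicts e \<subseteq> Sigma ?X C"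
  proof (rule image_subsetI)
    fix e' assume e': "e' \<in> conflicts e"
    have "diff_set e e' \<subseteq> \<Delta>"
    proof
      fix d assume "d \<in> diff_set e e'"
      then obtain p where p: "p \<in> I" "d = word_diff e e' p" by (auto simp: diff_set_def)
      have "(e p, e' p) \<in> T \<times> T" using solutions_mem e_sol e' p by (auto simp: conflicts_def)
      then show "d \<in> \<Delta>" unfolding \<Delta>_def by (rule rev_image_eqI) (auto simp: p word_diff_def)
    qed
    then show "g e' \<in> Sigma ?X C" using \<iota>[OF e'] e' by (auto simp: g_def C_def conflicts_def)
  qed
  have fin: "finite ?X" "\<And>x. finite (C x)" using \<Delta> by (auto simp: C_def)
  have "(\<Sum>e'\<in>conflicts e. f e') = (\<Sum>z\<in>g ` conflicts e. f (snd z))"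
    by (subst sum.reindex) (auto simp: inj_on_def g_def)
  also have "\<dots> \<le> (\<Sum>z\<in>Sigma ?X C. f (snd z))"
    using g by (intro sum_mono2 finite_SigmaI fin) (auto simp: f_def)
  also have "\<dots> = (\<Sum>x\<in>?X. \<Sum>e'\<in>C x. f e')"
    by (subst sum.Sigma) (simp_all add: case_prod_unfold fin \<Delta>)
  also have "\<dots> \<le> (\<Sum>x\<in>?X. R * real q powr (h - 1))"
    using inner by (intro sum_mono) auto
  also have "\<dots> = real (k * 2 ^ card \<Delta>) * (R * real q powr (h - 1))"
    using \<Delta> by (simp add: card_cartesian_product card_Pow)
  also have "\<dots> \<le> real (k * 2 ^ (card T ^ 2)) * (R * real q powr (h - 1))"
    using \<Delta> by (intro mult_right_mono of_nat_mono mult_le_mono power_increasing) (auto simp: R_def)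
  finally show ?thesis by (simp add: f_def R_def mult_ac)
qed

end

section \<open>Hashing\<close>

text \<open>\<open>S_bound\<close> keeps sums of \<open>k - 1\<close> elements of \<open>S\<close>
  below \<open>q\<close>, so a congruence between such sums is an equality of integers, to which
  \<open>S_avg\<close> applies.\<close>

locale hashing = word_class k q N I c
  for k q N :: nat and I :: "'i set" and c :: "(nat \<Rightarrow> nat) \<Rightarrow> nat" +
  fixes S :: "nat set"
  assumes S_bound: "\<And>s. s \<in> S \<Longrightarrow> k * s < q"
    and S_avg: "\<And>s. (\<And>j. j < k \<Longrightarrow> s j \<in> S) \<Longrightarrow> (\<Sum>j<k - 1. s j) = (k - 1) * s (k - 1) \<Longrightarrow>
      (\<And>j. j < k \<Longrightarrow> s j = s (k - 1))"
begin

definition dot :: "('i \<Rightarrow> int) \<Rightarrow> ('i \<Rightarrow> nat) \<Rightarrow> int" where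
  "dot u x = (\<Sum>p\<in>I. u p * int (x p))"

text \<open>The hash values of the components of a solution sum to zero after the last one is weighted
  with \<open>-(k - 1)\<close>, so that all of them lie in \<open>S\<close> only if they are equal.\<close>

definition hashed :: "('i \<Rightarrow> int) \<Rightarrow> (nat \<Rightarrow> int) \<Rightarrow> nat \<Rightarrow> ('i \<Rightarrow> nat) \<Rightarrow> nat \<Rightarrow> bool" where
  "hashed u b j x s \<longleftrightarrow> (if j = k - 1
     then int q dvd int (k - 1) * int s - (int N * (\<Sum>p\<in>I. u p) - dot u x + (\<Sum>j<k - 1. b j))
     else int q dvd dot u x + b j - int s)"

definition alive :: "('i \<Rightarrow> int) \<Rightarrow> (nat \<Rightarrow> int) \<Rightarrow> ('i \<Rightarrow> nat \<Rightarrow> nat) \<Rightarrow> bool" where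
  "alive u b e \<longleftrightarrow> (\<forall>j<k. \<exists>s\<in>S. hashed u b j (\<lambda>p. e p j) s)"

text \<open>Only \<open>k - 1\<close> offsets are random; the last hash value uses their
  sum.\<close>

definition \<Omega> :: "(('i \<Rightarrow> int) \<times> (nat \<Rightarrow> int)) set" where
  "\<Omega> = PiE I (\<lambda>_. {0..<int q}) \<times> PiE {..<k - 1} (\<lambda>_. {0..<int q})"

lemma S_less:
  assumes "s \<in> S"
  shows "s < q"
proof -
  have "1 * s \<le> k * s" using k_ge_3 by (intro mult_right_mono) auto
  then show ?thesis using S_bound[OF assms] by linarith
qed

lemma S_less2:
  assumes "s \<in> S"
  shows "(k - 1) * s < q"
proof -
  have "(k - 1) * s \<le> k * s" by (intro mult_right_mono) auto
  then show ?thesis using S_bound[OF assms] by linarith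
qed

lemma finite_S [simp]: "finite S"
  by (rule finite_subset[of _ "{..<q}"]) (use S_less in auto)

lemma finite_\<Omega> [simp]: "finite \<Omega>"
  unfolding \<Omega>_def by (intro finite_cartesian_product finite_PiE) auto

lemma card_\<Omega>: "card \<Omega> = q ^ card I * q ^ (k - 1)"
  by (simp add: \<Omega>_def card_cartesian_product card_PiE)

lemma small_eqI: "int q dvd int x - int y \<Longrightarrow> x < q \<Longrightarrow> y < q \<Longrightarrow> x = y"
  by (metis mod_eq_dvd_iff mod_less of_nat_eq_iff of_nat_mod)

lemma sum_dot:
  assumes "e \<in> solutions"
  shows "(\<Sum>j<k. dot u (\<lambda>p. e p j)) = int N * (\<Sum>p\<in>I. u p)"
proof -
  have "(\<Sum>j<k. dot u (\<lambda>p. e p j)) = (\<Sum>p\<in>I. u p * int (\<Sum>j<k. e p j))"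
    unfolding dot_def by (subst sum.swap) (simp add: sum_distrib_left)
  also have "\<dots> = (\<Sum>p\<in>I. int N * u p)"
  proof (intro sum.cong refl)
    fix p assume "p \<in> I"
    then have "(\<Sum>j<k. e p j) = N" using solutions_mem[OF assms] by (simp add: compositions_def)
    then show "u p * int (\<Sum>j<k. e p j) = int N * u p" by simp
  qed
  finally show ?thesis by (simp add: sum_distrib_left)
qed

lemma sum_dot_split:
  assumes "e \<in> solutions"
  shows "int N * (\<Sum>p\<in>I. u p) = (\<Sum>j<k - 1. dot u (\<lambda>p. e p j)) + dot u (\<lambda>p. e p (k - 1))"
proof -
  have "{..<k} = insert (k - 1) {..<k - 1}" using k_ge_3 by auto
  then have "(\<Sum>j<k. dot u (\<lambda>p. e p j)) = dot u (\<lambda>p. e p (k - 1)) + (\<Sum>j<k - 1. dot u (\<lambda>p. e p j))"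
    by simp
  then show ?thesis using sum_dot[OF assms, of u] by simp
qed

text \<open>Adding the congruences of all components cancels the products with \<open>u\<close>,
  since the components add up to the constant word \<open>N\<close>. What remains is that the last
  value is the average of the others modulo \<open>q\<close>.\<close>

lemma alive_common:
  assumes e: "e \<in> solutions" and alive: "alive u b e"
  obtains s where "s \<in> S" "\<And>j. j < k \<Longrightarrow> hashed u b j (\<lambda>p. e p j) s"
proof -
  have "\<forall>j\<in>{..<k}. \<exists>s. s \<in> S \<and> hashed u b j (\<lambda>p. e p j) s" using alive by (auto simp: alive_def)
  from bchoice[OF this] obtain s where s: "\<And>j. j < k \<Longrightarrow> s j \<in> S \<and> hashed u b j (\<lambda>p. e p j) (s j)"
    by auto
  have "int q dvd (\<Sum>j<k - 1. dot u (\<lambda>p. e p j) + b j - int (s j))"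
    using s by (intro dvd_sum) (force simp: hashed_def)
  moreover have "int q dvd int (k - 1) * int (s (k - 1))
      - (int N * (\<Sum>p\<in>I. u p) - dot u (\<lambda>p. e p (k - 1)) + (\<Sum>j<k - 1. b j))"
    using s[of "k - 1"] k_ge_3 by (simp add: hashed_def)
  ultimately have "int q dvd (\<Sum>j<k - 1. dot u (\<lambda>p. e p j) + b j - int (s j))
     + (int (k - 1) * int (s (k - 1))
      - (int N * (\<Sum>p\<in>I. u p) - dot u (\<lambda>p. e p (k - 1)) + (\<Sum>j<k - 1. b j)))"
    by (rule dvd_add)
  also have "\<dots> = int ((k - 1) * s (k - 1)) - int (\<Sum>j<k - 1. s j)"
    by (simp add: sum_dot_split[OF e] sum.distrib sum_subtractf)
  finally have "int q dvd int ((k - 1) * s (k - 1)) - int (\<Sum>j<k - 1. s j)" .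
  moreover have "(k - 1) * s (k - 1) < q" using s[of "k - 1"] k_ge_3 by (intro S_less2) auto
  moreover have "(\<Sum>j<k - 1. s j) < q"
  proof -
    have "k * (\<Sum>j<k - 1. s j) = (\<Sum>j<k - 1. k * s j)" by (rule sum_distrib_left)
    also have "\<dots> \<le> (\<Sum>j<k - 1. q)"
      using s S_bound by (intro sum_mono less_imp_le) (auto simp: less_diff_conv)
    also have "\<dots> < k * q" using k_ge_3 q_ge_2 by simp
    finally show ?thesis by simp
  qed
  ultimately have "(k - 1) * s (k - 1) = (\<Sum>j<k - 1. s j)" by (rule small_eqI)
  then have "s j = s (k - 1)" if "j < k" for j
    using s that by (intro S_avg) auto
  then show ?thesis using s that[of "s (k - 1)"] k_ge_3 by (metis diff_less less_le_trans zero_less_numeral zero_less_one)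
qed

text \<open>The vector \<open>u\<close> and the common value \<open>s\<close> can be chosen freely;
  the offsets are then determined, and the last congruence follows from the others.\<close>

lemma card_alive:
  assumes e: "e \<in> solutions"
  shows "q ^ card I * card S \<le> card {(u, b) \<in> \<Omega>. alive u b e}"
proof -
  define F where "F = (\<lambda>(u, s). (u, restrict (\<lambda>j. (int s - dot u (\<lambda>p. e p j)) mod int q) {..<k - 1}))"
  let ?U = "PiE I (\<lambda>_. {0..<int q})"
  have "card (?U \<times> S) \<le> card {(u, b) \<in> \<Omega>. alive u b e}"
  proof (rule card_inj_on_le)
    show "inj_on F (?U \<times> S)"
    proof (rule inj_onI, clarify)
      fix u s u' s' assume s: "s \<in> S" "s' \<in> S" and eq: "F (u, s) = F (u', s')"
      then have u: "u = u'" by (simp add: F_def)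
      have "0 < k - 1" using k_ge_3 by simp
      then have "(int s - dot u (\<lambda>p. e p 0)) mod int q = (int s' - dot u (\<lambda>p. e p 0)) mod int q"
        using eq u by (auto simp: F_def dest!: fun_cong[of _ _ 0])
      then have "int q dvd int s - int s'" by (simp add: mod_eq_dvd_iff)
      then show "u = u' \<and> s = s'" using u s S_less by (auto intro: small_eqI)
    qed
    show "F ` (?U \<times> S) \<subseteq> {(u, b) \<in> \<Omega>. alive u b e}"
    proof (rule image_subsetI)
      fix us assume us: "us \<in> ?U \<times> S"
      then obtain u s where us_eq: "us = (u, s)" and u: "u \<in> ?U" and s: "s \<in> S" by blast
      define b where "b = restrict (\<lambda>j. (int s - dot u (\<lambda>p. e p j)) mod int q) {..<k - 1}"
      have b: "int q dvd b j - (int s - dot u (\<lambda>p. e p j))" if "j < k - 1" for j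
        using that by (simp add: b_def mod_eq_dvd_iff[symmetric])
      have "(u, b) \<in> \<Omega>" using u q_ge_2 by (auto simp: \<Omega>_def b_def)
      moreover have "hashed u b j (\<lambda>p. e p j) s" if "j < k" for j
      proof (cases "j = k - 1")
        case True
        have "int q dvd (\<Sum>j<k - 1. b j - (int s - dot u (\<lambda>p. e p j)))" using b by (intro dvd_sum) auto
        also have "\<dots> = - (int (k - 1) * int s
            - (int N * (\<Sum>p\<in>I. u p) - dot u (\<lambda>p. e p (k - 1)) + (\<Sum>j<k - 1. b j)))"
          by (simp add: sum_dot_split[OF e] sum.distrib sum_subtractf)
        finally show ?thesis by (simp only: hashed_def True if_True dvd_minus_iff simp_thms)
      next
        case False
        then show ?thesis using b[of j] that by (simp add: hashed_def algebra_simps)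
      qed
      ultimately have "(u, b) \<in> {(u, b) \<in> \<Omega>. alive u b e}"
        using s by (auto simp: alive_def)
      moreover have "F us = (u, b)" by (simp add: F_def us_eq b_def)
      ultimately show "F us \<in> {(u, b) \<in> \<Omega>. alive u b e}" by (simp only:)
    qed
  qed (rule finite_subset[OF _ finite_\<Omega>], auto)
  then show ?thesis by (simp add: card_cartesian_product card_PiE)
qed

definition annihilator :: "('i \<Rightarrow> nat \<Rightarrow> nat) \<Rightarrow> ('i \<Rightarrow> nat \<Rightarrow> nat) \<Rightarrow> ('i \<Rightarrow> int) set" where
  "annihilator e e' = {u \<in> PiE I (\<lambda>_. {0..<int q}). \<forall>j. int q dvd (\<Sum>p\<in>I. u p * word_diff e e' p j)}"

text \<open>Combining the differences with coefficients \<open>u\<close> is a homomorphism from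
  (Z/q)^I onto the span modulo \<open>q\<close>, with kernel \<open>annihilator\<close>. The bound
  is kernel times image, obtained by adding to \<open>u\<close> a chosen preimage
  \<open>w x\<close>.\<close>

lemma card_annihilator:
  assumes e: "e \<in> solutions" "e' \<in> solutions"
  shows "card (annihilator e e') * density (lattice_span (diff_set e e')) \<le> q ^ card I"
proof -
  let ?D = "diff_set e e'" and ?U = "PiE I (\<lambda>_. {0..<int q})"
  have "\<exists>w. \<forall>j. int q dvd x j - (\<Sum>p\<in>I. w p * word_diff e e' p j)" if x: "x \<in> lattice_span ?D" for x
  proof -
    obtain v where v: "\<And>j. int q dvd x j - (\<Sum>d\<in>?D. v d * d j)" using x by (auto simp: lattice_span_def)
    define r where "r = inv_into I (word_diff e e')"
    have r: "r d \<in> I" "word_diff e e' (r d) = d" if "d \<in> ?D" for d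
      using that inv_into_into[of d "word_diff e e'" I] f_inv_into_f[of d "word_diff e e'" I]
      by (auto simp: r_def diff_set_def)
    have inj: "inj_on r ?D" using r by (metis inj_onI)
    have "(\<Sum>p\<in>I. (if p \<in> r ` ?D then v (word_diff e e' p) else 0) * word_diff e e' p j)
        = (\<Sum>p\<in>r ` ?D. v (word_diff e e' p) * word_diff e e' p j)" for j
      using r by (intro sum.mono_neutral_cong_right) auto
    also have "\<dots> j = (\<Sum>d\<in>?D. v d * d j)" for j
      by (subst sum.reindex[OF inj]) (use r in auto)
    finally show ?thesis using v by (intro exI[of _ "\<lambda>p. if p \<in> r ` ?D then v (word_diff e e' p) else 0"]) simp
  qed
  then obtain w where w: "\<And>x j. x \<in> lattice_span ?D \<Longrightarrow> int q dvd x j - (\<Sum>p\<in>I. w x p * word_diff e e' p j)"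
    by metis
  define F where "F = (\<lambda>(u, x). restrict (\<lambda>p. (u p + w x p) mod int q) I)"
  have F: "int q dvd x j - (\<Sum>p\<in>I. F (u, x) p * word_diff e e' p j)"
    if u: "u \<in> annihilator e e'" and x: "x \<in> lattice_span ?D" for u x j
  proof -
    have "int q dvd (\<Sum>p\<in>I. (u p + w x p - F (u, x) p) * word_diff e e' p j)"
      by (intro dvd_sum dvd_mult2) (simp add: F_def mod_eq_dvd_iff[symmetric])
    moreover have "int q dvd (\<Sum>p\<in>I. u p * word_diff e e' p j)" using u by (simp add: annihilator_def)
    ultimately have "int q dvd (\<Sum>p\<in>I. (u p + w x p - F (u, x) p) * word_diff e e' p j)
        - (\<Sum>p\<in>I. u p * word_diff e e' p j) + (x j - (\<Sum>p\<in>I. w x p * word_diff e e' p j))"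
      using dvd_add[OF dvd_diff w[OF x, of j]] by blast
    then show ?thesis by (simp add: algebra_simps sum.distrib sum_subtractf)
  qed
  have "card (annihilator e e' \<times> (lattice_span ?D \<inter> box)) \<le> card ?U"
  proof (rule card_inj_on_le)
    show "inj_on F (annihilator e e' \<times> (lattice_span ?D \<inter> box))"
    proof (rule inj_onI, clarify)
      fix u x u' x' assume u: "u \<in> annihilator e e'" "u' \<in> annihilator e e'"
        and x: "x \<in> lattice_span ?D" "x \<in> box" "x' \<in> lattice_span ?D" "x' \<in> box"
        and eq: "F (u, x) = F (u', x')"
      have "int q dvd x j - x' j" for j
        using dvd_diff[OF F[OF u(1) x(1), of j] F[OF u(2) x(3), of j]] by (simp add: eq)
      then have xx: "x = x'" using x by (intro box_eqI)
      have u_mem: "u \<in> ?U" "u' \<in> ?U" using u by (auto simp: annihilator_def)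
      then have "u = u'"
      proof (rule PiE_ext)
        fix p assume p: "p \<in> I"
        have "(u p + w x p) mod int q = (u' p + w x p) mod int q"
          using fun_cong[OF eq, of p] p xx by (simp add: F_def)
        then have "u p mod int q = u' p mod int q" by (simp add: mod_eq_dvd_iff)
        moreover have "u p \<in> {0..<int q}" "u' p \<in> {0..<int q}" using u_mem p by auto
        ultimately show "u p = u' p" by simp
      qed
      with xx show "u = u' \<and> x = x'" by simp
    qed
    show "F ` (annihilator e e' \<times> (lattice_span ?D \<inter> box)) \<subseteq> ?U"
      using q_ge_2 by (auto simp: F_def)
  qed (intro finite_PiE, auto)
  then show ?thesis by (simp add: card_cartesian_product card_PiE density_def)
qed

text \<open>A shared component forces both solutions to have the same common value \<open>s\<close>.
  Then all their products with \<open>u\<close> agree modulo \<open>q\<close>, so \<open>u\<close>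
  annihilates every difference. Given \<open>u\<close> and \<open>s\<close>, the offsets are
  determined.\<close>

lemma card_alive_pair:
  assumes e: "e \<in> solutions" and e': "e' \<in> conflicts e"
  shows "card {(u, b) \<in> \<Omega>. alive u b e \<and> alive u b e'} * density (lattice_span (diff_set e e'))
    \<le> q ^ card I * card S"
proof -
  have e'_sol: "e' \<in> solutions" using e' by (simp add: conflicts_def)
  obtain i where i: "i < k" "share e e' i" using e' by (auto simp: conflicts_def)
  let ?A = "{(u, b) \<in> \<Omega>. alive u b e \<and> alive u b e'}"
  define \<sigma> where "\<sigma> = (\<lambda>(u, b). SOME s. s \<in> S \<and> (\<forall>j<k. hashed u b j (\<lambda>p. e p j) s))"
  have \<sigma>: "\<sigma> (u, b) \<in> S" "j < k \<Longrightarrow> hashed u b j (\<lambda>p. e p j) (\<sigma> (u, b))" if "(u, b) \<in> ?A" for u b j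
  proof -
    have "alive u b e" using that by simp
    then obtain s where "s \<in> S \<and> (\<forall>j<k. hashed u b j (\<lambda>p. e p j) s)"
      using alive_common[OF e] by metis
    then have "\<sigma> (u, b) \<in> S \<and> (\<forall>j<k. hashed u b j (\<lambda>p. e p j) (\<sigma> (u, b)))"
      unfolding \<sigma>_def prod.case by (rule someI)
    then show "\<sigma> (u, b) \<in> S" "j < k \<Longrightarrow> hashed u b j (\<lambda>p. e p j) (\<sigma> (u, b))" by auto
  qed
  have ann: "u \<in> annihilator e e'" if ub: "(u, b) \<in> ?A" for u b
  proof -
    have "alive u b e'" using ub by simp
    then obtain s' where s': "s' \<in> S" "\<And>j. j < k \<Longrightarrow> hashed u b j (\<lambda>p. e' p j) s'"
      using alive_common[OF e'_sol] by metis
    let ?s = "\<sigma> (u, b)"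
    have s: "?s \<in> S" "\<And>j. j < k \<Longrightarrow> hashed u b j (\<lambda>p. e p j) ?s" using \<sigma>[OF ub] by auto
    have dot_diff: "dot u (\<lambda>p. e' p j) - dot u (\<lambda>p. e p j) = (\<Sum>p\<in>I. u p * word_diff e e' p j)" for j
      by (simp add: dot_def word_diff_def algebra_simps sum_subtractf)
    have share_dot: "dot u (\<lambda>p. e' p i) = dot u (\<lambda>p. e p i)"
      using i(2) unfolding dot_def share_def by (intro sum.cong) auto
    \<comment> \<open>The values are compared at the shared component \<open>i\<close>; if it is the
      last one, only \<open>(k - 1) * s\<close> is visible, which is still below
      \<open>q\<close>.\<close>
    have "?s = s'"
    proof (cases "i = k - 1")
      case True
      have "int q dvd (int (k - 1) * int ?s - (int N * (\<Sum>p\<in>I. u p) - dot u (\<lambda>p. e p i) + (\<Sum>j<k - 1. b j)))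
          - (int (k - 1) * int s' - (int N * (\<Sum>p\<in>I. u p) - dot u (\<lambda>p. e' p i) + (\<Sum>j<k - 1. b j)))"
        by (rule dvd_diff) (use s(2)[OF i(1)] s'(2)[OF i(1)] True in \<open>simp_all add: hashed_def\<close>)
      then have "int q dvd int ((k - 1) * ?s) - int ((k - 1) * s')" using share_dot by simp
      then have "(k - 1) * ?s = (k - 1) * s'" using s(1) s'(1) by (intro small_eqI S_less2)
      then show ?thesis using k_ge_3 by simp
    next
      case False
      have "int q dvd (dot u (\<lambda>p. e' p i) + b i - int s') - (dot u (\<lambda>p. e p i) + b i - int ?s)"
        by (rule dvd_diff) (use s(2)[OF i(1)] s'(2)[OF i(1)] False in \<open>simp_all add: hashed_def\<close>)
      then have "int q dvd int ?s - int s'" using share_dot by simp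
      then show ?thesis using s(1) s'(1) S_less by (intro small_eqI)
    qed
    have "int q dvd (\<Sum>p\<in>I. u p * word_diff e e' p j)" for j
    proof (cases "j < k")
      case True
      show ?thesis
      proof (cases "j = k - 1")
        case True
        have "int q dvd (int (k - 1) * int s' - (int N * (\<Sum>p\<in>I. u p) - dot u (\<lambda>p. e' p j) + (\<Sum>j<k - 1. b j)))
            - (int (k - 1) * int ?s - (int N * (\<Sum>p\<in>I. u p) - dot u (\<lambda>p. e p j) + (\<Sum>j<k - 1. b j)))"
          by (rule dvd_diff) (use s(2)[OF \<open>j < k\<close>] s'(2)[OF \<open>j < k\<close>] True in \<open>simp_all add: hashed_def\<close>)
        then show ?thesis using \<open>?s = s'\<close> by (simp add: dot_diff[symmetric])
      next
        case False
        have "int q dvd (dot u (\<lambda>p. e' p j) + b j - int s') - (dot u (\<lambda>p. e p j) + b j - int ?s)"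
          by (rule dvd_diff) (use s(2)[OF \<open>j < k\<close>] s'(2)[OF \<open>j < k\<close>] False in \<open>simp_all add: hashed_def\<close>)
        then show ?thesis using \<open>?s = s'\<close> by (simp add: dot_diff[symmetric])
      qed
    next
      case False
      then show ?thesis using word_diff_supp[OF e e'_sol] by (simp add: sum.neutral)
    qed
    moreover have "u \<in> PiE I (\<lambda>_. {0..<int q})" using ub by (simp add: \<Omega>_def)
    ultimately show ?thesis by (simp add: annihilator_def)
  qed
  have "card ?A \<le> card (annihilator e e' \<times> S)"
  proof (rule card_inj_on_le)
    show "inj_on (\<lambda>(u, b). (u, \<sigma> (u, b))) ?A"
    proof (rule inj_onI)
      fix z z' assume z: "z \<in> ?A" "z' \<in> ?A"
        and eq: "(\<lambda>(u, b). (u, \<sigma> (u, b))) z = (\<lambda>(u, b). (u, \<sigma> (u, b))) z'"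
      obtain u b u' b' where zb: "z = (u, b)" "z' = (u', b')" by (cases z, cases z')
      have "u' = u" and s: "\<sigma> (u, b) = \<sigma> (u, b')" using eq by (auto simp: zb)
      have ub: "(u, b) \<in> ?A" and ub': "(u, b') \<in> ?A" using z unfolding zb \<open>u' = u\<close> by blast+
      have mem: "b \<in> PiE {..<k - 1} (\<lambda>_. {0..<int q})" "b' \<in> PiE {..<k - 1} (\<lambda>_. {0..<int q})"
        using ub ub' by (auto simp: \<Omega>_def)
      then have "b = b'"
      proof (rule PiE_ext)
        fix j assume j: "j \<in> {..<k - 1}"
        have "hashed u b j (\<lambda>p. e p j) (\<sigma> (u, b))" "hashed u b' j (\<lambda>p. e p j) (\<sigma> (u, b))"
          using \<sigma>(2)[OF ub, of j] \<sigma>(2)[OF ub', of j] s j by auto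
        then have "int q dvd (dot u (\<lambda>p. e p j) + b j - int (\<sigma> (u, b))) - (dot u (\<lambda>p. e p j) + b' j - int (\<sigma> (u, b)))"
          using j by - (rule dvd_diff, simp_all add: hashed_def)
        also have "\<dots> = b j - b' j" by simp
        finally have "b j mod int q = b' j mod int q" by (simp only: mod_eq_dvd_iff)
        moreover have "b j \<in> {0..<int q}" "b' j \<in> {0..<int q}"
          using PiE_mem[OF mem(1) j] PiE_mem[OF mem(2) j] by simp_all
        ultimately show "b j = b' j" by simp
      qed
      then show "z = z'" by (simp add: zb \<open>u' = u\<close>)
    qed
    show "(\<lambda>(u, b). (u, \<sigma> (u, b))) ` ?A \<subseteq> annihilator e e' \<times> S"
      using ann \<sigma>(1) by auto
    show "finite (annihilator e e' \<times> S)"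
      by (intro finite_cartesian_product finite_S)
        (auto simp: annihilator_def intro!: finite_subset[OF _ finite_PiE[OF finite_I, of "\<lambda>_. {0..<int q}"]])
  qed
  then have "card ?A * density (lattice_span (diff_set e e'))
      \<le> (card (annihilator e e') * density (lattice_span (diff_set e e'))) * card S"
    by (simp add: card_cartesian_product)
  also have "\<dots> \<le> q ^ card I * card S" using card_annihilator[OF e e'_sol] by simp
  finally show ?thesis .
qed

definition isolated :: "('i \<Rightarrow> int) \<Rightarrow> (nat \<Rightarrow> int) \<Rightarrow> ('i \<Rightarrow> nat \<Rightarrow> nat) set" where
  "isolated u b = {e \<in> words. alive u b e \<and> (\<forall>e'\<in>conflicts e. \<not> alive u b e')}"

text \<open>First moment method: each word is alive for at least \<open>Q\<close> elements of
  \<open>\<Omega>\<close>, conflicts spoil at most half of this amount, and averaging over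
  \<open>\<Omega>\<close> produces one good hash.\<close>

lemma many_isolated:
  assumes conf: "\<And>e. e \<in> words \<Longrightarrow>
    (\<Sum>e'\<in>conflicts e. 1 / real (density (lattice_span (diff_set e e')))) \<le> 1 / 2"
  obtains u b where "real (card words) * real (card S) \<le> 2 * real q ^ (k - 1) * real (card (isolated u b))"
proof -
  define Q where "Q = real q ^ card I * real (card S)"
  have per_word: "Q / 2 \<le> real (card {(u, b) \<in> \<Omega>. e \<in> isolated u b})" if e: "e \<in> words" for e
  proof -
    have e_sol: "e \<in> solutions" using e words_subset_solutions by blast
    let ?B = "\<Union>e'\<in>conflicts e. {(u, b) \<in> \<Omega>. alive u b e \<and> alive u b e'}"
    have fin: "finite {(u, b) \<in> \<Omega>. P u b}" for P by (rule finite_subset[OF _ finite_\<Omega>]) auto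
    have "{(u, b) \<in> \<Omega>. alive u b e} \<subseteq> {(u, b) \<in> \<Omega>. e \<in> isolated u b} \<union> ?B"
      using e by (auto simp: isolated_def)
    then have "card {(u, b) \<in> \<Omega>. alive u b e} \<le> card ({(u, b) \<in> \<Omega>. e \<in> isolated u b} \<union> ?B)"
      using fin by (intro card_mono) auto
    also have "\<dots> \<le> card {(u, b) \<in> \<Omega>. e \<in> isolated u b} + card ?B" by (rule card_Un_le)
    also have "card ?B \<le> (\<Sum>e'\<in>conflicts e. card {(u, b) \<in> \<Omega>. alive u b e \<and> alive u b e'})"
      by (rule card_UN_le) simp
    finally have le: "card {(u, b) \<in> \<Omega>. alive u b e} \<le> card {(u, b) \<in> \<Omega>. e \<in> isolated u b}
        + (\<Sum>e'\<in>conflicts e. card {(u, b) \<in> \<Omega>. alive u b e \<and> alive u b e'})" by simp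
    have "Q \<le> real (card {(u, b) \<in> \<Omega>. alive u b e})"
      using of_nat_mono[OF card_alive[OF e_sol], where 'a = real] by (simp add: Q_def)
    also have "\<dots> \<le> real (card {(u, b) \<in> \<Omega>. e \<in> isolated u b})
        + (\<Sum>e'\<in>conflicts e. real (card {(u, b) \<in> \<Omega>. alive u b e \<and> alive u b e'}))"
      using of_nat_mono[OF le, where 'a = real] by simp
    also have "(\<Sum>e'\<in>conflicts e. real (card {(u, b) \<in> \<Omega>. alive u b e \<and> alive u b e'}))
        \<le> (\<Sum>e'\<in>conflicts e. Q * (1 / real (density (lattice_span (diff_set e e')))))"
    proof (rule sum_mono)
      fix e' assume e': "e' \<in> conflicts e"
      have "real (density (lattice_span (diff_set e e'))) > 0"
        using density_pos[OF lattice_lattice_span] by (simp add: Suc_le_eq)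
      then show "real (card {(u, b) \<in> \<Omega>. alive u b e \<and> alive u b e'})
          \<le> Q * (1 / real (density (lattice_span (diff_set e e'))))"
        using of_nat_mono[OF card_alive_pair[OF e_sol e'], where 'a = real]
        by (simp add: Q_def field_simps)
    qed
    also have "\<dots> = Q * (\<Sum>e'\<in>conflicts e. 1 / real (density (lattice_span (diff_set e e'))))"
      by (rule sum_distrib_left[symmetric])
    also have "\<dots> \<le> Q * (1 / 2)" using conf[OF e] by (intro mult_left_mono) (auto simp: Q_def)
    finally show ?thesis by simp
  qed
  have "real (card words) * (Q / 2) \<le> (\<Sum>e\<in>words. real (card {(u, b) \<in> \<Omega>. e \<in> isolated u b}))"
    using sum_mono[of words "\<lambda>_. Q / 2", OF per_word] by simp
  also have "\<dots> = (\<Sum>e\<in>words. \<Sum>z\<in>\<Omega>. if e \<in> isolated (fst z) (snd z) then 1 else 0)"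
    by (intro sum.cong refl) (simp add: sum.If_cases Int_def case_prod_unfold)
  also have "\<dots> = (\<Sum>z\<in>\<Omega>. \<Sum>e\<in>words. if e \<in> isolated (fst z) (snd z) then 1 else 0)"
    by (rule sum.swap)
  also have "\<dots> = (\<Sum>z\<in>\<Omega>. real (card (isolated (fst z) (snd z))))"
  proof (intro sum.cong refl)
    fix z
    have "words \<inter> {e. e \<in> isolated (fst z) (snd z)} = isolated (fst z) (snd z)"
      by (auto simp: isolated_def)
    then show "(\<Sum>e\<in>words. if e \<in> isolated (fst z) (snd z) then 1 else 0) = real (card (isolated (fst z) (snd z)))"
      by (simp add: sum.If_cases)
  qed
  finally have total: "real (card words) * (Q / 2) \<le> (\<Sum>z\<in>\<Omega>. real (card (isolated (fst z) (snd z))))" .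
  have "\<exists>z\<in>\<Omega>. real (card words) * real (card S) \<le> 2 * real q ^ (k - 1) * real (card (isolated (fst z) (snd z)))"
  proof (rule ccontr)
    assume contra: "\<not> ?thesis"
    have "\<Omega> \<noteq> {}" using card_\<Omega> q_ge_2 by (metis card.empty mult_eq_0_iff not_numeral_le_zero power_not_zero)
    have pos: "2 * real q ^ (k - 1) > 0" using q_ge_2 by simp
    have "(\<Sum>z\<in>\<Omega>. 2 * real q ^ (k - 1) * real (card (isolated (fst z) (snd z))))
        < (\<Sum>z\<in>\<Omega>. real (card words) * real (card S))"
      using contra \<open>\<Omega> \<noteq> {}\<close> by (intro sum_strict_mono) (auto simp: not_le)
    also have "\<dots> = 2 * real q ^ (k - 1) * (real (card words) * (Q / 2))"
      by (simp add: card_\<Omega> Q_def)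
    also have "\<dots> \<le> 2 * real q ^ (k - 1) * (\<Sum>z\<in>\<Omega>. real (card (isolated (fst z) (snd z))))"
      using total pos by (intro mult_left_mono) auto
    also have "\<dots> = (\<Sum>z\<in>\<Omega>. 2 * real q ^ (k - 1) * real (card (isolated (fst z) (snd z))))"
      by (rule sum_distrib_left)
    finally show False by simp
  qed
  then obtain z where
    "real (card words) * real (card S) \<le> 2 * real q ^ (k - 1) * real (card (isolated (fst z) (snd z)))"
    by blast
  then show ?thesis by (rule that)
qed

end

section \<open>Cardinalities from Gibbs weights\<close>

context word_class
begin

lemma sum_over_positions:
  fixes g :: "nat \<Rightarrow> 'b :: comm_semiring_1"
  assumes e: "e \<in> solutions" and i: "i < k"
  shows "(\<Sum>p\<in>I. g (e p i)) = (\<Sum>v\<le>N. of_nat (\<Sum>a | a \<in> T \<and> a i = v. c a) * g v)"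
proof -
  have le: "e p i \<le> N" if "p \<in> I" for p using compositions_le solutions_mem[OF e that] by blast
  have "(\<Sum>p\<in>I. g (e p i)) = (\<Sum>v\<le>N. \<Sum>p | p \<in> I \<and> e p i = v. g (e p i))"
    by (rule sum.group[symmetric]) (use le in auto)
  also have "\<dots> = (\<Sum>v\<le>N. of_nat (card {p \<in> I. e p i = v}) * g v)"
    by (intro sum.cong refl) simp
  also have "\<dots> = (\<Sum>v\<le>N. of_nat (\<Sum>a | a \<in> T \<and> a i = v. c a) * g v)"
    using e i by (intro sum.cong refl) (simp add: solutions_def)
  finally show ?thesis .
qed

text \<open>A symmetric type gives all components the same digit counts, so each takes an equal
  share of the total. The fixed value serves twice: it excludes carries modulo \<open>m\<close>, and
  it fixes the probability of a component under the geometric law.\<close>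

lemma solution_digit_sum:
  assumes e: "e \<in> solutions" and i: "i < k"
  shows "k * (\<Sum>p\<in>I. e p i) = card I * N"
proof -
  have sym: "(\<Sum>a | a \<in> T \<and> a j = v. c a) = (\<Sum>a | a \<in> T \<and> a i = v. c a)" if "j < k" for j v
    using c_symmetric i that by (rule sum_part_swap)
  have "(\<Sum>p\<in>I. e p j) = (\<Sum>p\<in>I. e p i)" if "j < k" for j
    using sum_over_positions[OF e that, of "\<lambda>v. v"] sum_over_positions[OF e i, of "\<lambda>v. v"] sym[OF that]
    by simp
  then have "k * (\<Sum>p\<in>I. e p i) = (\<Sum>j<k. \<Sum>p\<in>I. e p j)" by simp
  also have "\<dots> = (\<Sum>p\<in>I. \<Sum>j<k. e p j)" by (rule sum.swap)
  also have "\<dots> = (\<Sum>p\<in>I. N)"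
    using solutions_mem[OF e] by (intro sum.cong refl) (simp add: compositions_def)
  finally show ?thesis by simp
qed

text \<open>The exponent is a sum over components and values of \<theta> times the number of
  occurrences, which \<open>solutions\<close> prescribes.\<close>

lemma weight_solutions:
  assumes "e \<in> solutions" "e' \<in> solutions"
  shows "(\<Prod>p\<in>I. gibbs k \<theta> (e p)) = (\<Prod>p\<in>I. gibbs k \<theta> (e' p))"
proof -
  have *: "(\<Prod>p\<in>I. gibbs k \<theta> (e p)) = exp (\<Sum>i<k. \<Sum>v\<le>N. of_nat (\<Sum>a | a \<in> T \<and> a i = v. c a) * \<theta> v)"
    if e: "e \<in> solutions" for e
  proof -
    have "(\<Prod>p\<in>I. gibbs k \<theta> (e p)) = exp (\<Sum>p\<in>I. \<Sum>i<k. \<theta> (e p i))"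
      by (simp add: gibbs_def exp_sum)
    also have "(\<Sum>p\<in>I. \<Sum>i<k. \<theta> (e p i)) = (\<Sum>i<k. \<Sum>p\<in>I. \<theta> (e p i))" by (rule sum.swap)
    also have "\<dots> = (\<Sum>i<k. \<Sum>v\<le>N. of_nat (\<Sum>a | a \<in> T \<and> a i = v. c a) * \<theta> v)"
      by (intro sum.cong refl sum_over_positions[OF e]) auto
    finally show ?thesis .
  qed
  show ?thesis using *[OF assms(1)] *[OF assms(2)] by simp
qed

lemma card_solutions_weight:
  assumes "e \<in> solutions"
  shows "real (card solutions) * (\<Prod>p\<in>I. gibbs k \<theta> (e p)) \<le> (\<Sum>a\<in>T. gibbs k \<theta> a) ^ card I"
proof -
  have "real (card solutions) * (\<Prod>p\<in>I. gibbs k \<theta> (e p)) = (\<Sum>e'\<in>solutions. \<Prod>p\<in>I. gibbs k \<theta> (e p))"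
    by simp
  also have "\<dots> = (\<Sum>e'\<in>solutions. \<Prod>p\<in>I. gibbs k \<theta> (e' p))"
    by (intro sum.cong refl weight_solutions[OF assms])
  also have "\<dots> \<le> (\<Sum>e'\<in>PiE I (\<lambda>_. T). \<Prod>p\<in>I. gibbs k \<theta> (e' p))"
    by (intro sum_mono2) (auto simp: solutions_def less_imp_le intro!: prod_nonneg)
  also have "\<dots> = (\<Sum>a\<in>T. gibbs k \<theta> a) ^ card I"
    by (subst prod_sum_PiE[symmetric]) auto
  finally show ?thesis .
qed

lemma card_words_weight:
  assumes "e \<in> words"
  shows "(\<Sum>e'\<in>words. \<Prod>p\<in>I. gibbs k \<theta> (e' p)) = real (card words) * (\<Prod>p\<in>I. gibbs k \<theta> (e p))"
proof -
  have "(\<Sum>e'\<in>words. \<Prod>p\<in>I. gibbs k \<theta> (e' p)) = (\<Sum>e'\<in>words. \<Prod>p\<in>I. gibbs k \<theta> (e p))"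
    using assms words_subset_solutions by (intro sum.cong refl weight_solutions) auto
  then show ?thesis by simp
qed

text \<open>Keeping only the condition on component \<open>i\<close> turns the sum of weights into a
  product of one-position marginals.\<close>

lemma card_share_weight:
  assumes e: "e \<in> words"
  shows "real (card {e' \<in> words. share e e' i}) * (\<Prod>p\<in>I. gibbs k \<theta> (e p))
    \<le> (\<Prod>p\<in>I. \<Sum>a | a \<in> T \<and> a i = e p i. gibbs k \<theta> a)"
proof -
  have "real (card {e' \<in> words. share e e' i}) * (\<Prod>p\<in>I. gibbs k \<theta> (e p))
      = (\<Sum>e' | e' \<in> words \<and> share e e' i. \<Prod>p\<in>I. gibbs k \<theta> (e p))" by simp
  also have "\<dots> = (\<Sum>e' | e' \<in> words \<and> share e e' i. \<Prod>p\<in>I. gibbs k \<theta> (e' p))"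
    using e words_subset_solutions by (intro sum.cong refl weight_solutions) auto
  also have "\<dots> \<le> (\<Sum>e'\<in>PiE I (\<lambda>p. {a \<in> T. a i = e p i}). \<Prod>p\<in>I. gibbs k \<theta> (e' p))"
  proof (intro sum_mono2)
    show "{e' \<in> words. share e e' i} \<subseteq> PiE I (\<lambda>p. {a \<in> T. a i = e p i})"
      by (auto simp: words_def share_def PiE_def Pi_def)
  qed (auto simp: less_imp_le intro!: prod_nonneg finite_PiE)
  also have "\<dots> = (\<Prod>p\<in>I. \<Sum>a | a \<in> T \<and> a i = e p i. gibbs k \<theta> a)"
    by (subst prod_sum_PiE[symmetric]) auto
  finally show ?thesis .
qed

end

section \<open>Relations between components of isolated words\<close>

context hashing
begin

text \<open>Each position sum is N modulo N+1, hence at least \<open>N\<close>, and the fixed digit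
  sums leave no room for more. So component \<open>j\<close> of \<open>f j\<close>, for all
  \<open>j\<close> together, forms a solution \<open>e\<close>. It inherits the hash values, so it
  is alive, and it shares a component with every \<open>f j\<close>; isolation forces
  \<open>e = f j\<close>.\<close>

lemma isolated_combine:
  assumes f: "\<And>j. j < k \<Longrightarrow> f j \<in> isolated u b"
    and cong: "\<And>p. p \<in> I \<Longrightarrow> (\<Sum>j<k. f j p j) mod Suc N = N"
    and j: "j < k"
  shows "f j = f 0"
proof -
  have f_words: "f j \<in> words" if "j < k" for j using f[OF that] by (simp add: isolated_def)
  have f_sol: "f j \<in> solutions" if "j < k" for j using f_words[OF that] words_subset_solutions by blast
  define e where "e = restrict (\<lambda>p j. if j < k then f j p j else 0) I"
  have ge: "N \<le> (\<Sum>j<k. f j p j)" if "p \<in> I" for p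
    using cong[OF that] by (metis mod_less_eq_dividend)
  have digits: "k * (\<Sum>p\<in>I. f j p j) = card I * N" if "j < k" for j
    by (rule solution_digit_sum[OF f_sol[OF that] that])
  have "k * (\<Sum>p\<in>I. \<Sum>j<k. f j p j) = (\<Sum>j<k. k * (\<Sum>p\<in>I. f j p j))"
    by (subst sum.swap) (simp add: sum_distrib_left)
  also have "\<dots> = k * (card I * N)" using digits by simp
  finally have total: "(\<Sum>p\<in>I. \<Sum>j<k. f j p j) = (\<Sum>p\<in>I. N)" using k_ge_3 by simp
  have eq: "(\<Sum>j<k. f j p j) = N" if p: "p \<in> I" for p
  proof (rule ccontr)
    assume "(\<Sum>j<k. f j p j) \<noteq> N"
    then have "N < (\<Sum>j<k. f j p j)" using ge[OF p] by simp
    then have "(\<Sum>p\<in>I. N) < (\<Sum>p\<in>I. \<Sum>j<k. f j p j)"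
      using p ge by (intro sum_strict_mono_ex1) auto
    then show False using total by simp
  qed
  have e_T: "e p \<in> T" if "p \<in> I" for p
    using eq[OF that] that by (simp add: e_def compositions_def)
  have "e \<in> solutions"
    unfolding solutions_def
  proof (intro CollectI conjI allI impI)
    show "e \<in> PiE I (\<lambda>_. T)" using e_T by (auto simp: e_def)
    fix i v assume i: "i < k"
    have "{p \<in> I. e p i = v} = {p \<in> I. f i p i = v}" using i by (auto simp: e_def)
    then show "card {p \<in> I. e p i = v} = (\<Sum>a | a \<in> T \<and> a i = v. c a)"
      using f_sol[OF i] i by (simp add: solutions_def)
  qed
  have share: "share (f j) e j" if "j < k" for j using that by (simp add: share_def e_def)
  have "alive u b e"
    unfolding alive_def
  proof (intro allI impI)
    fix j assume j: "j < k"
    have "dot u (\<lambda>p. e p j) = dot u (\<lambda>p. f j p j)"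
      unfolding dot_def using j by (intro sum.cong) (auto simp: e_def)
    then have "hashed u b j (\<lambda>p. e p j) s = hashed u b j (\<lambda>p. f j p j) s" for s
      by (simp only: hashed_def)
    moreover have "alive u b (f j)" using f[OF j] by (simp add: isolated_def)
    ultimately show "\<exists>s\<in>S. hashed u b j (\<lambda>p. e p j) s" using j by (simp add: alive_def)
  qed
  then have "e = f j" if "j < k" for j
    using f[OF that] share[OF that] that \<open>e \<in> solutions\<close> by (auto simp: isolated_def conflicts_def)
  then show ?thesis using j k_ge_3 by (metis less_le_trans zero_less_numeral)
qed

end

section \<open>Behrend sets\<close>

lemma digits_unique:
  fixes f g :: "nat \<Rightarrow> nat"
  assumes "(\<Sum>t<D. f t * B ^ t) = (\<Sum>t<D. g t * B ^ t)"
    and "\<And>t. t < D \<Longrightarrow> f t < B" "\<And>t. t < D \<Longrightarrow> g t < B" "t < D"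
  shows "f t = g t"
  using assms
proof (induction D arbitrary: f g t)
  case (Suc D)
  have split: "(\<Sum>t<Suc D. h t * B ^ t) = h 0 + B * (\<Sum>t<D. h (Suc t) * B ^ t)" for h :: "nat \<Rightarrow> nat"
    by (subst sum.lessThan_Suc_shift) (simp add: sum_distrib_left mult_ac)
  have eq: "f 0 + B * (\<Sum>t<D. f (Suc t) * B ^ t) = g 0 + B * (\<Sum>t<D. g (Suc t) * B ^ t)"
    using Suc.prems(1) by (simp only: split)
  have lt: "f 0 < B" "g 0 < B" using Suc.prems(2)[of 0] Suc.prems(3)[of 0] by auto
  have 0: "f 0 = g 0" using arg_cong[OF eq, of "\<lambda>x. x mod B"] lt by simp
  then have "(\<Sum>t<D. f (Suc t) * B ^ t) = (\<Sum>t<D. g (Suc t) * B ^ t)" using eq lt by simp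
  then have "f (Suc s) = g (Suc s)" if "s < D" for s
    using Suc.prems(2,3) that by (intro Suc.IH[of "\<lambda>t. f (Suc t)" "\<lambda>t. g (Suc t)"]) auto
  with 0 show ?case using Suc.prems(4) by (cases t) auto
qed simp

lemma digits_less:
  fixes f :: "nat \<Rightarrow> nat"
  assumes "\<And>t. t < D \<Longrightarrow> f t < B"
  shows "(\<Sum>t<D. f t * B ^ t) < B ^ D \<or> D = 0"
  using assms
proof (induction D)
  case (Suc D)
  have "(\<Sum>t<D. f t * B ^ t) < B ^ D \<or> D = 0" using Suc by simp
  then have "(\<Sum>t<D. f t * B ^ t) < B ^ D" by auto
  then have "(\<Sum>t<Suc D. f t * B ^ t) < B ^ D + f D * B ^ D" by simp
  also have "\<dots> = Suc (f D) * B ^ D" by simp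
  also have "\<dots> \<le> B * B ^ D" using Suc.prems[of D] by (intro mult_right_mono) auto
  finally show ?case by simp
qed simp

text \<open>Behrend's construction: integers whose base-\<open>kd\<close> digits form a vector on a sphere. No carries occur
  when \<open>k - 1\<close> of them are added, and a point of a sphere is an average of points
  of that sphere only if these coincide.\<close>

lemma behrend_set:
  fixes k d D :: nat
  assumes k: "k \<ge> 2" and d: "d \<ge> 1" and D: "D \<ge> 1"
  obtains S where "S \<subseteq> {..<(k * d) ^ D}" "d ^ D \<le> card S * (D * d ^ 2)"
    "\<And>s. (\<And>j. j < k \<Longrightarrow> s j \<in> S) \<Longrightarrow> (\<Sum>j<k - 1. s j) = (k - 1) * s (k - 1) \<Longrightarrow>
      (\<And>j. j < k \<Longrightarrow> s j = s (k - 1))"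
proof -
  let ?B = "k * d"
  define X where "X = PiE {..<D} (\<lambda>_. {..<d})"
  define norm2 where "norm2 x = (\<Sum>t<D. (x t)\<^sup>2)" for x :: "nat \<Rightarrow> nat"
  define val where "val x = (\<Sum>t<D. x t * ?B ^ t)" for x :: "nat \<Rightarrow> nat"
  have X: "finite X" "card X = d ^ D" by (auto simp: X_def card_PiE intro: finite_PiE)
  have Xd: "x t < d" if "x \<in> X" "t < D" for x t using that by (auto simp: X_def PiE_def Pi_def)
  have norm2_less: "norm2 x < D * d ^ 2" if "x \<in> X" for x
  proof -
    have "norm2 x < (\<Sum>t<D. d ^ 2)" unfolding norm2_def
      using D Xd[OF that] by (intro sum_strict_mono power_strict_mono) (auto simp: lessThan_empty_iff)
    then show ?thesis by simp
  qed
  \<comment> \<open>Pigeonhole over the possible squared norms.\<close>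
  have "\<exists>R<D * d ^ 2. d ^ D \<le> card {x \<in> X. norm2 x = R} * (D * d ^ 2)"
  proof (rule ccontr)
    assume contra: "\<not> ?thesis"
    have "X = (\<Union>R<D * d ^ 2. {x \<in> X. norm2 x = R})" using norm2_less by auto
    then have "card X = card (\<Union>R<D * d ^ 2. {x \<in> X. norm2 x = R})" by simp
    also have "\<dots> = (\<Sum>R<D * d ^ 2. card {x \<in> X. norm2 x = R})"
      using X(1) by (intro card_UN_disjoint) auto
    finally have "d ^ D * (D * d ^ 2) = (\<Sum>R<D * d ^ 2. card {x \<in> X. norm2 x = R} * (D * d ^ 2))"
      using X(2) by (simp only: sum_distrib_right)
    also have "\<dots> < (\<Sum>R<D * d ^ 2. d ^ D)"
      using contra D d by (intro sum_strict_mono) (auto simp: not_le lessThan_empty_iff)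
    finally show False by (simp add: mult.commute)
  qed
  then obtain R where R: "d ^ D \<le> card {x \<in> X. norm2 x = R} * (D * d ^ 2)" by blast
  let ?Y = "{x \<in> X. norm2 x = R}"
  have Bd: "x t < ?B" if "x \<in> X" "t < D" for x t
    using Xd[OF that] k by (metis One_nat_def Suc_1 Suc_le_lessD less_le_trans mult.left_neutral mult_le_mono1 order_less_imp_le)
  have inj: "inj_on val ?Y"
  proof (rule inj_onI)
    fix x y assume xy: "x \<in> ?Y" "y \<in> ?Y" "val x = val y"
    have "x \<in> PiE {..<D} (\<lambda>_. {..<d})" "y \<in> PiE {..<D} (\<lambda>_. {..<d})" using xy by (auto simp: X_def)
    then show "x = y"
    proof (rule PiE_ext)
      fix t assume "t \<in> {..<D}"
      then show "x t = y t"
        using xy Bd by (intro digits_unique[where D = D and f = x and g = y and B = ?B]) (auto simp: val_def)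
    qed
  qed
  have avg: "\<forall>j<k. s j = s (k - 1)"
    if s: "\<And>j. j < k \<Longrightarrow> s j \<in> val ` ?Y" and eq: "(\<Sum>j<k - 1. s j) = (k - 1) * s (k - 1)" for s
  proof -
    have "\<forall>j\<in>{..<k}. \<exists>x. x \<in> ?Y \<and> s j = val x" using s by fast
    from bchoice[OF this] obtain x where x: "\<And>j. j < k \<Longrightarrow> x j \<in> ?Y \<and> s j = val (x j)"
      by fast
    define y where "y = x (k - 1)"
    have y: "y \<in> X" "norm2 y = R" "s (k - 1) = val y" using x[of "k - 1"] k by (auto simp: y_def)
    \<comment> \<open>Sums of \<open>k - 1\<close> digits below \<open>d\<close> stay below the base
      \<open>k * d\<close>, so the equation of integers holds digit by digit.\<close>
    have digit: "(\<Sum>j<k - 1. x j t) = (k - 1) * y t" if t: "t < D" for t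
    proof (rule digits_unique[OF _ _ _ t, where f = "\<lambda>t. \<Sum>j<k - 1. x j t" and g = "\<lambda>t. (k - 1) * y t" and B = ?B])
      have "(\<Sum>t<D. (\<Sum>j<k - 1. x j t) * ?B ^ t) = (\<Sum>j<k - 1. val (x j))"
        unfolding val_def sum_distrib_right by (rule sum.swap)
      also have "\<dots> = (\<Sum>j<k - 1. s j)" using x by (intro sum.cong) auto
      also have "\<dots> = (\<Sum>t<D. (k - 1) * y t * ?B ^ t)"
        unfolding eq y(3) val_def by (simp add: sum_distrib_left mult_ac)
      finally show "(\<Sum>t<D. (\<Sum>j<k - 1. x j t) * ?B ^ t) = (\<Sum>t<D. (k - 1) * y t * ?B ^ t)" .
    next
      fix t assume t: "t < D"
      have "(\<Sum>j<k - 1. x j t) \<le> (\<Sum>j<k - 1. d)"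
        using x Xd[OF _ t] by (intro sum_mono less_imp_le) (auto simp: less_diff_conv)
      also have "\<dots> < ?B" using k d by simp
      finally show "(\<Sum>j<k - 1. x j t) < ?B" .
      have "(k - 1) * y t \<le> (k - 1) * d" using Xd[OF y(1) t] by simp
      also have "\<dots> < ?B" using k d by simp
      finally show "(k - 1) * y t < ?B" .
    qed
    have nrm: "(\<Sum>t<D. (int (z t))\<^sup>2) = int R" if "norm2 z = R" for z
      using that by (simp add: norm2_def flip: of_nat_power of_nat_sum)
    \<comment> \<open>The total squared distance of the points from their average \<open>y\<close>
      is 0, because all of them and \<open>y\<close> have the same norm.\<close>
    have "(\<Sum>j<k - 1. \<Sum>t<D. (int (x j t) - int (y t))\<^sup>2)
        = (\<Sum>j<k - 1. (\<Sum>t<D. (int (x j t))\<^sup>2) + (\<Sum>t<D. (int (y t))\<^sup>2) - 2 * (\<Sum>t<D. int (y t) * int (x j t)))"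
      by (simp add: power2_diff sum.distrib sum_subtractf sum_distrib_left mult_ac)
    also have "\<dots> = (\<Sum>j<k - 1. int R + int R - 2 * (\<Sum>t<D. int (y t) * int (x j t)))"
      using x y nrm by (intro sum.cong) auto
    also have "\<dots> = 2 * int (k - 1) * int R - 2 * (\<Sum>j<k - 1. \<Sum>t<D. int (y t) * int (x j t))"
      by (simp add: sum_subtractf sum_distrib_left)
    also have "(\<Sum>j<k - 1. \<Sum>t<D. int (y t) * int (x j t)) = (\<Sum>t<D. int (y t) * int (\<Sum>j<k - 1. x j t))"
      by (subst sum.swap) (simp add: sum_distrib_left)
    also have "\<dots> = (\<Sum>t<D. int (k - 1) * (int (y t))\<^sup>2)"
      by (intro sum.cong refl) (simp only: digit lessThan_iff of_nat_mult power2_eq_square mult_ac)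
    also have "\<dots> = int (k - 1) * int R" by (simp add: nrm[OF y(2)] flip: sum_distrib_left)
    finally have zero: "(\<Sum>j<k - 1. \<Sum>t<D. (int (x j t) - int (y t))\<^sup>2) = 0" by simp
    have "val (x j) = val y" if "j < k - 1" for j
    proof -
      have "(\<Sum>t<D. (int (x j t) - int (y t))\<^sup>2) = 0"
        using sum_nonneg_0[OF _ _ zero, of j] that by (simp add: sum_nonneg)
      then have "(int (x j t) - int (y t))\<^sup>2 = 0" if "t < D" for t
        using sum_nonneg_0[of "{..<D}" "\<lambda>t. (int (x j t) - int (y t))\<^sup>2" t] that by simp
      then show ?thesis unfolding val_def by (intro sum.cong) auto
    qed
    then have "s j = s (k - 1)" if "j < k" for j
      using x[OF that] y(3) that by (cases "j = k - 1") auto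
    then show ?thesis by blast
  qed
  show ?thesis
  proof (rule that[of "val ` ?Y"])
    show "val ` ?Y \<subseteq> {..<?B ^ D}"
    proof (rule image_subsetI)
      fix x assume "x \<in> ?Y"
      then show "val x \<in> {..<?B ^ D}" using digits_less[where D = D and f = x and B = ?B] Bd D by (auto simp: val_def)
    qed
    show "d ^ D \<le> card (val ` ?Y) * (D * d ^ 2)" using R by (simp add: card_image[OF inj])
  qed (use avg in blast)
qed

section \<open>Bounds\<close>

lemma of_nat_le_exp: "real n \<le> exp (real n)"
  using exp_ge_add_one_self[of "real n"] by linarith

lemma le_exp_mult:
  fixes c x :: real
  assumes "c \<ge> 0" "x \<ge> 1"
  shows "c \<le> exp (c * x)"
proof -
  have "c * 1 \<le> c * x" using assms by (intro mult_left_mono)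
  then show ?thesis using exp_ge_add_one_self[of "c * x"] by linarith
qed

lemma root_power:
  fixes Q :: real
  assumes "Q > 0" "D \<ge> 1"
  shows "(Q powr (1 / real D)) ^ D = Q"
proof -
  have "(Q powr (1 / real D)) ^ D = (Q powr (1 / real D)) powr real D" using assms by (simp add: powr_realpow)
  also have "\<dots> = Q powr 1" using assms by (simp add: powr_powr)
  finally show ?thesis using assms by simp
qed

text \<open>Polynomial losses fit into exp(O(sqrt n)) through n + 1 \<le> (1 + sqrt n)^2.\<close>

lemma Suc_power_le_exp_sqrt: "real (n + 1) ^ j \<le> exp (2 * real j * sqrt (real n))"
proof -
  have "real (n + 1) \<le> (1 + sqrt (real n)) ^ 2" by (simp add: power2_sum)
  also have "\<dots> \<le> exp (sqrt (real n)) ^ 2" by (intro power_mono exp_ge_add_one_self) simp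
  also have "\<dots> = exp (2 * sqrt (real n))" by (simp add: exp_double)
  finally have "real (n + 1) ^ j \<le> exp (2 * sqrt (real n)) ^ j" by (intro power_mono) auto
  then show ?thesis by (simp add: exp_of_nat_mult[symmetric] mult_ac)
qed

lemma factor_ge_1:
  fixes P :: real
  assumes "k \<ge> 1" "P \<ge> 1"
  shows "2 * real k * 2 ^ j * P \<ge> 1"
proof -
  have "1 \<le> (2 :: real) ^ j" "1 \<le> 2 * real k" using assms by simp_all
  then have "1 * 1 * 1 \<le> 2 * real k * 2 ^ j * P" using assms by (intro mult_mono) auto
  then show ?thesis by simp
qed

lemma power_le_exp: "real b ^ D \<le> exp (real b * real D)"
proof -
  have "real b ^ D \<le> exp (real b) ^ D" by (intro power_mono of_nat_le_exp) auto
  then show ?thesis by (simp add: exp_of_nat_mult[symmetric] mult.commute)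
qed

text \<open>Here \<open>W\<close>, \<open>s\<close>, \<open>L\<close> stand for the numbers of
  words, of Behrend elements and of survivors. Up to exp(O(sqrt n)), q^(k-1) / s equals
  \<open>deg\<close>. This dictates the dimension D of order sqrt n: factors such as k^D cost
  exp(O(D)), while the sphere loss D * d^2 with d about Q^(1/D) and ln Q = O(n) costs
  exp(O(n/D)).\<close>

lemma loss_bound:
  fixes k t \<kappa> M :: nat and E :: real
  assumes k: "k \<ge> 3" and t: "t \<ge> 1" and \<kappa>: "\<kappa> \<ge> 1" and M: "M \<ge> 1" and E: "E \<ge> 0"
  obtains C where "C \<ge> 0"
    "\<And>n D d q :: nat. \<And>P A deg Q W s L :: real.
      n \<ge> 1 \<Longrightarrow> P = real (n + 1) ^ (t * \<kappa>) \<Longrightarrow> A = 2 * real k * 2 ^ (t ^ 2) * P \<Longrightarrow>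
      1 \<le> deg \<Longrightarrow> deg \<le> P * real t ^ (\<kappa> * n) * exp (E * sqrt (real n)) \<Longrightarrow>
      Q = A * deg powr (1 / real (k - 2)) \<Longrightarrow> D = nat \<lceil>sqrt (real n)\<rceil> \<Longrightarrow> d = nat \<lceil>Q powr (1 / real D)\<rceil> \<Longrightarrow>
      q = 1 + M * k * (k * d) ^ D \<Longrightarrow> real d ^ D \<le> s * (real D * real d ^ 2) \<Longrightarrow> W \<ge> 0 \<Longrightarrow>
      W * s \<le> 2 * real q ^ (k - 1) * L \<Longrightarrow>
      W / deg * exp (- C * sqrt (real n)) \<le> L"
proof -
  \<comment> \<open>With x = sqrt n, the constants are made for \<open>A \<le> exp (a * x)\<close>
    and \<open>Q \<le> exp (c1 * x ^ 2)\<close>; \<open>C\<close> adds the exponents of all factors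
    of \<open>X\<close> below.\<close>
  define a where "a = 2 * real k * 2 ^ (t ^ 2) + 2 * real (t * \<kappa>)"
  define c1 where "c1 = a + 2 * real (t * \<kappa>) + real t * real \<kappa> + E"
  define C where "C = 4 * real M * real k + 2 * real k + 2 + 2 * (1 + c1)
    + real (k - 2) * (2 * real M * real k + 4 * real k + a)"
  have a: "a \<ge> 0" by (simp add: a_def)
  have c1: "c1 \<ge> 0" using a E by (simp add: c1_def)
  have C: "C \<ge> 0" using a c1 by (simp add: C_def)
  show ?thesis
  proof (rule that[OF C])
    fix n D d q :: nat and P A deg Q W s L :: real
    assume n: "n \<ge> 1" and P: "P = real (n + 1) ^ (t * \<kappa>)" and A: "A = 2 * real k * 2 ^ (t ^ 2) * P"
      and deg: "1 \<le> deg" "deg \<le> P * real t ^ (\<kappa> * n) * exp (E * sqrt (real n))"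
      and Q: "Q = A * deg powr (1 / real (k - 2))" and D: "D = nat \<lceil>sqrt (real n)\<rceil>"
      and d: "d = nat \<lceil>Q powr (1 / real D)\<rceil>" and q: "q = 1 + M * k * (k * d) ^ D"
      and s: "real d ^ D \<le> s * (real D * real d ^ 2)" and W: "W \<ge> 0"
      and WL: "W * s \<le> 2 * real q ^ (k - 1) * L"
    define x where "x = sqrt (real n)"
    have x: "x \<ge> 1" "x ^ 2 = real n" using n by (auto simp: x_def)
    have xx: "x \<le> x ^ 2" using x(1) by (simp add: power2_eq_square)
    have D_bounds: "x \<le> real D" "real D \<le> 2 * x" "D \<ge> 1"
    proof -
      show "x \<le> real D" unfolding D x_def by linarith
      have "real D < x + 1" using x(1) unfolding D x_def by linarith
      then show "real D \<le> 2 * x" using x(1) by linarith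
      show "D \<ge> 1" using \<open>x \<le> real D\<close> x(1) by linarith
    qed
    have P_le: "P \<le> exp (2 * real (t * \<kappa>) * x)" unfolding P x_def by (rule Suc_power_le_exp_sqrt)
    have P1: "P \<ge> 1" by (simp add: P)
    have A_ge: "A \<ge> 1" unfolding A using k P1 by (intro factor_ge_1) auto
    have A_le: "A \<le> exp (a * x)"
    proof -
      have "2 * real k * 2 ^ (t ^ 2) \<le> exp (2 * real k * 2 ^ (t ^ 2) * x)"
        using x by (intro le_exp_mult) auto
      then have "2 * real k * 2 ^ (t ^ 2) * P \<le> exp (2 * real k * 2 ^ (t ^ 2) * x) * exp (2 * real (t * \<kappa>) * x)"
        using P_le P1 by (intro mult_mono) auto
      then show ?thesis by (simp add: A a_def exp_add[symmetric] algebra_simps)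
    qed
    have deg_le: "deg \<le> exp ((2 * real (t * \<kappa>) + real t * real \<kappa> + E) * x ^ 2)"
    proof -
      have "real t ^ (\<kappa> * n) \<le> exp (real t * real (\<kappa> * n))" by (rule power_le_exp)
      then have "P * real t ^ (\<kappa> * n) * exp (E * sqrt (real n))
          \<le> exp (2 * real (t * \<kappa>) * x) * exp (real t * real (\<kappa> * n)) * exp (E * x)"
        using P_le P1 unfolding x_def by (intro mult_mono) auto
      also have "\<dots> = exp (2 * real (t * \<kappa>) * x + real t * real \<kappa> * x ^ 2 + E * x)"
        by (simp add: exp_add[symmetric] x(2) algebra_simps)
      also have "\<dots> \<le> exp (2 * real (t * \<kappa>) * x ^ 2 + real t * real \<kappa> * x ^ 2 + E * x ^ 2)"
        using xx E by (intro iffD2[OF exp_le_cancel_iff] add_mono mult_left_mono) auto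
      finally show ?thesis using deg(2) by (simp add: algebra_simps)
    qed
    have Q_ge: "Q \<ge> 1"
    proof -
      have "1 \<le> deg powr (1 / real (k - 2))" using deg(1) by (intro ge_one_powr_ge_zero) auto
      with A_ge have "1 * 1 \<le> A * deg powr (1 / real (k - 2))" by (intro mult_mono) auto
      then show ?thesis by (simp add: Q)
    qed
    have Q_le: "Q \<le> exp (c1 * x ^ 2)"
    proof -
      have "deg powr (1 / real (k - 2)) \<le> deg powr 1"
        using deg(1) k by (intro powr_mono) auto
      also have "\<dots> = deg" using deg(1) by simp
      finally have "Q \<le> exp (a * x) * exp ((2 * real (t * \<kappa>) + real t * real \<kappa> + E) * x ^ 2)"
        unfolding Q using deg_le A_le A_ge by (intro mult_mono) auto
      also have "\<dots> = exp (a * x + (2 * real (t * \<kappa>) + real t * real \<kappa> + E) * x ^ 2)"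
        by (simp add: exp_add)
      also have "\<dots> \<le> exp (a * x ^ 2 + (2 * real (t * \<kappa>) + real t * real \<kappa> + E) * x ^ 2)"
        using xx a E by (intro iffD2[OF exp_le_cancel_iff] add_mono mult_left_mono) auto
      finally show ?thesis by (simp add: c1_def algebra_simps)
    qed
    define y where "y = Q powr (1 / real D)"
    have y_ge: "y \<ge> 1" using Q_ge unfolding y_def by (intro ge_one_powr_ge_zero) auto
    have y_pow: "y ^ D = Q" unfolding y_def using Q_ge D_bounds by (intro root_power) auto
    have y_le: "y \<le> exp (c1 * x)"
    proof -
      have "y \<le> exp (c1 * x ^ 2) powr (1 / real D)"
        using Q_le Q_ge unfolding y_def by (intro powr_mono2) auto
      also have "\<dots> = exp (c1 * x ^ 2 / real D)" by (simp add: powr_def)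
      also have "c1 * x ^ 2 / real D \<le> c1 * x"
      proof -
        have "c1 * x * x \<le> c1 * x * real D" using D_bounds c1 x by (intro mult_left_mono) auto
        then show ?thesis using D_bounds by (simp add: divide_simps power2_eq_square)
      qed
      finally show ?thesis by simp
    qed
    have d_bounds: "y \<le> real d" "real d \<le> 2 * y" "d \<ge> 1"
    proof -
      show "y \<le> real d" unfolding d y_def by linarith
      have "real d < y + 1" using y_ge unfolding d y_def[symmetric] by linarith
      then show "real d \<le> 2 * y" using y_ge by linarith
      show "d \<ge> 1" using \<open>y \<le> real d\<close> y_ge by linarith
    qed
    have d_pow: "real d ^ D \<le> 2 ^ D * Q"
      using power_mono[OF d_bounds(2), of D] by (simp add: power_mult_distrib y_pow)
    have d_le: "real d \<le> exp ((1 + c1) * x)"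
    proof -
      have "2 \<le> exp x" using x(1) exp_ge_add_one_self[of x] by linarith
      then have "2 * y \<le> exp x * exp (c1 * x)"
        using y_le y_ge by (intro mult_mono) auto
      then show ?thesis using d_bounds(2) by (simp add: exp_add[symmetric] algebra_simps)
    qed
    define B where "B = 2 * real M * real k"
    have B: "B \<ge> 1"
    proof -
      have "1 * 1 \<le> real M * real k" using M k by (intro mult_mono) auto
      then show ?thesis by (simp add: B_def)
    qed
    have q_le: "real q \<le> B * real k ^ D * real d ^ D"
    proof -
      have "1 \<le> M * k * (k * d) ^ D" using M k d_bounds(3) by (simp add: Suc_le_eq)
      then have "q \<le> 2 * (M * k * (k * d) ^ D)" using q by linarith
      then have "real q \<le> real (2 * (M * k * (k * d) ^ D))" by (rule of_nat_mono)
      then show ?thesis by (simp add: B_def power_mult_distrib mult_ac)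
    qed
    \<comment> \<open>\<open>Y\<close> is the excess of \<open>q\<close> over deg^(1/(k-2)), so
      q^(k-2) exceeds \<open>deg\<close> by at most Y^(k-2).\<close>
    define Y where "Y = B * (2 * real k) ^ D * A"
    have Y: "Y \<ge> 1"
    proof -
      have "1 \<le> (2 * real k) ^ D" using k by (intro one_le_power) auto
      then have "1 * 1 * 1 \<le> B * (2 * real k) ^ D * A" using B A_ge by (intro mult_mono) auto
      then show ?thesis by (simp add: Y_def)
    qed
    have q_pow: "real q ^ (k - 2) \<le> Y ^ (k - 2) * deg"
    proof -
      have "B * real k ^ D * real d ^ D \<le> B * real k ^ D * (2 ^ D * Q)"
        using d_pow B by (intro mult_left_mono) auto
      also have "\<dots> = Y * deg powr (1 / real (k - 2))"
        by (simp add: Y_def Q power_mult_distrib mult_ac)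
      finally have "real q ^ (k - 2) \<le> (Y * deg powr (1 / real (k - 2))) ^ (k - 2)"
        using q_le by (intro power_mono) auto
      also have "\<dots> = Y ^ (k - 2) * (deg powr (1 / real (k - 2))) ^ (k - 2)" by (rule power_mult_distrib)
      also have "(deg powr (1 / real (k - 2))) ^ (k - 2) = deg" using k deg(1) by (intro root_power) auto
      finally show ?thesis .
    qed
    \<comment> \<open>Everything lost apart from \<open>deg\<close>: the excess of q^(k-2), one
      further factor \<open>q\<close> relative to d^D, and the sphere loss.\<close>
    define X where "X = 2 * Y ^ (k - 2) * B * real k ^ D * real D * real d ^ 2"
    have X_pos: "X > 0" using Y B k D_bounds d_bounds by (simp add: X_def)
    have "s > 0"
    proof (rule ccontr)
      assume "\<not> s > 0"
      then have "s * (real D * real d ^ 2) \<le> 0" by (intro mult_nonpos_nonneg) auto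
      moreover have "real d ^ D > 0" using d_bounds by simp
      ultimately show False using s by linarith
    qed
    have "q \<ge> 1" by (simp add: q)
    then have q_pos: "real q > 0" by simp
    have L: "L \<ge> 0"
    proof (rule ccontr)
      assume "\<not> L \<ge> 0"
      then have "2 * real q ^ (k - 1) * L < 0" using q_pos by (intro mult_pos_neg) auto
      moreover have "W * s \<ge> 0" using W \<open>s > 0\<close> by simp
      ultimately show False using WL by linarith
    qed
    have "W * real d ^ D \<le> W * (s * (real D * real d ^ 2))" using s W by (intro mult_left_mono)
    also have "\<dots> = (W * s) * (real D * real d ^ 2)" by simp
    also have "\<dots> \<le> (2 * real q ^ (k - 1) * L) * (real D * real d ^ 2)"
      using WL by (intro mult_right_mono) auto
    also have "real q ^ (k - 1) = real q ^ (k - 2) * real q"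
    proof -
      have "k - 1 = Suc (k - 2)" using k by simp
      then show ?thesis by simp
    qed
    also have "2 * (real q ^ (k - 2) * real q) * L * (real D * real d ^ 2)
        \<le> 2 * ((Y ^ (k - 2) * deg) * (B * real k ^ D * real d ^ D)) * L * (real D * real d ^ 2)"
      using q_pow q_le L Y deg(1) q_pos by (intro mult_right_mono mult_left_mono mult_mono) auto
    also have "\<dots> = (X * deg * L) * real d ^ D" by (simp add: X_def mult_ac)
    finally have "W \<le> X * deg * L" using d_bounds(3) by (simp add: mult_le_cancel_right)
    then have WX: "W / deg \<le> X * L" using deg(1) by (simp add: field_simps)
    have X_le: "X \<le> exp (C * x)"
    proof -
      have B_exp: "B \<le> exp (B * x)" using B x by (intro le_exp_mult) auto
      have B2_exp: "2 * B \<le> exp (2 * B * x)" using B x by (intro le_exp_mult) auto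
      have kD: "real k ^ D \<le> exp (2 * real k * x)"
      proof -
        have "real k * real D \<le> real k * (2 * x)" using D_bounds by (intro mult_left_mono) auto
        then have "exp (real k * real D) \<le> exp (2 * real k * x)" by simp
        then show ?thesis using power_le_exp[of k D] by linarith
      qed
      have k2D: "(2 * real k) ^ D \<le> exp (4 * real k * x)"
      proof -
        have "real (2 * k) * real D \<le> real (2 * k) * (2 * x)" using D_bounds by (intro mult_left_mono) auto
        then have "exp (real (2 * k) * real D) \<le> exp (4 * real k * x)" by simp
        then have "real (2 * k) ^ D \<le> exp (4 * real k * x)" using power_le_exp[of "2 * k" D] by linarith
        then show ?thesis by simp
      qed
      have D_exp: "real D \<le> exp (2 * x)"
        using exp_ge_add_one_self[of "2 * x"] D_bounds(2) by linarith
      have "Y \<le> exp (B * x) * exp (4 * real k * x) * exp (a * x)"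
        unfolding Y_def using B_exp k2D A_le B A_ge by (intro mult_mono) auto
      also have "\<dots> = exp ((B + 4 * real k + a) * x)" by (simp add: exp_add[symmetric] algebra_simps)
      finally have "Y ^ (k - 2) \<le> exp ((B + 4 * real k + a) * x) ^ (k - 2)"
        using Y by (intro power_mono) auto
      then have Y_exp: "Y ^ (k - 2) \<le> exp (real (k - 2) * ((B + 4 * real k + a) * x))"
        by (simp only: exp_of_nat_mult)
      have d2: "real d ^ 2 \<le> exp (2 * ((1 + c1) * x))"
        using power_mono[OF d_le, of 2] by (simp add: exp_double)
      have "X = 2 * B * Y ^ (k - 2) * real k ^ D * real D * real d ^ 2" by (simp add: X_def)
      also have "\<dots> \<le> exp (2 * B * x) * exp (real (k - 2) * ((B + 4 * real k + a) * x)) * exp (2 * real k * x)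
          * exp (2 * x) * exp (2 * ((1 + c1) * x))"
        using B2_exp Y_exp kD D_exp d2 B Y by (intro mult_mono) auto
      also have "\<dots> = exp (2 * B * x + real (k - 2) * ((B + 4 * real k + a) * x) + 2 * real k * x
          + 2 * x + 2 * ((1 + c1) * x))" by (simp only: exp_add)
      also have "\<dots> = exp (C * x)" by (simp add: C_def B_def algebra_simps)
      finally show ?thesis .
    qed
    have "W / deg \<le> exp (C * x) * L" using WX mult_right_mono[OF X_le L] by linarith
    then have "W / deg * exp (- (C * x)) \<le> exp (C * x) * L * exp (- (C * x))" by (intro mult_right_mono) auto
    also have "\<dots> = L" by (simp add: exp_minus)
    finally show "W / deg * exp (- C * sqrt (real n)) \<le> L" by (simp add: x_def)
  qed
qed

section \<open>Sum-free sets in powers of cyclic groups\<close>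

lemma carrier_Zmod_power: "m \<ge> 1 \<Longrightarrow> carrier (Zmod_power m n) = PiE {1..n} (\<lambda>_. {0..<int m})"
  by (simp add: Zmod_power_def carrier_product_group carrier_integer_mod_group)

lemma one_Zmod_power: "\<one>\<^bsub>Zmod_power m n\<^esub> = (\<lambda>t\<in>{1..n}. 0)"
  by (simp add: Zmod_power_def one_product_group one_integer_mod_group)

lemma finprod_Zmod_power:
  assumes m: "m \<ge> 1" and A: "finite A" "\<And>a. a \<in> A \<Longrightarrow> f a \<in> carrier (Zmod_power m n)"
  shows "finprod (Zmod_power m n) f A = (\<lambda>t\<in>{1..n}. (\<Sum>a\<in>A. f a t) mod int m)"
  using A
proof (induction A rule: finite_induct)
  interpret comm_group "Zmod_power m n" by (rule comm_group_Zmod_power)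
  case empty
  show ?case by (simp only: finprod_empty one_Zmod_power) simp
next
  interpret comm_group "Zmod_power m n" by (rule comm_group_Zmod_power)
  case (insert a A)
  have "finprod (Zmod_power m n) f (insert a A) = f a \<otimes>\<^bsub>Zmod_power m n\<^esub> finprod (Zmod_power m n) f A"
    using insert by (intro finprod_insert) auto
  also have "finprod (Zmod_power m n) f A = (\<lambda>t\<in>{1..n}. (\<Sum>a\<in>A. f a t) mod int m)"
    using insert by auto
  also have "f a \<otimes>\<^bsub>Zmod_power m n\<^esub> \<dots> = (\<lambda>t\<in>{1..n}. (\<Sum>a\<in>insert a A. f a t) mod int m)"
    using insert(1,2) by (auto simp: Zmod_power_def mult_product_group mult_integer_mod_group fun_eq_iff mod_simps)
  finally show ?case .
qed

lemma colored_sum_free_singleton: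
  assumes m: "m \<ge> 1"
  shows "colored_sum_free_set (Zmod_power m n) k 1 (\<lambda>_ _. \<lambda>t\<in>{1..n}. 0)"
proof -
  have "(\<lambda>t\<in>{1..n}. 0) \<in> carrier (Zmod_power m n)"
    using m by (auto simp: carrier_Zmod_power)
  then have "finprod (Zmod_power m n) (\<lambda>_. \<lambda>t\<in>{1..n}. 0) {1..k} = \<one>\<^bsub>Zmod_power m n\<^esub>"
    using finprod_Zmod_power[OF m, of "{1..k}" "\<lambda>_. \<lambda>t\<in>{1..n}. 0" n]
    by (auto simp: one_Zmod_power fun_eq_iff)
  with \<open>(\<lambda>t\<in>{1..n}. 0) \<in> carrier (Zmod_power m n)\<close> show ?thesis
    by (auto simp: colored_sum_free_set_def Pi_def)
qed

section \<open>Transfer to powers of the cyclic group\<close>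

context hashing
begin

text \<open>The isolated words occupy \<open>card I\<close> coordinates and all other coordinates
  are 0, so \<open>n\<close> may be any number that is large enough.\<close>

lemma colored_sum_free_isolated:
  assumes n: "card I \<le> n"
  obtains x where "colored_sum_free_set (Zmod_power (Suc N) n) k (card (isolated u b)) x"
proof -
  define K where "K = isolated u b"
  have K_words: "K \<subseteq> words" by (auto simp: K_def isolated_def)
  then have fin_K: "finite K" by (rule finite_subset) simp
  obtain en where en: "bij_betw en {1..card K} K" using ex_bij_betw_nat_finite_1[OF fin_K] by blast
  have en_mem: "en l \<in> K" if "l \<in> {1..card K}" for l using en that by (auto simp: bij_betw_def)
  have "card I \<le> card {1..n}" using n by simp
  then obtain g where g: "inj_on g I" "g ` I \<subseteq> {1..n}"
    using card_le_inj[of I "{1..n}"] by auto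
  define h where "h = inv_into I g"
  have h: "h (g p) = p" if "p \<in> I" for p using g(1) that by (simp add: h_def)
  \<comment> \<open>Adding \<open>1\<close> to the last component turns the target sum \<open>N\<close> into \<open>0\<close> modulo \<open>N + 1\<close>.\<close>
  define x where "x i l = (\<lambda>t\<in>{1..n}. if t \<in> g ` I
      then (int (en l (h t) (i - 1)) + (if i = k then 1 else 0)) mod int (Suc N) else 0)" for i l :: nat
  have x_mem: "x i l \<in> carrier (Zmod_power (Suc N) n)" for i l
    by (auto simp: carrier_Zmod_power x_def)
  have zero_iff: "finprod (Zmod_power (Suc N) n) (\<lambda>i. x i (js i)) {1..k} = \<one>\<^bsub>Zmod_power (Suc N) n\<^esub>
      \<longleftrightarrow> (\<forall>p\<in>I. (\<Sum>j<k. en (js (Suc j)) p j) mod Suc N = N)" for js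
  proof -
    have "finprod (Zmod_power (Suc N) n) (\<lambda>i. x i (js i)) {1..k}
        = (\<lambda>t\<in>{1..n}. (\<Sum>i\<in>{1..k}. x i (js i) t) mod int (Suc N))"
      by (rule finprod_Zmod_power) (auto simp: x_mem)
    then have "finprod (Zmod_power (Suc N) n) (\<lambda>i. x i (js i)) {1..k} = \<one>\<^bsub>Zmod_power (Suc N) n\<^esub>
        \<longleftrightarrow> (\<forall>t\<in>{1..n}. (\<Sum>i\<in>{1..k}. x i (js i) t) mod int (Suc N) = 0)"
      by (auto simp: one_Zmod_power fun_eq_iff restrict_def)
    also have "\<dots> \<longleftrightarrow> (\<forall>t\<in>g ` I. (\<Sum>i\<in>{1..k}. x i (js i) t) mod int (Suc N) = 0)"
    proof -
      have "(\<Sum>i\<in>{1..k}. x i (js i) t) = 0" if "t \<in> {1..n} - g ` I" for t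
        using that by (intro sum.neutral) (auto simp: x_def)
      then show ?thesis using g(2) by fastforce
    qed
    also have "\<dots> \<longleftrightarrow> (\<forall>p\<in>I. (\<Sum>i\<in>{1..k}. x i (js i) (g p)) mod int (Suc N) = 0)" by simp
    also have "\<dots> \<longleftrightarrow> (\<forall>p\<in>I. (\<Sum>j<k. en (js (Suc j)) p j) mod Suc N = N)"
    proof (intro ball_cong refl)
      fix p assume p: "p \<in> I"
      let ?s = "\<Sum>j<k. en (js (Suc j)) p j"
      have gp: "g p \<in> {1..n}" "g p \<in> g ` I" using g(2) p by auto
      have "(\<Sum>i\<in>{1..k}. x i (js i) (g p)) mod int (Suc N)
          = (\<Sum>i\<in>{1..k}. (int (en (js i) p (i - 1)) + (if i = k then 1 else 0)) mod int (Suc N)) mod int (Suc N)"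
        using gp h[OF p] by (simp add: x_def)
      also have "\<dots> = (\<Sum>i\<in>{1..k}. int (en (js i) p (i - 1)) + (if i = k then 1 else 0)) mod int (Suc N)"
        by (rule mod_sum_eq)
      also have "(\<Sum>i\<in>{1..k}. int (en (js i) p (i - 1)) + (if i = k then 1 else 0))
          = (\<Sum>i\<in>{1..k}. int (en (js i) p (i - 1))) + 1"
        using k_ge_3 by (simp add: sum.distrib)
      also have "(\<Sum>i\<in>{1..k}. int (en (js i) p (i - 1))) = int ?s"
        by (subst of_nat_sum, rule sum.reindex_bij_witness[of _ Suc "\<lambda>i. i - 1"]) auto
      finally have "(\<Sum>i\<in>{1..k}. x i (js i) (g p)) mod int (Suc N) = int (Suc ?s mod Suc N)"
        by (simp add: of_nat_mod add.commute)
      moreover have "Suc ?s mod Suc N = 0 \<longleftrightarrow> ?s mod Suc N = N"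
        by (simp add: mod_Suc)
      ultimately show "((\<Sum>i\<in>{1..k}. x i (js i) (g p)) mod int (Suc N) = 0) \<longleftrightarrow> (?s mod Suc N = N)"
        by simp
    qed
    finally show ?thesis .
  qed
  have "colored_sum_free_set (Zmod_power (Suc N) n) k (card K) x"
    unfolding colored_sum_free_set_def zero_iff
  proof (intro conjI ballI iffI)
    fix js i i' assume js: "js \<in> {1..k} \<rightarrow> {1..card K}"
      and cong: "\<forall>p\<in>I. (\<Sum>j<k. en (js (Suc j)) p j) mod Suc N = N"
      and i: "i \<in> {1..k}" "i' \<in> {1..k}"
    have mem: "js i \<in> {1..card K}" if "i \<in> {1..k}" for i using js that by auto
    have all: "en (js (Suc j)) = en (js (Suc 0))" if "j < k" for j
      by (rule isolated_combine[where u = u and b = b and f = "\<lambda>j. en (js (Suc j))", OF _ _ that])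
        (use cong en_mem mem in \<open>auto simp: K_def\<close>)
    have "en (js i) = en (js i')"
      using all[of "i - 1"] all[of "i' - 1"] i by auto
    then show "js i = js i'"
      using en mem i by (auto simp: bij_betw_def dest: inj_onD)
  next
    fix js p assume js: "js \<in> {1..k} \<rightarrow> {1..card K}"
      and eq: "\<forall>i\<in>{1..k}. \<forall>i'\<in>{1..k}. js i = js i'" and p: "p \<in> I"
    have js_eq: "js (Suc j) = js 1" if j: "j < k" for j
    proof -
      have "Suc j \<in> {1..k}" "1 \<in> {1..k}" using j k_ge_3 by simp_all
      then show ?thesis using eq by blast
    qed
    have "(\<Sum>j<k. en (js (Suc j)) p j) = (\<Sum>j<k. en (js 1) p j)"
    proof (intro sum.cong refl)
      fix j assume "j \<in> {..<k}"
      then have "js (Suc j) = js 1" using js_eq by blast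
      then show "en (js (Suc j)) p j = en (js 1) p j" by (simp only:)
    qed
    moreover have "js 1 \<in> {1..card K}" using k_ge_3 by (intro funcset_mem[OF js]) simp
    then have "en (js 1) \<in> solutions"
      using en_mem K_words words_subset_solutions by blast
    then have "(\<Sum>j<k. en (js 1) p j) = N"
      using solutions_mem p by (auto simp: compositions_def)
    ultimately show "(\<Sum>j<k. en (js (Suc j)) p j) mod Suc N = N" by simp
  qed (rule x_mem)
  then show ?thesis using that by (simp add: K_def)
qed

end

text \<open>The derivative vanishes at the interior minimum. In probabilistic terms, the truncated
  geometric law of ratio \<open>g\<close> has mean (m-1)/k.\<close>

lemma minimizer_mean:
  assumes g: "0 < g" "g < 1" and k: "k \<ge> 1"
    and min: "\<And>g'. 0 < g' \<Longrightarrow> g' < 1 \<Longrightarrow> Gamma_fun m k g \<le> Gamma_fun m k g'"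
  shows "real k * (\<Sum>v<m. real v * g ^ v) = (real m - 1) * (\<Sum>v<m. g ^ v)"
proof -
  define a where "a = (real m - 1) / real k"
  define S where "S x = (\<Sum>v<m. x ^ v)" for x :: real
  define S' where "S' = (\<Sum>v<m. real v * g ^ (v - 1))"
  have "(S has_real_derivative S') (at g)"
    unfolding S_def S'_def by (auto intro!: derivative_eq_intros sum.cong)
  moreover have "((\<lambda>x. x powr a) has_real_derivative a * g powr (a - 1)) (at g)"
    using g by (auto intro!: derivative_eq_intros)
  ultimately have "((\<lambda>x. S x / x powr a) has_real_derivative
      (S' * g powr a - S g * (a * g powr (a - 1))) / (g powr a * g powr a)) (at g)"
    using g by (intro DERIV_divide) auto
  moreover have "Gamma_fun m k = (\<lambda>x. S x / x powr a)"
    by (rule ext) (simp add: Gamma_fun_def S_def a_def)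
  ultimately have D: "(Gamma_fun m k has_real_derivative
      (S' * g powr a - S g * (a * g powr (a - 1))) / (g powr a * g powr a)) (at g)" by simp
  have "(S' * g powr a - S g * (a * g powr (a - 1))) / (g powr a * g powr a) = 0"
  proof (rule DERIV_local_min[OF D, of "min g (1 - g)"])
    show "0 < min g (1 - g)" using g by simp
    show "\<forall>y. \<bar>g - y\<bar> < min g (1 - g) \<longrightarrow> Gamma_fun m k g \<le> Gamma_fun m k y"
      using g by (intro allI impI min) (auto simp: abs_less_iff)
  qed
  then have "S' * g powr a = S g * (a * g powr (a - 1))" using g by simp
  also have "\<dots> = S g * a / g * g powr a" using g by (simp add: powr_diff)
  finally have "S' * g powr a = (S g * a / g) * g powr a" .
  moreover have "g powr a \<noteq> 0" using g by simp
  ultimately have "S' = S g * a / g" by (metis mult_right_cancel)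
  then have "g * S' = S g * a" using g by simp
  moreover have "g * S' = (\<Sum>v<m. real v * g ^ v)"
    unfolding S'_def sum_distrib_left
  proof (intro sum.cong refl)
    fix v show "g * (real v * g ^ (v - 1)) = real v * g ^ v" by (cases v) auto
  qed
  ultimately have eq: "(\<Sum>v<m. real v * g ^ v) = S g * a" by simp
  show ?thesis unfolding eq using k by (simp add: S_def a_def)
qed

text \<open>All parameters are chosen here. Lengths are multiples of k!, since a symmetric type
  consists of k! blocks of length n'; \<open>n\<close> may exceed this length.\<close>

lemma large_sum_free_sets:
  fixes k N :: nat and g :: real
  assumes k: "k \<ge> 3" and N: "N \<ge> 1" and g: "0 < g" "g < 1"
    and mean: "real k * (\<Sum>v\<le>N. real v * g ^ v) = real N * (\<Sum>v\<le>N. g ^ v)"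
  defines "\<Gamma> \<equiv> (\<Sum>v\<le>N. g ^ v) / g powr (real N / real k)"
  obtains C where "C \<ge> 0" "\<And>n n'. n' \<ge> 1 \<Longrightarrow> fact k * n' \<le> n \<Longrightarrow>
    \<exists>L x. colored_sum_free_set (Zmod_power (Suc N) n) k L x \<and>
      \<Gamma> ^ (fact k * n') * exp (- C * sqrt (real n')) \<le> real L"
proof -
  let ?T = "compositions k N"
  define G where "G = (\<Sum>v\<le>N. g ^ v)"
  have G: "G \<ge> 1"
  proof -
    have "(\<Sum>v\<in>{0}. g ^ v) \<le> G" unfolding G_def using g by (intro sum_mono2) auto
    then show ?thesis by simp
  qed
  define \<psi> where "\<psi> v = g ^ v / G" for v
  interpret target: mean_target k N \<psi>
  proof
    show "\<psi> (Suc v) \<le> \<psi> v" for v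
      using g G mult_right_mono[of g 1 "g ^ v"] by (simp add: \<psi>_def divide_right_mono)
    show "\<psi> v \<ge> 0" for v using g G by (simp add: \<psi>_def)
    show "(\<Sum>v\<le>N. \<psi> v) = 1" using G by (simp add: \<psi>_def sum_divide_distrib[symmetric] G_def[symmetric])
    have "(\<Sum>v\<le>N. real v * \<psi> v) = (\<Sum>v\<le>N. real v * g ^ v) / G" by (simp add: \<psi>_def sum_divide_distrib)
    then show "real k * (\<Sum>v\<le>N. real v * \<psi> v) = real N" using mean G by (simp add: G_def)
  qed (use k N in auto)
  define t where "t = card ?T"
  have T_ne: "?T \<noteq> {}" using compositions_nonempty[of k N] k by simp
  from T_ne have t: "t \<ge> 1" by (simp add: t_def Suc_le_eq card_gt_0_iff)
  define \<kappa> where "\<kappa> = (fact k :: nat)"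
  have \<kappa>: "\<kappa> \<ge> 1" by (simp add: \<kappa>_def)
  \<comment> \<open>As \<open>q\<close> is 1 modulo (2N)!, it is coprime to 1, ..., 2N.\<close>
  define M where "M = (fact (2 * N) :: nat)"
  have M: "M \<ge> 1" by (simp add: M_def)
  have \<psi>_pos: "\<psi> v > 0" for v using g G by (simp add: \<psi>_def)
  have \<psi>_min: "\<psi> N \<le> \<psi> v" if "v \<le> N" for v
    using that g G by (auto simp: \<psi>_def intro!: divide_right_mono power_decreasing)
  \<comment> \<open>The relative error of a marginal, which is worst at the least likely digit
    \<open>N\<close>, accumulated over all k! n' positions and divided by sqrt n'.\<close>
  define E where "E = real \<kappa> * (2 * sqrt (ln (real t))) / (real k * \<psi> N)"
  have E: "E \<ge> 0" using t \<psi>_pos[of N] by (simp add: E_def)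
  obtain C where C: "C \<ge> 0" and loss:
    "\<And>n D d q :: nat. \<And>P A deg Q W s L :: real.
      n \<ge> 1 \<Longrightarrow> P = real (n + 1) ^ (t * \<kappa>) \<Longrightarrow> A = 2 * real k * 2 ^ (t ^ 2) * P \<Longrightarrow>
      1 \<le> deg \<Longrightarrow> deg \<le> P * real t ^ (\<kappa> * n) * exp (E * sqrt (real n)) \<Longrightarrow>
      Q = A * deg powr (1 / real (k - 2)) \<Longrightarrow> D = nat \<lceil>sqrt (real n)\<rceil> \<Longrightarrow> d = nat \<lceil>Q powr (1 / real D)\<rceil> \<Longrightarrow>
      q = 1 + M * k * (k * d) ^ D \<Longrightarrow> real d ^ D \<le> s * (real D * real d ^ 2) \<Longrightarrow> W \<ge> 0 \<Longrightarrow>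
      W * s \<le> 2 * real q ^ (k - 1) * L \<Longrightarrow>
      W / deg * exp (- C * sqrt (real n)) \<le> L"
    using loss_bound[OF k t \<kappa> M E] by blast
  have \<Gamma>_ge: "\<Gamma> \<ge> 1"
  proof -
    have "g powr (real N / real k) \<le> 1" using g by (intro powr_le1) auto
    then show ?thesis using G g by (simp add: \<Gamma>_def G_def[symmetric] le_divide_eq)
  qed
  define C' where "C' = C + E + 2 * real (t * \<kappa>)"
  have C': "C' \<ge> 0" using C E by (simp add: C'_def)
  show ?thesis
  proof (rule that[OF C'])
    fix n n' :: nat assume n': "n' \<ge> 1" and n: "fact k * n' \<le> n"
    define x where "x = sqrt (real n')"
    have x: "x \<ge> 1" "x ^ 2 = real n'" using n' by (auto simp: x_def)
    define \<nu> where "\<nu> = \<kappa> * n'"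
    define \<eta> where "\<eta> = 2 * sqrt (ln (real t)) / sqrt (real n')"
    have \<eta>: "\<eta> \<ge> 0" using t by (simp add: \<eta>_def)
    have E_eq: "real \<nu> * (\<eta> / (real k * \<psi> N)) = E * x"
    proof -
      have "real \<nu> * (\<eta> / (real k * \<psi> N))
          = real \<kappa> * (2 * sqrt (ln (real t))) / (real k * \<psi> N) * (real n' / sqrt (real n'))"
        by (simp add: \<eta>_def \<nu>_def mult_ac)
      also have "real n' / sqrt (real n') = x" by (simp add: x_def real_div_sqrt)
      finally show ?thesis by (simp only: E_def)
    qed
    obtain \<theta> where \<theta>: "\<And>v. v \<le> N \<Longrightarrow>
        \<bar>mean_count k N (gibbs k \<theta>) v / (\<Sum>a\<in>?T. gibbs k \<theta> a) - real k * \<psi> v\<bar> \<le> \<eta>"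
      using target.gibbs_approximation[OF n'] unfolding \<eta>_def t_def by blast
    define Z where "Z = (\<Sum>a\<in>?T. gibbs k \<theta> a)"
    have Z: "Z > 0" unfolding Z_def using T_ne by (intro sum_pos) auto
    have marginal: "(\<Sum>a | a \<in> ?T \<and> a i = v. gibbs k \<theta> a) \<le> Z * (\<psi> v * exp (\<eta> / (real k * \<psi> N)))"
      if i: "i < k" and v: "v \<le> N" for i v
    proof -
      have "mean_count k N (gibbs k \<theta>) v / Z \<le> real k * \<psi> v + \<eta>" using \<theta>[OF v] by (simp add: Z_def abs_le_iff)
      then have "real k * (\<Sum>a | a \<in> ?T \<and> a i = v. gibbs k \<theta> a) \<le> (real k * \<psi> v + \<eta>) * Z"
        using Z gibbs_marginal[OF i, where N = N and v = v and \<theta> = \<theta>] by (simp add: field_simps)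
      then have "(\<Sum>a | a \<in> ?T \<and> a i = v. gibbs k \<theta> a) \<le> Z * (\<psi> v + \<eta> / real k)"
        using k by (simp add: field_simps)
      also have "\<psi> v + \<eta> / real k \<le> \<psi> v * exp (\<eta> / (real k * \<psi> N))"
      proof -
        have "\<eta> / real k = \<psi> N * (\<eta> / (real k * \<psi> N))" using \<psi>_pos[of N] by simp
        also have "\<dots> \<le> \<psi> v * (\<eta> / (real k * \<psi> N))"
          using \<psi>_min[OF v] \<eta> \<psi>_pos[of N] by (intro mult_right_mono) auto
        finally have "\<psi> v + \<eta> / real k \<le> \<psi> v * (1 + \<eta> / (real k * \<psi> N))" by (simp add: algebra_simps)
        also have "\<dots> \<le> \<psi> v * exp (\<eta> / (real k * \<psi> N))"
          using \<psi>_pos[of v] by (intro mult_left_mono exp_ge_add_one_self) auto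
        finally show ?thesis .
      qed
      finally show ?thesis using Z by (simp add: mult_left_mono)
    qed
    define I where "I = {\<sigma>. \<sigma> permutes {..<k}} \<times> {..<n'}"
    have fin_I: "finite I" by (simp add: I_def finite_permutations)
    have card_I: "card I = \<nu>" by (simp add: I_def \<nu>_def \<kappa>_def card_cartesian_product card_permutations)
    obtain c where c_sym: "\<And>\<sigma> a. \<sigma> permutes {..<k} \<Longrightarrow> c (a \<circ> \<sigma>) = c a" and
      c_large: "(Z ^ n' / real (n' + 1) ^ t) ^ \<kappa>
      \<le> (\<Sum>e | e \<in> PiE I (\<lambda>_. ?T) \<and> (\<forall>a. card {p \<in> I. e p = a} = c a). \<Prod>p\<in>I. gibbs k \<theta> (e p))"
      using symmetric_type[OF n', of k \<theta> N] unfolding I_def Z_def t_def \<kappa>_def by blast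
    define words0 where "words0 = {e \<in> PiE I (\<lambda>_. ?T). \<forall>a. card {p \<in> I. e p = a} = c a}"
    define P where "P = real (n' + 1) ^ (t * \<kappa>)"
    have P: "P > 0" by (simp add: P_def)
    have c_large': "Z ^ \<nu> / P \<le> (\<Sum>e\<in>words0. \<Prod>p\<in>I. gibbs k \<theta> (e p))"
    proof -
      have "(Z ^ n' / real (n' + 1) ^ t) ^ \<kappa> = Z ^ \<nu> / P"
        by (simp add: power_divide power_mult[symmetric] \<nu>_def P_def mult.commute)
      then show ?thesis using c_large by (simp add: words0_def)
    qed
    moreover have "Z ^ \<nu> / P > 0" using Z P by simp
    ultimately have "words0 \<noteq> {}" by auto
    then obtain e0 where e0: "e0 \<in> words0" by blast
    define w where "w = (\<Prod>p\<in>I. gibbs k \<theta> (e0 p))"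
    have w: "w > 0" unfolding w_def by (intro prod_pos) auto
    \<comment> \<open>Upper bound for the number of words through one component: the product of the
      marginals, at most Z^\<nu> exp(E x) / \<Gamma>^\<nu>, divided by the common weight
      \<open>w\<close> of a word.\<close>
    define deg where "deg = Z ^ \<nu> * exp (E * x) / (\<Gamma> ^ \<nu> * w)"
    \<comment> \<open>\<open>A\<close> is twice the constant factor in \<open>conflict_sum\<close>.
      With q at least \<open>Q = A * deg powr (1 / (k - 2))\<close> the conflicts of a word
      therefore sum to at most 1/2.\<close>
    define A where "A = 2 * real k * 2 ^ (t ^ 2) * P"
    define Q where "Q = A * deg powr (1 / real (k - 2))"
    define D where "D = nat \<lceil>sqrt (real n')\<rceil>"
    define d where "d = nat \<lceil>Q powr (1 / real D)\<rceil>"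
    define q where "q = 1 + M * k * (k * d) ^ D"
    have D: "D \<ge> 1" using x(1) unfolding D_def x_def by linarith
    have deg_pos: "deg > 0" using Z w \<Gamma>_ge by (simp add: deg_def)
    have A_pos: "A > 0" using k P by (simp add: A_def)
    have Q_pos: "Q > 0" using A_pos deg_pos by (simp add: Q_def)
    have d_ge: "Q powr (1 / real D) \<le> real d" unfolding d_def by linarith
    have d: "d \<ge> 1"
    proof -
      have "0 < Q powr (1 / real D)" using Q_pos by simp
      then have "0 < real d" using d_ge by linarith
      then show ?thesis by simp
    qed
    have hashed: "\<exists>L x. colored_sum_free_set (Zmod_power (Suc N) n) k L x \<and>
        \<Gamma> ^ (fact k * n') * exp (- C' * sqrt (real n')) \<le> real L"
      if hash: "hashing k q N I c S" and S_large: "d ^ D \<le> card S * (D * d ^ 2)" for S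
    proof -
      interpret hashing k q N I c S by (rule hash)
      have words: "words = words0" by (simp add: words_def words0_def)
      have e0_words: "e0 \<in> words" using e0 words by simp
      have e0_sol: "e0 \<in> solutions" using e0_words words_subset_solutions by blast
      have card_words_pos: "card words > 0" using e0_words by (auto simp: card_gt_0_iff)
      have words_w: "Z ^ \<nu> / P \<le> real (card words) * w"
        using c_large' card_words_weight[OF e0_words, of \<theta>] by (simp add: words w_def)
      have sol_w: "real (card solutions) * w \<le> Z ^ \<nu>"
        using card_solutions_weight[OF e0_sol, of \<theta>] by (simp add: w_def Z_def card_I)
      have ratio: "real (card solutions) / real (card words) \<le> P"
      proof -
        have "real (card solutions) * w \<le> (P * real (card words)) * w"
          using sol_w words_w P by (simp add: field_simps)
        then show ?thesis using w card_words_pos by (simp add: divide_le_eq)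
      qed
      have share_le: "real (card {e' \<in> words. share e e' i}) \<le> deg" if e: "e \<in> words" and i: "i < k" for e i
      proof -
        have e_sol: "e \<in> solutions" using e words_subset_solutions by blast
        have le: "e p i \<le> N" if "p \<in> I" for p
          using compositions_le[OF solutions_mem[OF e_sol that]] .
        have "real (card {e' \<in> words. share e e' i}) * w \<le> (\<Prod>p\<in>I. \<Sum>a | a \<in> ?T \<and> a i = e p i. gibbs k \<theta> a)"
          using card_share_weight[OF e, of i \<theta>] weight_solutions[OF e_sol e0_sol, of \<theta>] by (simp add: w_def)
        also have "\<dots> \<le> (\<Prod>p\<in>I. Z * (\<psi> (e p i) * exp (\<eta> / (real k * \<psi> N))))"
          using marginal[OF i le] by (intro prod_mono conjI sum_nonneg) (auto simp: less_imp_le)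
        also have "\<dots> = Z ^ \<nu> * ((\<Prod>p\<in>I. \<psi> (e p i)) * exp (\<eta> / (real k * \<psi> N)) ^ \<nu>)"
          by (simp add: prod.distrib card_I)
        also have "exp (\<eta> / (real k * \<psi> N)) ^ \<nu> = exp (E * x)"
          using E_eq by (simp add: exp_of_nat_mult[symmetric])
        \<comment> \<open>Under a geometric law a component's probability depends only on its digit
          sum, here \<nu> N / k; this is exactly where the value of \<Gamma> arises.\<close>
        also have "(\<Prod>p\<in>I. \<psi> (e p i)) = 1 / \<Gamma> ^ \<nu>"
        proof -
          have "(\<Prod>p\<in>I. \<psi> (e p i)) = g ^ (\<Sum>p\<in>I. e p i) / G ^ \<nu>"
            by (simp add: \<psi>_def prod_dividef power_sum card_I)
          also have "g ^ (\<Sum>p\<in>I. e p i) = (g powr (real N / real k)) ^ \<nu>"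
          proof -
            have "real (k * (\<Sum>p\<in>I. e p i)) = real (\<nu> * N)"
              using solution_digit_sum[OF e_sol i] card_I by (simp only:)
            then have *: "real (\<Sum>p\<in>I. e p i) = real N / real k * real \<nu>" using k by (simp add: field_simps)
            have "g ^ (\<Sum>p\<in>I. e p i) = g powr real (\<Sum>p\<in>I. e p i)" using g by (simp only: powr_realpow)
            also have "\<dots> = (g powr (real N / real k)) powr real \<nu>" by (simp only: * powr_powr)
            also have "\<dots> = (g powr (real N / real k)) ^ \<nu>" using g by (intro powr_realpow) simp
            finally show ?thesis .
          qed
          also have "(g powr (real N / real k)) ^ \<nu> / G ^ \<nu> = 1 / \<Gamma> ^ \<nu>"
            by (simp add: \<Gamma>_def G_def power_divide)
          finally show ?thesis .
        qed
        finally have "real (card {e' \<in> words. share e e' i}) * w \<le> deg * w"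
          using w by (simp add: deg_def)
        then show ?thesis using w by simp
      qed
      have deg1: "deg \<ge> 1"
      proof -
        have "card {e' \<in> words. share e0 e' 0} > 0" using e0_words by (auto simp: card_gt_0_iff share_def)
        then show ?thesis using share_le[OF e0_words, of 0] k by linarith
      qed
      \<comment> \<open>A crude estimate through \<open>card words\<close>; it serves to keep ln Q
        linear in n'.\<close>
      have deg_upper: "deg \<le> P * real t ^ (\<kappa> * n') * exp (E * sqrt (real n'))"
      proof -
        have "card words \<le> card (PiE I (\<lambda>_. ?T))" by (intro card_mono) (auto simp: words_def)
        also have "\<dots> = t ^ \<nu>" using fin_I by (simp add: card_PiE t_def card_I)
        finally have cw: "real (card words) \<le> real t ^ \<nu>" by (metis of_nat_mono of_nat_power)
        have "Z ^ \<nu> / w \<le> P * real (card words)" using words_w P w by (simp add: field_simps)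
        also have "\<dots> \<le> P * real t ^ \<nu>" using cw P by (intro mult_left_mono) auto
        finally have Zw: "Z ^ \<nu> / w \<le> P * real t ^ \<nu>" .
        have "\<Gamma> ^ \<nu> \<ge> 1" using \<Gamma>_ge by (rule one_le_power)
        then have "deg \<le> Z ^ \<nu> / w * exp (E * x)"
          using Z w by (simp add: deg_def field_simps mult_le_cancel_left1)
        also have "\<dots> \<le> P * real t ^ \<nu> * exp (E * x)" using Zw by (intro mult_right_mono) auto
        finally show ?thesis by (simp add: \<nu>_def x_def)
      qed
      have Q_le_q: "Q \<le> real q"
      proof -
        have "Q = (Q powr (1 / real D)) ^ D" using root_power[OF Q_pos D] by simp
      also have "\<dots> \<le> real d ^ D" using d_ge by (intro power_mono) auto
        also have "\<dots> = real (d ^ D)" by simp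
        also have "\<dots> \<le> real q"
        proof (rule of_nat_mono)
          have "d ^ D \<le> (k * d) ^ D" using k by (intro power_mono) auto
          also have "\<dots> \<le> M * k * (k * d) ^ D" using M k by simp
          finally show "d ^ D \<le> q" by (simp add: q_def)
        qed
        finally show ?thesis .
      qed
      define h where "h = ln deg / (real (k - 2) * ln (real q))"
      have q_gt1: "real q > 1" using q_ge_2 by simp
      have q_powr_h: "real q powr h = deg powr (1 / real (k - 2))"
        using deg_pos q_gt1 by (simp add: h_def powr_def)
      have A_q: "A * real q powr h \<le> real q" using Q_le_q by (simp add: q_powr_h Q_def)
      have A_ge: "A \<ge> 1" unfolding A_def using k by (intro factor_ge_1) (auto simp: P_def)
      have h1: "h \<le> 1"
      proof -
        have "1 * real q powr h \<le> A * real q powr h" using A_ge by (intro mult_right_mono) auto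
        also have "\<dots> \<le> real q" by (rule A_q)
        finally have "real q powr h \<le> real q powr 1" using q_gt1 by simp
        then show ?thesis by (rule powr_le_cancel_iff[OF q_gt1, THEN iffD1])
      qed
      have conf: "(\<Sum>e'\<in>conflicts e. 1 / real (density (lattice_span (diff_set e e')))) \<le> 1 / 2"
        if e: "e \<in> words" for e
      proof -
        have "(\<Sum>e'\<in>conflicts e. 1 / real (density (lattice_span (diff_set e e'))))
            \<le> real k * 2 ^ (t ^ 2) * (real (card solutions) / real (card words)) * real q powr (h - 1)"
          unfolding t_def by (rule conflict_sum[OF e deg1 share_le[OF e] h_def h1])
        also have "\<dots> \<le> real k * 2 ^ (t ^ 2) * P * real q powr (h - 1)"
          using ratio by (intro mult_right_mono mult_left_mono) auto
        also have "\<dots> = A / 2 * (real q powr h / real q)" using q_gt1 by (simp add: A_def powr_diff)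
        also have "\<dots> \<le> 1 / 2" using A_q q_gt1 by (simp add: field_simps)
        finally show ?thesis .
      qed
      obtain u b where ub: "real (card words) * real (card S) \<le> 2 * real q ^ (k - 1) * real (card (isolated u b))"
        using many_isolated[OF conf] by blast
      define L where "L = card (isolated u b)"
      have "real d ^ D \<le> real (card S) * (real D * real d ^ 2)"
        using of_nat_mono[OF S_large, where 'a = real] by simp
      then have "real (card words) / deg * exp (- C * sqrt (real n')) \<le> real L"
        by (rule loss[OF n' P_def A_def deg1 deg_upper Q_def D_def d_def q_def]) (use ub in \<open>simp_all add: L_def\<close>)
      moreover have "\<Gamma> ^ \<nu> * exp (- E * x) / P \<le> real (card words) / deg"
      proof -
        have "\<Gamma> ^ \<nu> * exp (- E * x) / P * deg = Z ^ \<nu> / P / w"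
          using w \<Gamma>_ge by (simp add: deg_def exp_minus field_simps)
        also have "\<dots> \<le> real (card words)" by (rule pos_divide_le_eq[OF w, THEN iffD2, OF words_w])
        finally show ?thesis using deg_pos by (simp add: le_divide_eq)
      qed
      then have "\<Gamma> ^ \<nu> * exp (- E * x) / P * exp (- C * x) \<le> real (card words) / deg * exp (- C * x)"
        by (intro mult_right_mono) auto
      ultimately have L_ge: "\<Gamma> ^ \<nu> * exp (- E * x) / P * exp (- C * x) \<le> real L" by (simp add: x_def)
      have P_le: "P \<le> exp (2 * real (t * \<kappa>) * x)" unfolding P_def x_def by (rule Suc_power_le_exp_sqrt)
      have "exp (- C' * x) = exp (- E * x) * exp (- (2 * real (t * \<kappa>) * x)) * exp (- C * x)"
        by (simp add: C'_def exp_add[symmetric] algebra_simps)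
      also have "\<dots> \<le> exp (- E * x) * (1 / P) * exp (- C * x)"
        using P_le P by (intro mult_right_mono mult_left_mono) (auto simp: exp_minus inverse_eq_divide divide_simps)
      finally have "\<Gamma> ^ \<nu> * exp (- C' * x) \<le> \<Gamma> ^ \<nu> * (exp (- E * x) * (1 / P) * exp (- C * x))"
        using \<Gamma>_ge by (intro mult_left_mono) auto
      with L_ge have "\<Gamma> ^ \<nu> * exp (- C' * x) \<le> real L" by simp
      moreover obtain X where "colored_sum_free_set (Zmod_power (Suc N) n) k L X"
        using colored_sum_free_isolated[of n u b] n card_I unfolding L_def \<nu>_def \<kappa>_def by auto
      ultimately show ?thesis
        unfolding \<nu>_def \<kappa>_def x_def by blast
    qed
    obtain S where S: "S \<subseteq> {..<(k * d) ^ D}" "d ^ D \<le> card S * (D * d ^ 2)"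
      and S_avg: "\<forall>s. (\<forall>j<k. s j \<in> S) \<longrightarrow> (\<Sum>j<k - 1. s j) = (k - 1) * s (k - 1) \<longrightarrow>
        (\<forall>j<k. s j = s (k - 1))"
    proof (rule behrend_set[of k d D])
      show "k \<ge> 2" using k by simp
    qed (use d D in \<open>blast+\<close>)
    have kd: "(k * d) ^ D \<ge> 1" using k d by simp
    have "hashing k q N I c S"
    proof
      show "q \<ge> 2" using M k kd by (simp add: q_def Suc_le_eq)
      show "coprime u q" if u: "1 \<le> u" "u \<le> 2 * N" for u
      proof -
        have "u dvd M" unfolding M_def using u by (intro dvd_fact) auto
        then have "u dvd M * k * (k * d) ^ D" by (simp add: dvd_mult2)
        then obtain r where r: "M * k * (k * d) ^ D = u * r" by (rule dvdE)
        have "coprime u (1 + u * r)"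
        proof (rule coprimeI)
          fix l assume "l dvd u" "l dvd 1 + u * r"
          then show "l dvd 1" using dvd_add_left_iff[of l "u * r" 1] dvd_mult2[of l u r] by blast
        qed
        then show ?thesis by (simp only: q_def r)
      qed
      show "k * s < q" if "s \<in> S" for s
      proof -
        have "s < (k * d) ^ D" using S(1) that by auto
        then have "k * s \<le> k * (k * d) ^ D" by (intro mult_left_mono) auto
        also have "\<dots> \<le> M * (k * (k * d) ^ D)" using M by simp
        finally have "k * s \<le> M * k * (k * d) ^ D" by (simp only: mult.assoc)
        then show ?thesis unfolding q_def by linarith
      qed
      show "\<And>s j. (\<And>j. j < k \<Longrightarrow> s j \<in> S) \<Longrightarrow> (\<Sum>j<k - 1. s j) = (k - 1) * s (k - 1) \<Longrightarrow> j < k \<Longrightarrow> s j = s (k - 1)"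
        using S_avg by blast
    qed (use k N fin_I c_sym in auto)
    then show "\<exists>L x. colored_sum_free_set (Zmod_power (Suc N) n) k L x \<and>
        \<Gamma> ^ (fact k * n') * exp (- C' * sqrt (real n')) \<le> real L"
      using S(2) by (rule hashed)
  qed
qed

theorem theorem1p3:
  fixes m k :: nat
  assumes "m \<ge> 2" and "k \<ge> 3"
  shows "\<exists>C::real. \<forall>n::nat. n \<ge> 1 \<longrightarrow>
           (\<exists>(L::nat) (x :: nat \<Rightarrow> nat \<Rightarrow> nat \<Rightarrow> int).
              colored_sum_free_set (Zmod_power m n) k L x \<and>
              real L \<ge> Gamma_min m k powr (real n - C * sqrt (real n)))"
proof -
  define N where "N = m - 1"
  have N: "N \<ge> 1" "m = Suc N" "real m - 1 = real N" using assms(1) by (simp_all add: N_def of_nat_diff)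
  obtain g where g: "0 < g" "g < 1" and \<Gamma>g: "Gamma_min m k = Gamma_fun m k g"
    using Gamma_min_attained(1)[OF assms] by auto
  have \<Gamma>_eq: "Gamma_min m k = (\<Sum>v\<le>N. g ^ v) / g powr (real N / real k)"
    unfolding \<Gamma>g Gamma_fun_def N(3) by (simp add: N(2) lessThan_Suc_atMost)
  have "real k * (\<Sum>v<m. real v * g ^ v) = (real m - 1) * (\<Sum>v<m. g ^ v)"
    using Gamma_min_attained(2)[OF assms] assms(2) by (intro minimizer_mean[OF g]) (auto simp: \<Gamma>g)
  then have mean: "real k * (\<Sum>v\<le>N. real v * g ^ v) = real N * (\<Sum>v\<le>N. g ^ v)"
    by (simp add: N(2) lessThan_Suc_atMost)
  define \<Gamma> where "\<Gamma> = Gamma_min m k"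
  have \<Gamma>_gt: "\<Gamma> > 1"
  proof -
    have "(\<Sum>v\<in>{0, 1}. g ^ v) \<le> (\<Sum>v\<le>N. g ^ v)" using g N by (intro sum_mono2) auto
    then have "1 < (\<Sum>v\<le>N. g ^ v)" using g by simp
    moreover have "g powr (real N / real k) \<le> 1" "0 < g powr (real N / real k)"
      using g by (auto intro!: powr_le1)
    ultimately show ?thesis by (simp add: \<Gamma>_def \<Gamma>_eq less_divide_eq)
  qed
  obtain C where C: "C \<ge> 0" and large: "\<And>n n'. n' \<ge> 1 \<Longrightarrow> fact k * n' \<le> n \<Longrightarrow>
    \<exists>L x. colored_sum_free_set (Zmod_power m n) k L x \<and>
      \<Gamma> ^ (fact k * n') * exp (- C * sqrt (real n')) \<le> real L"
    by (rule large_sum_free_sets[OF assms(2) N(1) g mean, folded \<Gamma>_eq \<Gamma>_def N(2)]) (rule that)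
  \<comment> \<open>k! pays for rounding \<open>n\<close> down to a multiple of k!, and C / ln
    \<Gamma> expresses the exponential loss in base \<Gamma>.\<close>
  define C' where "C' = real (fact k) + C / ln \<Gamma>"
  have ln_pos: "ln \<Gamma> > 0" using \<Gamma>_gt by simp
  have "\<exists>L x. colored_sum_free_set (Zmod_power m n) k L x \<and>
      real L \<ge> \<Gamma> powr (real n - C' * sqrt (real n))" if n: "n \<ge> 1" for n
  proof -
    define n' where "n' = n div fact k"
    have n'_le: "fact k * n' \<le> n" by (simp add: n'_def)
    have n_lt: "n < fact k * n' + fact k"
      using dividend_less_times_div[of "fact k" n] by (simp add: n'_def)
    have sqrt_n: "sqrt (real n) \<ge> 1" using n by simp
    have fact_le: "real (fact k) \<le> real (fact k) * sqrt (real n)" using sqrt_n by simp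
    show ?thesis
    proof (cases "n' = 0")
      case True
      \<comment> \<open>For such short lengths the exponent is not positive and a single tuple
        suffices.\<close>
      have "n \<le> fact k" using n_lt True by simp
      then have "real n \<le> real (fact k)" by (rule of_nat_mono)
      also have "\<dots> \<le> C' * sqrt (real n)"
      proof -
        have "real (fact k) \<le> C'" using C ln_pos by (simp add: C'_def)
        moreover have "C' \<ge> 0" using C ln_pos by (simp add: C'_def)
        ultimately have "real (fact k) * 1 \<le> C' * sqrt (real n)" using sqrt_n by (intro mult_mono) auto
        then show ?thesis by simp
      qed
      finally have "\<Gamma> powr (real n - C' * sqrt (real n)) \<le> \<Gamma> powr 0"
        using \<Gamma>_gt by (intro powr_mono) auto
      then have "\<Gamma> powr (real n - C' * sqrt (real n)) \<le> real 1" using \<Gamma>_gt by simp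
      moreover have "colored_sum_free_set (Zmod_power m n) k 1 (\<lambda>_ _. \<lambda>t\<in>{1..n}. 0)"
        using assms(1) by (intro colored_sum_free_singleton) simp
      ultimately show ?thesis by blast
    next
      case False
      then have n': "n' \<ge> 1" by simp
      obtain L x where Lx: "colored_sum_free_set (Zmod_power m n) k L x"
        and L: "\<Gamma> ^ (fact k * n') * exp (- C * sqrt (real n')) \<le> real L"
        using large[OF n' n'_le] by blast
      have "n' \<le> n"
        using n'_le by (metis fact_ge_1 le_trans mult_le_mono1 nat_mult_1)
      then have "C * sqrt (real n') \<le> C * sqrt (real n)" using C by (intro mult_left_mono) auto
      moreover have "real n - real (fact k) * sqrt (real n) \<le> real (fact k * n')"
      proof -
        have "real n \<le> real (fact k * n' + fact k)" using n_lt by (intro of_nat_mono) simp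
        then have "real n \<le> real (fact k * n') + real (fact k)" by (simp only: of_nat_add)
        then show ?thesis using fact_le by linarith
      qed
      then have "(real n - real (fact k) * sqrt (real n)) * ln \<Gamma> \<le> real (fact k * n') * ln \<Gamma>"
        using ln_pos by (intro mult_right_mono) auto
      ultimately have "(real n - C' * sqrt (real n)) * ln \<Gamma> \<le> real (fact k * n') * ln \<Gamma> - C * sqrt (real n')"
        using ln_pos by (simp add: C'_def algebra_simps)
      then have "exp ((real n - C' * sqrt (real n)) * ln \<Gamma>) \<le> exp (real (fact k * n') * ln \<Gamma> - C * sqrt (real n'))"
        by simp
      also have "\<dots> = \<Gamma> ^ (fact k * n') * exp (- C * sqrt (real n'))"
      proof -
        have "exp (real (fact k * n') * ln \<Gamma>) = \<Gamma> ^ (fact k * n')"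
          using \<Gamma>_gt by (simp add: exp_of_nat_mult del: of_nat_mult of_nat_fact)
        then show ?thesis by (simp add: exp_diff exp_minus divide_inverse)
      qed
      finally have "\<Gamma> powr (real n - C' * sqrt (real n)) \<le> real L"
        using L \<Gamma>_gt by (simp add: powr_def)
      with Lx show ?thesis by blast
    qed
  qed
  then show ?thesis unfolding \<Gamma>_def by blast
qed

end
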